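(* Let $\gamma_n\searrow0$, $\delta_n\searrow0$ be sequences of positive numbers with $0<\delta_n\le\rho$ for all $n\in\mathbb N$ and $\gamma_n/\delta_n^{d}\to0$ as $n\to\infty$. Let $\{(\pi_n,\mu_1^n,c_n)\}_{n\in\mathbb N}\subset\mathfrak M(\Omega)\times\mathfrak M(\Omega_1)\times W^{1,p}(\Omega)$ be a sequence such that $(\pi_n,\mu_1^n,c_n)$ is feasible for the regularized bilevel problem $(\mathrm{BK}_n)$ for every $n\in\mathbb N$. If $(\pi,\mu_1,c_{\mathrm d})\in\mathfrak M(\Omega)\times\mathfrak M(\Omega_1)\times W^{1,p}(\Omega)$ is an accumulation point of this sequence with respect to weak-$*$ convergence in $\mathfrak M(\Omega)\times\mathfrak M(\Omega_1)$ and weak convergence in $W^{1,p}(\Omega)$, then $(\pi,\mu_1)$ is feasible for $(\mathrm{BK})$, i.e. $\mu_1\in\mathfrak P(\Omega_1)$, $\mathrm{dist}(\mathrm{supp}(\mu_1),\partial\Omega_1)\ge\rho$, and $\pi$ is optimal for the Kantorovich problem with marginals $\mu_1$ and $\mu_2^{\mathrm d}$ and cost function $c_{\mathrm d}$, that is, $\pi$ minimizes $\int_\Omega c_{\mathrm d}\,d\varphi$ over all $\varphi\in\Pi(\mu_1,\mu_2^{\mathrm d})$ with $\varphi\ge0$.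
   Context: Domains. $d_1,d_2\in\mathbb N$; $\Omega_i\subset\mathbb R^{d_i}$ ($i=1,2$) are compact with non-empty interior; $\Omega:=\Omega_1\times\Omega_2$ coincides with the closure of its interior and has a Lipschitz boundary; $d:=d_1+d_2$. $\lambda_i$ and $\lambda=\lambda_1\otimes\lambda_2$ are the Lebesgue measures on $\Omega_i$ and $\Omega$; $|\Omega_i|:=\lambda_i(\Omega_i)$. $W^{1,p}(\Omega)$ denotes the Sobolev space on the interior of $\Omega$. Measures. For compact $X$, $\mathfrak M(X)$ is the space of signed regular Borel measures with the total variation norm, identified with the dual of $C(X)$. $\mathfrak P(\Omega_i)$ is the set of probability measures in $\mathfrak M(\Omega_i)$. $P_i:\Omega_1\times\Omega_2\to\Omega_i$ is the coordinate projection, ${P_i}_\#\pi=\pi\circ P_i^{-1}$, and $\Pi(\mu_1,\mu_2):=\{\pi\in\mathfrak M(\Omega):{P_1}_\#\pi=\mu_1,\ {P_2}_\#\pi=\mu_2\}$. A non-negative $L^2(\Omega)$-function is identified with the measure having it as Lebesgue density. Accumulation points are limits of subsequences. Data. $\rho>0$ is fixed; $\mu_2^{\mathrm d}\in\mathfrak P(\Omega_2)$ satisfies $\mathrm{dist}(\mathrm{supp}(\mu_2^{\mathrm d}),\partial\Omega_2)\ge\rho$; $c_{\mathrm d}\in W^{1,p}(\Omega)$ with $p>d$ (with its continuous representative on $\Omega$). Feasible set of $(\mathrm{BK})$: all $(\pi,\mu_1)$ with $\mu_1\in\mathfrak P(\Omega_1)$, $\mathrm{dist}(\mathrm{supp}(\mu_1),\partial\Omega_1)\ge\rho$,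 and $\pi\in\arg\min\{\int_\Omega c_{\mathrm d}\,d\varphi:\varphi\in\Pi(\mu_1,\mu_2^{\mathrm d}),\ \varphi\ge0\}$. It is assumed that this set is non-empty. Regularized lower level. For $\gamma>0$, $c\in L^2(\Omega)$ and $\lambda_i$-a.e. non-negative $\mu_i\in L^2(\Omega_i)$ with $\|\mu_1\|_{L^1(\Omega_1)}=\|\mu_2\|_{L^1(\Omega_2)}$, $\mathcal S_\gamma(c,\mu_1,\mu_2)\in L^2(\Omega)$ is the unique minimizer of $\int_\Omega c\,\pi\,d\lambda+\frac\gamma2\|\pi\|_{L^2(\Omega)}^2$ over all $\pi\in L^2(\Omega)$ with $\pi\ge0$ a.e., $\int_{\Omega_2}\pi(x_1,x_2)\,d\lambda_2(x_2)=\mu_1(x_1)$ for a.e. $x_1\in\Omega_1$, $\int_{\Omega_1}\pi(x_1,x_2)\,d\lambda_1(x_1)=\mu_2(x_2)$ for a.e. $x_2\in\Omega_2$. (Existence and uniqueness are known.) Smoothing. For $\delta>0$, $\mathcal T_i^\delta(\mu_i):=\varphi_i^\delta*\mu_i+\frac{\delta}{|\Omega_i|}\in L^2(\Omega_i)$ for $\mu_i\in\mathfrak M(\Omega_i)$, where $\varphi_i^\delta\in C_c^\infty(\mathbb R^{d_i})$ is the (symmetric, non-negative, rescaled) standard mollifier with $\|\varphi_i^\delta\|_{L^1}=1$ and support in $\overline{B(0,\delta)}$. Feasible set of $(\mathrm{BK}_n)$: all $(\pi,\mu_1,c)$ with $c\in W^{1,p}(\Omega)$, $\mu_1\in\mathfrak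 P(\Omega_1)$, $\mathrm{dist}(\mathrm{supp}(\mu_1),\partial\Omega_1)\ge\rho$, and $\pi=\mathcal S_{\gamma_n}(c,\mathcal T_1^{\delta_n}(\mu_1),\mathcal T_2^{\delta_n}(\mu_2^{\mathrm d}))$. *)

theory Defs
  imports "HOL-Analysis.Analysis"
begin

section \<open>Domains\<close>

text \<open>Near every boundary point \<open>x\<close>, after a rotation taking the last coordinate axis to the unit
  vector \<open>v\<close>, the interior of \<open>S\<close> is the strict subgraph, and its boundary the graph, of a Lipschitz
  function \<open>g\<close> on the hyperplane orthogonal to \<open>v\<close>.\<close>

definition lipschitz_boundary :: "'a::euclidean_space set \<Rightarrow> bool" where
  "lipschitz_boundary S \<longleftrightarrow>
    (\<forall>x\<in>frontier S. \<exists>v r h L. \<exists>g :: 'a \<Rightarrow> real.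
       norm v = 1 \<and> 0 < r \<and> 0 < h \<and> L-lipschitz_on {z. z \<bullet> v = 0} g \<and>
       (\<forall>y. let t = (y - x) \<bullet> v; z = (y - x) - t *\<^sub>R v in
          norm z < r \<longrightarrow> \<bar>t\<bar> < h \<longrightarrow>
            (y \<in> interior S \<longleftrightarrow> t < g z) \<and> (y \<in> frontier S \<longleftrightarrow> t = g z)))"

section \<open>Lebesgue and Sobolev spaces\<close>

text \<open>Elements of Lebesgue and Sobolev spaces are represented by functions on the whole Euclidean space
  whose values outside the domain are irrelevant; the integrals, norms and function spaces in this
  section are unaffected by changes on null sets.\<close>

definition Lp_on :: "real \<Rightarrow> 'a::euclidean_space set \<Rightarrow> ('a \<Rightarrow> real) \<Rightarrow> bool" where
  "Lp_on p S f \<longleftrightarrow> set_borel_measurable lebesgue S f \<and> set_integrable lebesgue S (\<lambda>x. \<bar>f x\<bar> powr p)"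

primrec Ck :: "nat \<Rightarrow> ('a::euclidean_space \<Rightarrow> real) \<Rightarrow> bool" where
  "Ck 0 f \<longleftrightarrow> continuous_on UNIV f"
| "Ck (Suc k) f \<longleftrightarrow> (\<forall>x. f differentiable (at x)) \<and>
      (\<forall>b\<in>Basis. Ck k (\<lambda>x. frechet_derivative f (at x) b))"

definition test_function :: "'a::euclidean_space set \<Rightarrow> ('a \<Rightarrow> real) \<Rightarrow> bool" where
  "test_function U \<phi> \<longleftrightarrow> (\<forall>k. Ck k \<phi>) \<and> compact (closure {x. \<phi> x \<noteq> 0}) \<and> closure {x. \<phi> x \<noteq> 0} \<subseteq> U"

definition is_weak_partial ::
    "'a::euclidean_space set \<Rightarrow> 'a \<Rightarrow> ('a \<Rightarrow> real) \<Rightarrow> ('a \<Rightarrow> real) \<Rightarrow> bool" where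
  "is_weak_partial U b u g \<longleftrightarrow>
     (\<forall>K. compact K \<longrightarrow> K \<subseteq> U \<longrightarrow> set_integrable lebesgue K g) \<and>
     (\<forall>\<phi>. test_function U \<phi> \<longrightarrow>
        set_lebesgue_integral lebesgue U (\<lambda>x. u x * frechet_derivative \<phi> (at x) b)
          = - set_lebesgue_integral lebesgue U (\<lambda>x. g x * \<phi> x))"

definition W1p :: "real \<Rightarrow> 'a::euclidean_space set \<Rightarrow> ('a \<Rightarrow> real) set" where
  "W1p p U = {u. Lp_on p U u \<and> (\<forall>b\<in>Basis. \<exists>g. is_weak_partial U b u g \<and> Lp_on p U g)}"

text \<open>Weak partial derivatives are unique almost everywhere, so the choice of representative does not
  affect the norm.\<close>

definition weak_partial :: "'a::euclidean_space set \<Rightarrow> 'a \<Rightarrow> ('a \<Rightarrow> real) \<Rightarrow> 'a \<Rightarrow> real" where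
  "weak_partial U b u = (SOME g. is_weak_partial U b u g)"

definition W1p_norm :: "real \<Rightarrow> 'a::euclidean_space set \<Rightarrow> ('a \<Rightarrow> real) \<Rightarrow> real" where
  "W1p_norm p U u =
     (set_lebesgue_integral lebesgue U (\<lambda>x. \<bar>u x\<bar> powr p)
      + (\<Sum>b\<in>Basis. set_lebesgue_integral lebesgue U (\<lambda>x. \<bar>weak_partial U b u x\<bar> powr p))) powr (1 / p)"

text \<open>Boundedness forces such a functional to agree on functions that are equal almost everywhere on
  \<open>U\<close>, so these are exactly the elements of the dual space.\<close>

definition W1p_dual :: "real \<Rightarrow> 'a::euclidean_space set \<Rightarrow> (('a \<Rightarrow> real) \<Rightarrow> real) set" where
  "W1p_dual p U = {l.
     (\<forall>u\<in>W1p p U. \<forall>v\<in>W1p p U. l (\<lambda>x. u x + v x) = l u + l v) \<and>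
     (\<forall>a. \<forall>u\<in>W1p p U. l (\<lambda>x. a * u x) = a * l u) \<and>
     (\<exists>C. \<forall>u\<in>W1p p U. \<bar>l u\<bar> \<le> C * W1p_norm p U u)}"

definition W1p_weakly_tendsto ::
    "real \<Rightarrow> 'a::euclidean_space set \<Rightarrow> (nat \<Rightarrow> 'a \<Rightarrow> real) \<Rightarrow> ('a \<Rightarrow> real) \<Rightarrow> bool" where
  "W1p_weakly_tendsto p U us u \<longleftrightarrow> (\<forall>l\<in>W1p_dual p U. (\<lambda>n. l (us n)) \<longlonglongrightarrow> l u)"

section \<open>Signed regular Borel measures\<close>

abbreviation borel_sets_on :: "'a::topological_space set \<Rightarrow> 'a set set" where
  "borel_sets_on X \<equiv> sets (restrict_space borel X)"

text \<open>The positive and negative parts of the Jordan decomposition.\<close>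

definition pos_part :: "'a::topological_space set \<Rightarrow> ('a set \<Rightarrow> real) \<Rightarrow> 'a set \<Rightarrow> real" where
  "pos_part X \<nu> A = (SUP B\<in>{B\<in>borel_sets_on X. B \<subseteq> A}. \<nu> B)"

definition neg_part :: "'a::topological_space set \<Rightarrow> ('a set \<Rightarrow> real) \<Rightarrow> 'a set \<Rightarrow> real" where
  "neg_part X \<nu> A = (SUP B\<in>{B\<in>borel_sets_on X. B \<subseteq> A}. - \<nu> B)"

definition total_variation :: "'a::topological_space set \<Rightarrow> ('a set \<Rightarrow> real) \<Rightarrow> 'a set \<Rightarrow> real" where
  "total_variation X \<nu> A = pos_part X \<nu> A + neg_part X \<nu> A"

text \<open>Set functions are normalised to \<open>0\<close> off the Borel sets of \<open>X\<close>, so that equality of measures is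
  equality in HOL.\<close>

definition signed_measures :: "'a::topological_space set \<Rightarrow> ('a set \<Rightarrow> real) set" where
  "signed_measures X = {\<nu>.
     (\<forall>A. A \<notin> borel_sets_on X \<longrightarrow> \<nu> A = 0) \<and>
     (\<forall>A :: nat \<Rightarrow> 'a set. range A \<subseteq> borel_sets_on X \<longrightarrow> disjoint_family A \<longrightarrow>
        (\<lambda>n. \<nu> (A n)) sums \<nu> (\<Union>n. A n)) \<and>
     (\<forall>A\<in>borel_sets_on X. \<forall>e>0. \<exists>K U. compact K \<and> openin (top_of_set X) U \<and> K \<subseteq> A \<and> A \<subseteq> U \<and>
        total_variation X \<nu> (U - K) < e)}"

definition sintegral :: "'a::topological_space set \<Rightarrow> ('a set \<Rightarrow> real) \<Rightarrow> ('a \<Rightarrow> real) \<Rightarrow> real" where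
  "sintegral X \<nu> f =
     integral\<^sup>L (measure_of X (borel_sets_on X) (\<lambda>A. ennreal (pos_part X \<nu> A))) f
     - integral\<^sup>L (measure_of X (borel_sets_on X) (\<lambda>A. ennreal (neg_part X \<nu> A))) f"

definition weak_star_tendsto ::
    "'a::topological_space set \<Rightarrow> (nat \<Rightarrow> 'a set \<Rightarrow> real) \<Rightarrow> ('a set \<Rightarrow> real) \<Rightarrow> bool" where
  "weak_star_tendsto X \<nu>s \<nu> \<longleftrightarrow>
     (\<forall>f. continuous_on X f \<longrightarrow> (\<lambda>n. sintegral X (\<nu>s n) f) \<longlonglongrightarrow> sintegral X \<nu> f)"

definition nonneg_measure :: "('a set \<Rightarrow> real) \<Rightarrow> bool" where
  "nonneg_measure \<nu> \<longleftrightarrow> (\<forall>A. 0 \<le> \<nu> A)"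

definition prob_measures :: "'a::topological_space set \<Rightarrow> ('a set \<Rightarrow> real) set" where
  "prob_measures X = {\<nu>\<in>signed_measures X. nonneg_measure \<nu> \<and> \<nu> X = 1}"

definition msupport :: "'a::topological_space set \<Rightarrow> ('a set \<Rightarrow> real) \<Rightarrow> 'a set" where
  "msupport X \<nu> = {x\<in>X. \<forall>U. open U \<longrightarrow> x \<in> U \<longrightarrow> 0 < total_variation X \<nu> (U \<inter> X)}"

definition pushforward ::
    "'a::topological_space set \<Rightarrow> 'b::topological_space set \<Rightarrow> ('a \<Rightarrow> 'b) \<Rightarrow> ('a set \<Rightarrow> real) \<Rightarrow> 'b set \<Rightarrow> real"
  where "pushforward X Y f \<nu> = (\<lambda>B. if B \<in> borel_sets_on Y then \<nu> (f -` B \<inter> X) else 0)"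

text \<open>The measure on \<open>S\<close> with Lebesgue density \<open>f\<close>.\<close>

definition density_measure :: "'a::euclidean_space set \<Rightarrow> ('a \<Rightarrow> real) \<Rightarrow> 'a set \<Rightarrow> real" where
  "density_measure S f =
     (\<lambda>A. if A \<in> borel_sets_on S then set_lebesgue_integral lebesgue A f else 0)"

section \<open>Kantorovich problem and its regularization\<close>

definition couplings ::
    "'a::euclidean_space set \<Rightarrow> 'b::euclidean_space set \<Rightarrow> ('a set \<Rightarrow> real) \<Rightarrow> ('b set \<Rightarrow> real)
      \<Rightarrow> (('a \<times> 'b) set \<Rightarrow> real) set" where
  "couplings \<Omega>1 \<Omega>2 \<mu>1 \<mu>2 = {\<pi>\<in>signed_measures (\<Omega>1 \<times> \<Omega>2).
     pushforward (\<Omega>1 \<times> \<Omega>2) \<Omega>1 fst \<pi> = \<mu>1 \<and> pushforward (\<Omega>1 \<times> \<Omega>2) \<Omega>2 snd \<pi> = \<mu>2}"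

definition kantorovich_optimal ::
    "'a::euclidean_space set \<Rightarrow> 'b::euclidean_space set \<Rightarrow> ('a \<times> 'b \<Rightarrow> real) \<Rightarrow> ('a set \<Rightarrow> real)
      \<Rightarrow> ('b set \<Rightarrow> real) \<Rightarrow> (('a \<times> 'b) set \<Rightarrow> real) \<Rightarrow> bool" where
  "kantorovich_optimal \<Omega>1 \<Omega>2 c \<mu>1 \<mu>2 \<pi> \<longleftrightarrow>
     \<pi> \<in> couplings \<Omega>1 \<Omega>2 \<mu>1 \<mu>2 \<and> nonneg_measure \<pi> \<and>
     (\<forall>\<phi>\<in>couplings \<Omega>1 \<Omega>2 \<mu>1 \<mu>2. nonneg_measure \<phi> \<longrightarrow>
        sintegral (\<Omega>1 \<times> \<Omega>2) \<pi> c \<le> sintegral (\<Omega>1 \<times> \<Omega>2) \<phi> c)"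

definition BK_feasible ::
    "'a::euclidean_space set \<Rightarrow> 'b::euclidean_space set \<Rightarrow> real \<Rightarrow> ('b set \<Rightarrow> real) \<Rightarrow> ('a \<times> 'b \<Rightarrow> real)
      \<Rightarrow> ((('a \<times> 'b) set \<Rightarrow> real) \<times> ('a set \<Rightarrow> real)) set" where
  "BK_feasible \<Omega>1 \<Omega>2 \<rho> \<mu>2d cd = {(\<pi>, \<mu>1).
     \<mu>1 \<in> prob_measures \<Omega>1 \<and> \<rho> \<le> setdist (msupport \<Omega>1 \<mu>1) (frontier \<Omega>1) \<and>
     kantorovich_optimal \<Omega>1 \<Omega>2 cd \<mu>1 \<mu>2d \<pi>}"

definition L2_coupling ::
    "'a::euclidean_space set \<Rightarrow> 'b::euclidean_space set \<Rightarrow> ('a \<Rightarrow> real) \<Rightarrow> ('b \<Rightarrow> real)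
      \<Rightarrow> ('a \<times> 'b \<Rightarrow> real) \<Rightarrow> bool" where
  "L2_coupling \<Omega>1 \<Omega>2 m1 m2 f \<longleftrightarrow>
     Lp_on 2 (\<Omega>1 \<times> \<Omega>2) f \<and>
     (AE z in lebesgue. z \<in> \<Omega>1 \<times> \<Omega>2 \<longrightarrow> 0 \<le> f z) \<and>
     (AE x in lebesgue. x \<in> \<Omega>1 \<longrightarrow> set_lebesgue_integral lebesgue \<Omega>2 (\<lambda>y. f (x, y)) = m1 x) \<and>
     (AE y in lebesgue. y \<in> \<Omega>2 \<longrightarrow> set_lebesgue_integral lebesgue \<Omega>1 (\<lambda>x. f (x, y)) = m2 y)"

definition reg_objective ::
    "'a::euclidean_space set \<Rightarrow> real \<Rightarrow> ('a \<Rightarrow> real) \<Rightarrow> ('a \<Rightarrow> real) \<Rightarrow> real" where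
  "reg_objective \<Omega> \<gamma> c f =
     set_lebesgue_integral lebesgue \<Omega> (\<lambda>z. c z * f z)
     + \<gamma> / 2 * set_lebesgue_integral lebesgue \<Omega> (\<lambda>z. (f z)\<^sup>2)"

text \<open>\<open>f\<close> represents the solution operator \<open>\<S>\<^sub>\<gamma>\<close> at \<open>(c, m1, m2)\<close>.  It is a
  relation because the minimizer is unique only up to null sets.\<close>

definition is_S ::
    "'a::euclidean_space set \<Rightarrow> 'b::euclidean_space set \<Rightarrow> real \<Rightarrow> ('a \<times> 'b \<Rightarrow> real) \<Rightarrow> ('a \<Rightarrow> real)
      \<Rightarrow> ('b \<Rightarrow> real) \<Rightarrow> ('a \<times> 'b \<Rightarrow> real) \<Rightarrow> bool" where
  "is_S \<Omega>1 \<Omega>2 \<gamma> c m1 m2 f \<longleftrightarrow>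
     L2_coupling \<Omega>1 \<Omega>2 m1 m2 f \<and>
     (\<forall>f'. L2_coupling \<Omega>1 \<Omega>2 m1 m2 f' \<longrightarrow>
        reg_objective (\<Omega>1 \<times> \<Omega>2) \<gamma> c f \<le> reg_objective (\<Omega>1 \<times> \<Omega>2) \<gamma> c f')"

definition std_bump :: "'a::euclidean_space \<Rightarrow> real" where
  "std_bump x = (if norm x < 1 then exp (1 / ((norm x)\<^sup>2 - 1)) else 0)"

definition mollifier :: "real \<Rightarrow> 'a::euclidean_space \<Rightarrow> real" where
  "mollifier \<delta> x =
     std_bump (x /\<^sub>R \<delta>) / (\<delta> ^ DIM('a) * integral\<^sup>L lebesgue (std_bump :: 'a \<Rightarrow> real))"

definition smoothing :: "'a::euclidean_space set \<Rightarrow> real \<Rightarrow> ('a set \<Rightarrow> real) \<Rightarrow> 'a \<Rightarrow> real" where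
  "smoothing \<Omega> \<delta> \<mu> x = sintegral \<Omega> \<mu> (\<lambda>y. mollifier \<delta> (x - y)) + \<delta> / measure lebesgue \<Omega>"

text \<open>The first component is a measure; it is the one whose density is the value of the solution
  operator.\<close>

definition BK_reg_feasible ::
    "'a::euclidean_space set \<Rightarrow> 'b::euclidean_space set \<Rightarrow> real \<Rightarrow> real \<Rightarrow> ('b set \<Rightarrow> real) \<Rightarrow> real \<Rightarrow> real
      \<Rightarrow> ((('a \<times> 'b) set \<Rightarrow> real) \<times> ('a set \<Rightarrow> real) \<times> ('a \<times> 'b \<Rightarrow> real)) set" where
  "BK_reg_feasible \<Omega>1 \<Omega>2 p \<rho> \<mu>2d \<gamma> \<delta> = {(\<pi>, \<mu>1, c).
     c \<in> W1p p (interior (\<Omega>1 \<times> \<Omega>2)) \<and>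
     \<mu>1 \<in> prob_measures \<Omega>1 \<and> \<rho> \<le> setdist (msupport \<Omega>1 \<mu>1) (frontier \<Omega>1) \<and>
     (\<exists>f. is_S \<Omega>1 \<Omega>2 \<gamma> c (smoothing \<Omega>1 \<delta> \<mu>1) (smoothing \<Omega>2 \<delta> \<mu>2d) f \<and>
          \<pi> = density_measure (\<Omega>1 \<times> \<Omega>2) f)}"

end

theory Submission
  imports Defs
begin

text \<open>
  Feasibility of \<open>\<mu>1\<close> and the marginals of \<open>\<pi>\<close> pass to the limit by testing with continuous
  functions: a mollification at scale \<open>\<delta> \<le> \<rho>\<close> of a measure that is supported at distance \<open>\<rho>\<close> from
  the boundary loses no mass, so it differs little from the measure itself (\<open>smoothing_close\<close>).

  Optimality follows from a comparison.  Let \<open>\<phi>\<close> be any nonnegative coupling of \<open>\<mu>1\<close> and \<open>\<mu>2d\<close>.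
  If there are densities \<open>\<theta>\<close> that have the smoothed marginals of the \<open>n\<close>-th problem, cost at most that of
  \<open>\<phi>\<close> up to a small error, and squared norm of order at most \<open>\<delta> n\<close> to the power \<open>- (DIM('a) + DIM('b))\<close>,
  then minimality of the \<open>n\<close>-th density can be tested with \<open>\<theta>\<close>; the growth condition on
  \<open>\<gamma> n\<close> makes the penalty vanish, and in the limit the cost of \<open>\<pi>\<close> is at most that of \<open>\<phi>\<close>.
  Two things have to be supplied.

  The costs must converge uniformly, because the minimizers may concentrate anywhere.  As the exponent
  exceeds the dimension, evaluation at the vertex of a cone inside the domain is a bounded functional on the
  Sobolev space, and it depends on the vertex continuously in the dual norm (\<open>point_evaluation\<close>): it
  is the limit of averages against mollifiers, and moving a mollifier along a path changes the average
  by a pairing with the weak gradient (\<open>avg_path\<close>).  A gliding hump then turns weak into uniform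
  convergence (\<open>gliding_hump\<close>, \<open>weak_imp_uniform\<close>).  A Lipschitz boundary provides the cones and is a
  null set.

  The competitors \<open>\<theta>\<close> are not mollifications of \<open>\<phi>\<close>, since their first marginal comes from the
  \<open>n\<close>-th measure and not from \<open>\<mu>1\<close>.  A partition of unity cuts the first space into small pieces whose
  masses under the \<open>n\<close>-th measure are close to those under \<open>\<mu>1\<close>.  Inside each piece the first smoothed marginal is
  coupled as a product with the mollified second marginal of the part of \<open>\<phi>\<close> over that piece; the small
  mass that is left over is coupled as a product, too (\<open>block_coupling\<close>, \<open>recovery\<close>).
\<close>

section \<open>Smooth functions and the mollifier\<close>

lemma Ck_Suc_imp: "Ck (Suc k) f \<Longrightarrow> Ck k f"
proof (induction k arbitrary: f)
  case 0
  then show ?case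
    by (auto intro!: differentiable_imp_continuous_on simp: differentiable_on_def)
next
  case (Suc k)
  then show ?case by (metis Ck.simps(2))
qed

lemma Ck_const: "Ck k (\<lambda>x::'a::euclidean_space. c)"
  by (induction k arbitrary: c) auto

lemma Ck_add:
  assumes "Ck k f" "Ck k g" shows "Ck k (\<lambda>x. f x + g x)"
  using assms
proof (induction k arbitrary: f g)
  case 0
  then show ?case by (auto intro: continuous_intros)
next
  case (Suc k)
  have D: "frechet_derivative (\<lambda>x. f x + g x) (at x) b
      = frechet_derivative f (at x) b + frechet_derivative g (at x) b" for x b
  proof -
    have "(f has_derivative frechet_derivative f (at x)) (at x)"
      "(g has_derivative frechet_derivative g (at x)) (at x)"
      using Suc.prems by (auto simp: frechet_derivative_works)
    from frechet_derivative_at[OF has_derivative_add[OF this]] show ?thesis by metis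
  qed
  show ?case using Suc by (auto simp: D)
qed

lemma Ck_mult:
  assumes "Ck k f" "Ck k g" shows "Ck k (\<lambda>x. f x * g x)"
  using assms
proof (induction k arbitrary: f g)
  case 0
  then show ?case by (auto intro: continuous_intros)
next
  case (Suc k)
  have D: "frechet_derivative (\<lambda>x. f x * g x) (at x) b
      = f x * frechet_derivative g (at x) b + frechet_derivative f (at x) b * g x" for x b
  proof -
    have "(f has_derivative frechet_derivative f (at x)) (at x)"
      "(g has_derivative frechet_derivative g (at x)) (at x)"
      using Suc.prems by (auto simp: frechet_derivative_works)
    from frechet_derivative_at[OF has_derivative_mult[OF this]] show ?thesis by metis
  qed
  have "Ck k f" "Ck k g"
    using Suc.prems Ck_Suc_imp by blast+
  then show ?case using Suc by (auto simp: D intro!: Ck_add)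
qed

lemma Ck_sum:
  "finite I \<Longrightarrow> (\<And>i. i \<in> I \<Longrightarrow> Ck k (f i)) \<Longrightarrow> Ck k (\<lambda>x. \<Sum>i\<in>I. f i x)"
  by (induction I rule: finite_induct) (auto intro: Ck_const Ck_add)

lemma Ck_inner: "Ck k (\<lambda>x::'a::euclidean_space. x \<bullet> b)"
proof (cases k)
  case (Suc j)
  have D: "((\<lambda>x. x \<bullet> b) has_derivative (\<lambda>x. x \<bullet> b)) (at x)" for x :: 'a
    by (auto intro!: derivative_eq_intros)
  show ?thesis
    using D frechet_derivative_at[OF D, symmetric]
    by (auto simp: Suc differentiable_def Ck_const)
qed (auto intro: continuous_intros)

text \<open>The whole sequence of derivatives of the outer function enters, because the induction on the order
  replaces \<open>h j\<close> by \<open>h (Suc j)\<close>.\<close>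

lemma Ck_compose_real:
  fixes f :: "'a::euclidean_space \<Rightarrow> real"
  assumes h: "\<And>j t. (h j has_real_derivative h (Suc j) t) (at t)" and "Ck k f"
  shows "Ck k (\<lambda>x. h j (f x))"
  using assms(2)
proof (induction k arbitrary: j)
  case 0
  have "continuous_on UNIV (h j)"
    by (meson h DERIV_continuous_on has_field_derivative_at_within)
  with 0 show ?case
    by (auto intro: continuous_on_compose2[of UNIV "h j"])
next
  case (Suc k)
  have D: "((\<lambda>x. h j (f x)) has_derivative
       (\<lambda>v. h (Suc j) (f x) * frechet_derivative f (at x) v)) (at x)" for x
  proof -
    have "(f has_derivative frechet_derivative f (at x)) (at x)"
      using Suc.prems by (auto simp: frechet_derivative_works)
    from has_derivative_compose[OF this, of "h j" "\<lambda>v. h (Suc j) (f x) * v"]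
    show ?thesis using h[of j "f x"] by (simp add: has_field_derivative_def)
  qed
  have "Ck k f" using Suc.prems by (rule Ck_Suc_imp)
  then show ?case
    using Suc D frechet_derivative_at[OF D, symmetric]
    by (auto simp: differentiable_def intro!: Ck_mult)
qed

text \<open>Polynomials in \<open>1 / t\<close> times \<open>exp (- 1 / t)\<close>, extended by \<open>0\<close>.  This family is closed under
  differentiation, also at the origin, so that one rule yields all derivatives of the standard bump.\<close>

definition flat :: "real poly \<Rightarrow> real \<Rightarrow> real" where
  "flat P t = (if 0 < t then poly P (1 / t) * exp (- (1 / t)) else 0)"

lemma poly_div_exp_0: "((\<lambda>s::real. poly P s * exp (- s)) \<longlongrightarrow> 0) at_top"
proof -
  have "((\<lambda>s. \<Sum>i\<le>degree P. coeff P i * (s ^ i / exp s)) \<longlongrightarrow> (\<Sum>i\<le>degree P. coeff P i * 0)) at_top"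
    by (intro tendsto_intros tendsto_power_div_exp_0)
  then show ?thesis
    by (simp add: poly_altdef sum_distrib_right exp_minus divide_inverse mult.assoc)
qed

lemma flat_tendsto_0: "(flat P \<longlongrightarrow> 0) (at 0)"
proof -
  have "((\<lambda>t::real. poly P (inverse t) * exp (- inverse t)) \<longlongrightarrow> 0) (at_right 0)"
    using filterlim_compose[OF poly_div_exp_0 filterlim_inverse_at_top_right] .
  then have "(flat P \<longlongrightarrow> 0) (at_right 0)"
    by (rule Lim_transform_eventually)
      (auto simp: flat_def eventually_at_filter divide_inverse)
  moreover have "(flat P \<longlongrightarrow> 0) (at_left 0)"
    by (rule Lim_transform_eventually[where f = "\<lambda>_. 0"]) (auto simp: flat_def eventually_at_filter)
  ultimately show ?thesis by (simp add: filterlim_split_at)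
qed

lemma flat_deriv:
  "(flat P has_real_derivative flat ([:0, 0, 1:] * (P - pderiv P)) t) (at t)"
proof -
  consider "t < 0" | "t = 0" | "0 < t" by linarith
  then show ?thesis
  proof cases
    case 1
    then have "eventually (\<lambda>s. s < 0) (nhds t)"
      by (intro order_tendstoD) (auto simp: filterlim_ident)
    then have "eventually (\<lambda>s. flat P s = 0) (nhds t)"
      by eventually_elim (auto simp: flat_def)
    with 1 show ?thesis
      by (subst DERIV_cong_ev[OF refl _ refl, of _ "\<lambda>_. 0"]) (auto simp: flat_def)
  next
    case 2
    have "((\<lambda>y. flat P y / y) \<longlongrightarrow> 0) (at 0)"
      using flat_tendsto_0[of "[:0, 1:] * P"]
      by (rule Lim_transform_eventually) (auto simp: flat_def eventually_at_filter)
    with 2 show ?thesis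
      by (simp add: has_field_derivative_iff flat_def)
  next
    case 3
    then have "eventually (\<lambda>s. 0 < s) (nhds t)"
      by (intro order_tendstoD) (auto simp: filterlim_ident)
    then have ev: "eventually (\<lambda>s. flat P s = poly P (1 / s) * exp (- (1 / s))) (nhds t)"
      by eventually_elim (auto simp: flat_def)
    have "((\<lambda>s. poly P (1 / s) * exp (- (1 / s))) has_real_derivative
        (poly (pderiv P) (1 / t) * (- 1 / t^2)) * exp (- (1 / t)) +
         poly P (1 / t) * (exp (- (1 / t)) * (1 / t^2))) (at t)"
      using 3 by (auto intro!: derivative_eq_intros simp: power2_eq_square field_simps)
    also have "(poly (pderiv P) (1 / t) * (- 1 / t^2)) * exp (- (1 / t)) +
         poly P (1 / t) * (exp (- (1 / t)) * (1 / t^2)) = flat ([:0, 0, 1:] * (P - pderiv P)) t"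
      using 3 by (simp add: flat_def power2_eq_square field_simps)
    finally show ?thesis
      using DERIV_cong_ev[OF refl ev refl] by blast
  qed
qed

lemma std_bump_flat: "std_bump x = flat 1 (1 - x \<bullet> x)"
proof -
  have "norm x < 1 \<longleftrightarrow> x \<bullet> x < 1"
    by (metis norm_lt_square power_one zero_less_one)
  moreover have "1 / ((norm x)\<^sup>2 - 1) = - (1 / (1 - x \<bullet> x))"
    by (simp add: dot_square_norm[symmetric] minus_divide_right)
  ultimately show ?thesis by (simp add: std_bump_def flat_def)
qed

lemma Ck_flat: "Ck k f \<Longrightarrow> Ck k (\<lambda>x. flat P (f x))"
  using Ck_compose_real[of "\<lambda>j. flat (((\<lambda>P. [:0, 0, 1:] * (P - pderiv P)) ^^ j) P)" k f 0]
    flat_deriv by (simp del: mult_pCons_left)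

lemma Ck_affine_inner: "Ck k (\<lambda>y::'a::euclidean_space. ((y - x) /\<^sub>R r) \<bullet> b)"
proof -
  have "Ck k (\<lambda>y::'a. inverse r * (y \<bullet> b) + (- (inverse r * (x \<bullet> b))))"
    by (intro Ck_add Ck_mult Ck_const Ck_inner)
  then show ?thesis by (simp add: inner_diff_left algebra_simps)
qed

lemma Ck_mollifier: "Ck k (\<lambda>y::'a::euclidean_space. mollifier r (y - x))"
proof -
  let ?z = "\<lambda>y. (y - x) /\<^sub>R r"
  have "Ck k (\<lambda>y. 1 + (- 1) * (\<Sum>b\<in>Basis. (?z y \<bullet> b) * (?z y \<bullet> b)))"
    by (intro Ck_add Ck_mult Ck_const Ck_sum Ck_affine_inner finite_Basis)
  then have "Ck k (\<lambda>y. 1 - ?z y \<bullet> ?z y)"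
    by (subst euclidean_inner) simp
  then have "Ck k (\<lambda>y. std_bump (?z y) * inverse (r ^ DIM('a) * integral\<^sup>L lebesgue (std_bump :: 'a \<Rightarrow> real)))"
    unfolding std_bump_flat by (intro Ck_mult Ck_const Ck_flat)
  then show ?thesis by (simp add: mollifier_def divide_inverse)
qed

lemma continuous_std_bump: "continuous_on UNIV (std_bump :: 'a::euclidean_space \<Rightarrow> real)"
proof -
  have "continuous_on UNIV (flat 1)"
    by (meson flat_deriv DERIV_continuous_on has_field_derivative_at_within)
  then show ?thesis
    unfolding std_bump_flat
    by (rule continuous_on_compose2) (auto intro!: continuous_intros)
qed

lemma std_bump_nonneg: "0 \<le> std_bump x" by (simp add: std_bump_def)

lemma std_bump_le_1: "std_bump x \<le> 1"
  by (auto simp: std_bump_def divide_nonpos_nonneg power_le_one_iff abs_square_less_1 abs_square_le_1)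

lemma std_bump_eq_0: "1 \<le> norm x \<Longrightarrow> std_bump x = 0" by (simp add: std_bump_def)

lemma std_bump_borel [measurable]: "std_bump \<in> borel_measurable borel"
  using continuous_std_bump by (rule borel_measurable_continuous_onI)

lemma integrable_std_bump: "integrable lborel (std_bump :: 'a::euclidean_space \<Rightarrow> real)"
proof (rule Bochner_Integration.integrable_bound)
  show "integrable lborel (indicat_real (cball (0::'a) 1))"
    using emeasure_lborel_cball_finite by (intro integrable_real_indicator) auto
  show "AE x in lborel. norm (std_bump (x::'a)) \<le> norm (indicat_real (cball 0 1) x)"
    by (auto simp: std_bump_nonneg std_bump_le_1 std_bump_eq_0 split: split_indicator)
qed auto

lemma integral_std_bump_pos: "0 < integral\<^sup>L lborel (std_bump :: 'a::euclidean_space \<Rightarrow> real)"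
proof -
  have "0 \<le> integral\<^sup>L lborel (std_bump :: 'a \<Rightarrow> real)"
    by (intro integral_nonneg_AE AE_I2 std_bump_nonneg)
  moreover have "integral\<^sup>L lborel (std_bump :: 'a \<Rightarrow> real) \<noteq> 0"
  proof
    assume "integral\<^sup>L lborel (std_bump :: 'a \<Rightarrow> real) = 0"
    then have "AE x in lborel. std_bump (x::'a) = 0"
      using integrable_std_bump by (subst (asm) integral_nonneg_eq_0_iff_AE) (auto simp: std_bump_nonneg)
    then have "AE x in lborel. x \<notin> ball (0::'a) 1"
      by eventually_elim (auto simp: std_bump_def split: if_splits)
    then have "emeasure lborel (ball (0::'a) 1) = 0"
      by (subst (asm) AE_iff_measurable[of "ball (0::'a) 1"]) auto
    then show False using open_not_negligible[of "ball (0::'a) 1"] by (simp add: negligible_iff_emeasure0 emeasure_completion)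
  qed
  ultimately show ?thesis by simp
qed

definition bump_mass :: "'a::euclidean_space itself \<Rightarrow> real" where
  "bump_mass _ = integral\<^sup>L lebesgue (std_bump :: 'a \<Rightarrow> real)"

lemma bump_mass_pos: "0 < bump_mass TYPE('a::euclidean_space)"
  using integral_std_bump_pos by (simp add: bump_mass_def integral_completion)

lemma mollifier_alt:
  "mollifier r (x::'a::euclidean_space) = std_bump (x /\<^sub>R r) * inverse (r ^ DIM('a) * bump_mass TYPE('a))"
  by (simp add: mollifier_def bump_mass_def divide_inverse)

lemma mollifier_nonneg: "0 \<le> r \<Longrightarrow> 0 \<le> mollifier r (x::'a::euclidean_space)"
  using bump_mass_pos[where 'a='a] by (simp add: mollifier_alt std_bump_nonneg)

lemma mollifier_le:
  "0 \<le> r \<Longrightarrow> mollifier r (x::'a::euclidean_space) \<le> inverse (r ^ DIM('a) * bump_mass TYPE('a))"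
  using bump_mass_pos[where 'a='a]
    mult_right_mono[OF std_bump_le_1[of "x /\<^sub>R r"], of "inverse (r ^ DIM('a) * bump_mass TYPE('a))"]
  by (simp add: mollifier_alt)

lemma mollifier_eq_0: "0 < r \<Longrightarrow> r \<le> norm x \<Longrightarrow> mollifier r x = 0"
  by (simp add: mollifier_alt std_bump_eq_0 field_simps)

lemma continuous_mollifier: "continuous_on UNIV (mollifier r :: 'a::euclidean_space \<Rightarrow> real)"
  using Ck_mollifier[of 0 r "0::'a"] by simp

lemma mollifier_borel [measurable]: "mollifier r \<in> borel_measurable borel"
  using continuous_mollifier by (rule borel_measurable_continuous_onI)

lemma integral_mollifier:
  fixes x :: "'a::euclidean_space"
  assumes "0 < r"
  shows "(\<integral>y. mollifier r (y - x) \<partial>lborel) = 1"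
proof -
  let ?T = "\<lambda>y. (- (x /\<^sub>R r)) + (inverse r) *\<^sub>R y"
  let ?N = "density (distr lborel borel ?T) (\<lambda>_. ennreal (\<bar>inverse r\<bar> ^ DIM('a)))"
  have N: "(lborel :: 'a measure) = ?N"
    using assms by (intro lborel_affine) auto
  have eq: "mollifier r (y - x) = inverse (bump_mass TYPE('a)) * (\<bar>inverse r\<bar> ^ DIM('a) *\<^sub>R std_bump (?T y))" for y
    using assms by (simp add: mollifier_alt scaleR_right_diff_distrib power_inverse)
  have "bump_mass TYPE('a) = integral\<^sup>L ?N (std_bump :: 'a \<Rightarrow> real)"
    unfolding bump_mass_def N[symmetric] by (simp add: integral_completion)
  also have "\<dots> = (\<integral>y. \<bar>inverse r\<bar> ^ DIM('a) *\<^sub>R std_bump y \<partial>distr lborel borel ?T)"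
    by (subst integral_density) simp_all
  also have "\<dots> = (\<integral>y. \<bar>inverse r\<bar> ^ DIM('a) *\<^sub>R std_bump (?T y) \<partial>lborel)"
    by (subst integral_distr) simp_all
  finally have e: "(\<integral>y. \<bar>inverse r\<bar> ^ DIM('a) *\<^sub>R std_bump (?T y) \<partial>lborel) = bump_mass TYPE('a)" by (rule sym)
  show "(\<integral>y. mollifier r (y - x) \<partial>lborel) = 1"
    unfolding eq integral_mult_right_zero e using bump_mass_pos[where 'a='a] by simp
qed

definition bump_grad :: "'a::euclidean_space \<Rightarrow> 'a" where
  "bump_grad z = (- 2 * flat [:0, 0, 1:] (1 - z \<bullet> z)) *\<^sub>R z"

lemma std_bump_has_derivative: "(std_bump has_derivative (\<lambda>v. bump_grad z \<bullet> v)) (at z)"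
proof -
  have "((\<lambda>z. 1 - z \<bullet> z) has_derivative (\<lambda>v. - 2 * (z \<bullet> v))) (at z)"
    by (auto intro!: derivative_eq_intros simp: inner_commute)
  moreover have "(flat 1 has_derivative (\<lambda>v. flat [:0, 0, 1:] (1 - z \<bullet> z) * v)) (at (1 - z \<bullet> z))"
    using flat_deriv[of 1 "1 - z \<bullet> z"] by (simp add: has_field_derivative_def)
  ultimately have "((\<lambda>z. flat 1 (1 - z \<bullet> z)) has_derivative
      (\<lambda>v. flat [:0, 0, 1:] (1 - z \<bullet> z) * (- 2 * (z \<bullet> v)))) (at z)"
    by (rule has_derivative_compose)
  then show ?thesis
    by (simp add: bump_grad_def std_bump_flat[abs_def] mult_ac)
qed

lemma bump_grad_eq_0: "1 \<le> norm z \<Longrightarrow> bump_grad z = 0"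
  using power_mono[of 1 "norm z" 2]
  by (simp add: bump_grad_def flat_def power2_norm_eq_inner)

lemma continuous_bump_grad: "continuous_on UNIV bump_grad"
proof -
  have "continuous_on UNIV (flat P)" for P
    by (meson flat_deriv DERIV_continuous_on has_field_derivative_at_within)
  then have "continuous_on UNIV (\<lambda>z::'a. flat [:0, 0, 1:] (1 - z \<bullet> z))"
    by (rule continuous_on_compose2) (auto intro!: continuous_intros)
  then show ?thesis unfolding bump_grad_def by (intro continuous_intros)
qed

lemma bump_grad_bounded: obtains L where "0 \<le> L" "\<And>z::'a::euclidean_space. norm (bump_grad z) \<le> L"
proof -
  have "compact (bump_grad ` cball (0::'a) 1)"
    using continuous_bump_grad by (intro compact_continuous_image) (auto intro: continuous_on_subset)
  then obtain L where L: "0 < L" "\<And>z. z \<in> cball (0::'a) 1 \<Longrightarrow> norm (bump_grad z) \<le> L"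
    by (auto simp: bounded_pos dest!: compact_imp_bounded)
  have "norm (bump_grad z) \<le> L" for z :: 'a
    using L bump_grad_eq_0[of z] by (cases "norm z \<le> 1") auto
  with L show ?thesis by (intro that[of L]) auto
qed

text \<open>The kernel that is moved along the path \<open>s \<mapsto> (x + s *\<^sub>R x', r + s * r')\<close> of centres and
  radii satisfies a continuity equation, with the following velocity field.\<close>

definition flow :: "'a::euclidean_space \<Rightarrow> real \<Rightarrow> 'a \<Rightarrow> real \<Rightarrow> 'a \<Rightarrow> 'a" where
  "flow x r x' r' y = x' + (r' / r) *\<^sub>R (y - x)"

lemma flow_mollifier_has_derivative:
  fixes x y :: "'a::euclidean_space"
  assumes "0 < r"
  shows "((\<lambda>y. (flow x r x' r' y \<bullet> b) * mollifier r (y - x)) has_derivative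
    (\<lambda>v. (flow x r x' r' y \<bullet> b) * (inverse (r ^ DIM('a) * bump_mass TYPE('a)) * (bump_grad ((y - x) /\<^sub>R r) \<bullet> v) / r)
       + (r' / r) * (v \<bullet> b) * mollifier r (y - x))) (at y)"
proof -
  have *: "((\<lambda>y. (y - x) /\<^sub>R r) has_derivative (\<lambda>v. v /\<^sub>R r)) (at y)"
    by (auto intro!: derivative_eq_intros)
  have "((\<lambda>y. std_bump ((y - x) /\<^sub>R r)) has_derivative (\<lambda>v. bump_grad ((y - x) /\<^sub>R r) \<bullet> (v /\<^sub>R r))) (at y)"
    by (rule has_derivative_compose[OF * std_bump_has_derivative])
  then show ?thesis
    unfolding mollifier_alt flow_def
    by (auto intro!: derivative_eq_intros simp: divide_inverse inner_add_left algebra_simps)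
qed

lemma flow_divergence:
  fixes x y :: "'a::euclidean_space"
  assumes "0 < r"
  shows "(\<Sum>b\<in>Basis. frechet_derivative (\<lambda>y. (flow x r x' r' y \<bullet> b) * mollifier r (y - x)) (at y) b)
    = inverse (r ^ DIM('a) * bump_mass TYPE('a)) / r *
       (real DIM('a) * r' * std_bump ((y - x) /\<^sub>R r) + bump_grad ((y - x) /\<^sub>R r) \<bullet> flow x r x' r' y)"
proof -
  have "(\<Sum>b\<in>Basis. frechet_derivative (\<lambda>y. (flow x r x' r' y \<bullet> b) * mollifier r (y - x)) (at y) b)
    = (\<Sum>b\<in>Basis. (flow x r x' r' y \<bullet> b) * (inverse (r ^ DIM('a) * bump_mass TYPE('a)) * (bump_grad ((y - x) /\<^sub>R r) \<bullet> b) / r)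
       + (r' / r) * (b \<bullet> b) * mollifier r (y - x))"
    by (simp add: frechet_derivative_at[OF flow_mollifier_has_derivative[OF assms], symmetric])
  also have "\<dots> = inverse (r ^ DIM('a) * bump_mass TYPE('a)) / r * (\<Sum>b\<in>Basis. (bump_grad ((y - x) /\<^sub>R r) \<bullet> b) * (flow x r x' r' y \<bullet> b))
      + real DIM('a) * ((r' / r) * mollifier r (y - x))"
    by (simp add: sum.distrib sum_distrib_left mult_ac divide_inverse)
  finally show ?thesis
    unfolding euclidean_inner[symmetric] by (simp add: mollifier_alt distrib_left mult_ac divide_inverse)
qed

text \<open>The continuity equation of the moving kernel.  Its right-hand side is a divergence of test functions,
  which weak differentiation moves onto the Sobolev function.\<close>

lemma mollifier_path_deriv:
  fixes x y x' :: "'a::euclidean_space" and r r' :: real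
  defines "X \<equiv> (\<lambda>s. x + s *\<^sub>R x')" and "R \<equiv> (\<lambda>s. r + s * r')"
  assumes "0 < R s"
  shows "((\<lambda>s. mollifier (R s) (y - X s)) has_real_derivative
    - (\<Sum>b\<in>Basis. frechet_derivative (\<lambda>y. (flow (X s) (R s) x' r' y \<bullet> b) * mollifier (R s) (y - X s)) (at y) b)) (at s)"
proof -
  let ?z = "\<lambda>s. (y - X s) /\<^sub>R (R s)"
  have R': "(R has_real_derivative r') (at s)"
    unfolding R_def by (auto intro!: derivative_eq_intros)
  have X': "((\<lambda>s. y - X s) has_vector_derivative - x') (at s)"
    unfolding X_def by (auto intro!: derivative_eq_intros)
  have Rs: "R s \<noteq> 0" using assms(3) by simp
  have "(?z has_vector_derivative - (inverse (R s) *\<^sub>R flow (X s) (R s) x' r' y)) (at s)"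
    by (rule has_vector_derivative_eq_rhs[OF has_vector_derivative_scaleR[OF DERIV_inverse_fun[OF R' Rs] X']])
      (simp add: flow_def divide_inverse scaleR_add_right mult_ac)
  from vector_derivative_diff_chain_within[OF this, of std_bump "\<lambda>v. bump_grad (?z s) \<bullet> v"]
  have 1: "((\<lambda>s. std_bump (?z s)) has_real_derivative
      - (bump_grad (?z s) \<bullet> flow (X s) (R s) x' r' y) / R s) (at s)"
    using has_derivative_at_withinI[OF std_bump_has_derivative[of "?z s"]]
    by (simp add: o_def has_real_derivative_iff_has_vector_derivative divide_inverse mult.commute)
  let ?I = "bump_mass TYPE('a)"
  have I: "?I \<noteq> 0" using bump_mass_pos[where 'a='a] by simp
  have P: "R s ^ DIM('a) = R s ^ (DIM('a) - Suc 0) * R s"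
    by (metis DIM_positive Suc_pred mult.commute power_Suc One_nat_def)
  have alg: "- (n * (r' * p) * i * inverse ((p * q * i) ^ Suc (Suc 0))) = - (n * r' / q * inverse (p * q * i))"
    if "p \<noteq> 0" "q \<noteq> 0" "i \<noteq> 0" for p q i n :: real
    using that by (simp add: divide_simps)
  have "R s ^ DIM('a) * ?I \<noteq> 0" using Rs I by simp
  from DERIV_inverse_fun[OF DERIV_cmult_right[OF DERIV_power[OF R', of "DIM('a)"], of ?I] this]
  have 2: "((\<lambda>s. inverse (R s ^ DIM('a) * ?I)) has_real_derivative
      - (real DIM('a) * r' / R s * inverse (R s ^ DIM('a) * ?I))) (at s)"
    unfolding P by (rule DERIV_cong) (rule alg, use Rs I in auto)
  show ?thesis
    unfolding flow_divergence[OF assms(3)] unfolding mollifier_alt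
    by (rule DERIV_cong[OF DERIV_mult[OF 1 2]]) (simp add: divide_inverse distrib_left distrib_right mult_ac)
qed

lemma norm_flow_le: "0 < r \<Longrightarrow> norm (y - x) \<le> r \<Longrightarrow> norm (flow x r x' r' y) \<le> norm x' + \<bar>r'\<bar>"
proof -
  assume r: "0 < r" "norm (y - x) \<le> r"
  have "norm (flow x r x' r' y) \<le> norm x' + \<bar>r'\<bar> / r * norm (y - x)"
    using norm_triangle_ineq[of x' "(r' / r) *\<^sub>R (y - x)"] r by (simp add: flow_def)
  also have "\<bar>r'\<bar> / r * norm (y - x) \<le> \<bar>r'\<bar> / r * r" using r by (intro mult_left_mono) auto
  finally show ?thesis using r by simp
qed

lemma flow_divergence_bounded:
  fixes x' :: "'a::euclidean_space"
  assumes "0 < \<rho>"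
  obtains M where "\<And>x y r. \<rho> \<le> r \<Longrightarrow>
    \<bar>\<Sum>b\<in>Basis. frechet_derivative (\<lambda>y. (flow x r x' r' y \<bullet> b) * mollifier r (y - x)) (at y) b\<bar> \<le> M"
proof -
  obtain L where L: "0 \<le> L" "\<And>z::'a. norm (bump_grad z) \<le> L" using bump_grad_bounded by blast
  let ?K = "real DIM('a) * \<bar>r'\<bar> + L * (norm x' + \<bar>r'\<bar>)"
  let ?I = "bump_mass TYPE('a)"
  have "\<bar>\<Sum>b\<in>Basis. frechet_derivative (\<lambda>y. (flow x r x' r' y \<bullet> b) * mollifier r (y - x)) (at y) b\<bar>
     \<le> inverse (\<rho> ^ DIM('a) * ?I) / \<rho> * ?K" if r: "\<rho> \<le> r" for x y r
  proof -
    let ?z = "(y - x) /\<^sub>R r"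
    have r0: "0 < r" using r assms by simp
    have "\<bar>bump_grad ?z \<bullet> flow x r x' r' y\<bar> \<le> L * (norm x' + \<bar>r'\<bar>)"
    proof (cases "norm (y - x) \<le> r")
      case True
      have "\<bar>bump_grad ?z \<bullet> flow x r x' r' y\<bar> \<le> norm (bump_grad ?z) * norm (flow x r x' r' y)"
        by (rule Cauchy_Schwarz_ineq2)
      also have "\<dots> \<le> L * (norm x' + \<bar>r'\<bar>)"
        by (intro mult_mono L norm_flow_le r0 True) auto
      finally show ?thesis .
    next
      case False
      moreover have "norm ?z = norm (y - x) / r" using r0 by (simp add: divide_inverse mult.commute)
      ultimately have "bump_grad ?z = 0" using r0 by (intro bump_grad_eq_0) (simp add: le_divide_eq)
      then show ?thesis using L by simp
    qed
    moreover have "\<bar>real DIM('a) * r' * std_bump ?z\<bar> \<le> real DIM('a) * \<bar>r'\<bar>"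
      using std_bump_le_1[of ?z] std_bump_nonneg[of ?z]
      by (simp add: abs_mult mult_left_le)
    ultimately have K: "\<bar>real DIM('a) * r' * std_bump ?z + bump_grad ?z \<bullet> flow x r x' r' y\<bar> \<le> ?K"
      by linarith
    have I: "0 \<le> inverse (r ^ DIM('a) * ?I) / r" using r0 bump_mass_pos[where 'a='a] by simp
    have I2: "inverse (r ^ DIM('a) * ?I) / r \<le> inverse (\<rho> ^ DIM('a) * ?I) / \<rho>"
      using r assms bump_mass_pos[where 'a='a]
      by (auto intro!: frac_le le_imp_inverse_le mult_right_mono power_mono)
    have K0: "0 \<le> ?K" using L by simp
    show ?thesis
      unfolding flow_divergence[OF r0] abs_mult abs_of_nonneg[OF I]
      using mult_mono[OF I2 K] I I2 K0 by linarith
  qed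
  then show ?thesis by (intro that)
qed

section \<open>Mollifier averages and weak derivatives\<close>

definition avg :: "'a::euclidean_space set \<Rightarrow> 'a \<Rightarrow> real \<Rightarrow> ('a \<Rightarrow> real) \<Rightarrow> real" where
  "avg U x r u = set_lebesgue_integral lebesgue U (\<lambda>y. u y * mollifier r (y - x))"

lemma borel_in_lebesgue [measurable_dest]: "f \<in> borel_measurable borel \<Longrightarrow> f \<in> borel_measurable (lebesgue :: 'a::euclidean_space measure)"
  by (intro measurable_completion) simp

lemma
  fixes g \<phi> :: "'a::euclidean_space \<Rightarrow> real"
  assumes g: "set_integrable lebesgue K g" and "K \<subseteq> U" and \<phi>: "\<phi> \<in> borel_measurable borel"
    and B: "\<And>y. y \<in> K \<Longrightarrow> \<bar>\<phi> y\<bar> \<le> B" and 0: "\<And>y. y \<in> U \<Longrightarrow> y \<notin> K \<Longrightarrow> \<phi> y = 0"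
  shows set_integrable_mult_supported: "set_integrable lebesgue U (\<lambda>y. g y * \<phi> y)"
    and set_integral_mult_supported: "(LINT y:U|lebesgue. g y * \<phi> y) = (LINT y:K|lebesgue. g y * \<phi> y)"
    and set_integral_mult_supported_bound: "\<bar>LINT y:U|lebesgue. g y * \<phi> y\<bar> \<le> B * (LINT y:K|lebesgue. \<bar>g y\<bar>)"
proof -
  have eq: "indicat_real U y *\<^sub>R (g y * \<phi> y) = (indicat_real K y *\<^sub>R g y) * \<phi> y"
    "indicat_real K y *\<^sub>R (g y * \<phi> y) = (indicat_real K y *\<^sub>R g y) * \<phi> y" for y
    using \<open>K \<subseteq> U\<close> 0 by (auto split: split_indicator)
  have g': "integrable lebesgue (\<lambda>y. indicat_real K y *\<^sub>R g y)"
    using g by (simp add: set_integrable_def)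
  have meas: "(\<lambda>y. (indicat_real K y *\<^sub>R g y) * \<phi> y) \<in> borel_measurable lebesgue"
    using borel_measurable_times[OF borel_measurable_integrable[OF g'] borel_in_lebesgue[OF \<phi>]] .
  have bound: "\<bar>(indicat_real K y *\<^sub>R g y) * \<phi> y\<bar> \<le> B * (indicat_real K y *\<^sub>R \<bar>g y\<bar>)" for y
    using B[of y] mult_left_mono[of "\<bar>\<phi> y\<bar>" B "\<bar>g y\<bar>"]
    by (auto simp: abs_mult mult_ac split: split_indicator)
  have abs: "integrable lebesgue (\<lambda>y. indicat_real K y *\<^sub>R \<bar>g y\<bar>)"
    using set_integrable_abs[OF g] by (simp add: set_integrable_def)
  have int: "integrable lebesgue (\<lambda>y. (indicat_real K y *\<^sub>R g y) * \<phi> y)"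
  proof (rule Bochner_Integration.integrable_bound[OF _ meas AE_I2])
    show "integrable lebesgue (\<lambda>y. B * (indicat_real K y *\<^sub>R \<bar>g y\<bar>))" using abs by (intro integrable_mult_right)
    show "norm ((indicat_real K y *\<^sub>R g y) * \<phi> y) \<le> norm (B * (indicat_real K y *\<^sub>R \<bar>g y\<bar>))" for y
      using bound[of y] unfolding real_norm_def by (meson abs_ge_self order_trans)
  qed
  show "set_integrable lebesgue U (\<lambda>y. g y * \<phi> y)"
    unfolding set_integrable_def eq using int .
  show "(LINT y:U|lebesgue. g y * \<phi> y) = (LINT y:K|lebesgue. g y * \<phi> y)"
    unfolding set_lebesgue_integral_def eq ..
  have "\<bar>LINT y|lebesgue. (indicat_real K y *\<^sub>R g y) * \<phi> y\<bar> \<le> (LINT y|lebesgue. \<bar>(indicat_real K y *\<^sub>R g y) * \<phi> y\<bar>)"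
    by (rule integral_abs_bound)
  also have "\<dots> \<le> (LINT y|lebesgue. B * (indicat_real K y *\<^sub>R \<bar>g y\<bar>))"
    using bound int abs by (intro integral_mono integrable_abs integrable_mult_right) auto
  finally show "\<bar>LINT y:U|lebesgue. g y * \<phi> y\<bar> \<le> B * (LINT y:K|lebesgue. \<bar>g y\<bar>)"
    unfolding set_lebesgue_integral_def eq integral_mult_right_zero .
qed

lemma mollifier_support: "0 < r \<Longrightarrow> y \<notin> cball x r \<Longrightarrow> mollifier r (y - x) = 0"
  by (rule mollifier_eq_0) (auto simp: dist_norm norm_minus_commute)

lemma test_function_supported:
  assumes "\<And>k. Ck k \<phi>" and "\<And>y. y \<notin> cball x r \<Longrightarrow> \<phi> y = 0" and "cball x r \<subseteq> U"
  shows "test_function U \<phi>"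
proof -
  have "closure {y. \<phi> y \<noteq> 0} \<subseteq> cball x r"
    using assms(2) by (intro closure_minimal closed_cball) blast
  moreover from this have "compact (closure {y. \<phi> y \<noteq> 0})"
    by (meson bounded_cball bounded_subset closed_closure compact_eq_bounded_closed)
  ultimately show ?thesis using assms by (auto simp: test_function_def)
qed

lemma test_function_mollifier:
  "0 < r \<Longrightarrow> cball x r \<subseteq> U \<Longrightarrow> test_function U (\<lambda>y. mollifier r (y - x))"
  by (rule test_function_supported) (auto intro: Ck_mollifier mollifier_support)

lemma test_function_flow:
  assumes "0 < r" "cball x r \<subseteq> U"
  shows "test_function U (\<lambda>y. (flow x r x' r' y \<bullet> b) * mollifier r (y - x))"
proof (rule test_function_supported[OF _ _ assms(2)])
  have "Ck k (\<lambda>y. x' \<bullet> b + r' * (((y - x) /\<^sub>R r) \<bullet> b))" for k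
    by (intro Ck_add Ck_mult Ck_const Ck_affine_inner)
  then show "Ck k (\<lambda>y. (flow x r x' r' y \<bullet> b) * mollifier r (y - x))" for k
    by (intro Ck_mult Ck_mollifier) (simp add: flow_def inner_add_left divide_inverse mult.assoc)
qed (use assms in \<open>auto intro: mollifier_support\<close>)

text \<open>Almost every point is a point of differentiation of all functions \<open>\<bar>f - q\<bar>\<close> with rational \<open>q\<close>; a
  rational \<open>q\<close> close to \<open>f x\<close> then controls \<open>\<bar>f - f x\<bar>\<close>.\<close>

lemma lebesgue_point_boxes:
  fixes f :: "'a::euclidean_space \<Rightarrow> real"
  assumes f: "integrable lebesgue f"
  shows "AE x in lebesgue. \<forall>e>0. \<exists>d>0. \<forall>t. 0 < t \<and> t < d \<longrightarrow>
    (LINT y:cbox x (x + t *\<^sub>R One)|lebesgue. \<bar>f y - f x\<bar>) \<le> e * t ^ DIM('a)"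
proof -
  have i: "set_integrable lebesgue (cbox a b) (\<lambda>y. \<bar>f y - c\<bar>)" for a b c
  proof (intro set_integrable_abs set_integral_diff)
    show "set_integrable lebesgue (cbox a b) f"
      using f unfolding set_integrable_def by (intro integrable_mult_indicator) auto
    show "set_integrable lebesgue (cbox a b) (\<lambda>_. c)"
      using lmeasurable_cbox[of a b] unfolding set_integrable_def
      by (intro integrable_scaleR_left integrable_real_indicator) (auto simp: fmeasurable_def)
  qed
  have "\<exists>N. negligible N \<and> (\<forall>x e. x \<notin> N \<longrightarrow> 0 < e \<longrightarrow>
      (\<exists>d>0. \<forall>t. 0 < t \<and> t < d \<longrightarrow>
        norm (integral (cbox x (x + t *\<^sub>R One)) (\<lambda>y. \<bar>f y - of_rat q\<bar>) /\<^sub>R t ^ DIM('a) - \<bar>f x - of_rat q\<bar>) < e))" for q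
    using integrable_ccontinuous_explicit[of "\<lambda>y. \<bar>f y - of_rat q\<bar>"] set_lebesgue_integral_eq_integral(1)[OF i] by metis
  then obtain N where N: "\<And>q. negligible (N q)" "\<And>q x e. x \<notin> N q \<Longrightarrow> 0 < e \<Longrightarrow>
      (\<exists>d>0. \<forall>t. 0 < t \<and> t < d \<longrightarrow>
        norm (integral (cbox x (x + t *\<^sub>R One)) (\<lambda>y. \<bar>f y - of_rat q\<bar>) /\<^sub>R t ^ DIM('a) - \<bar>f x - of_rat q\<bar>) < e)"
    by metis
  have "AE x in lebesgue. x \<notin> N q" for q
    using N(1)[of q] AE_not_in negligible_iff_null_sets by blast
  then have "AE x in lebesgue. \<forall>q. x \<notin> N q" by (simp add: AE_all_countable)
  then show ?thesis
  proof eventually_elim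
    case (elim x)
    show ?case
    proof (intro allI impI)
      fix e :: real assume e: "0 < e"
      obtain q where q: "\<bar>f x - of_rat q\<bar> < e / 4"
      proof -
        obtain q where "f x - e / 4 < of_rat q" "of_rat q < f x + e / 4"
          using of_rat_dense[of "f x - e / 4" "f x + e / 4"] e by auto
        then show thesis by (intro that[of q]) linarith
      qed
      obtain d where d: "0 < d" "\<And>t. 0 < t \<Longrightarrow> t < d \<Longrightarrow>
        norm (integral (cbox x (x + t *\<^sub>R One)) (\<lambda>y. \<bar>f y - of_rat q\<bar>) /\<^sub>R t ^ DIM('a) - \<bar>f x - of_rat q\<bar>) < e / 4"
        using N(2)[of x q "e / 4"] elim e by auto
      have "(LINT y:cbox x (x + t *\<^sub>R One)|lebesgue. \<bar>f y - f x\<bar>) \<le> e * t ^ DIM('a)" if t: "0 < t" "t < d" for t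
      proof -
        let ?B = "cbox x (x + t *\<^sub>R One)"
        have B: "measure lebesgue ?B = t ^ DIM('a)"
          using t by (simp add: content_cbox_if inner_add_left box_eq_empty not_less algebra_simps)
        have const: "set_integrable lebesgue ?B (\<lambda>y. \<bar>of_rat q - f x\<bar>)"
          using lmeasurable_cbox[of x "x + t *\<^sub>R One"] unfolding set_integrable_def
          by (intro integrable_scaleR_left integrable_real_indicator) (auto simp: fmeasurable_def)
        have "inverse (t ^ DIM('a)) * (LINT y:?B|lebesgue. \<bar>f y - of_rat q\<bar>) < e / 2"
          using d(2)[OF t] q unfolding set_lebesgue_integral_eq_integral(2)[OF i, symmetric] real_norm_def real_scaleR_def
          by linarith
        then have 1: "(LINT y:?B|lebesgue. \<bar>f y - of_rat q\<bar>) < e / 2 * t ^ DIM('a)"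
          using t by (simp add: divide_inverse[symmetric] mult.commute[of "inverse _"] divide_less_eq)
        have "(LINT y:?B|lebesgue. \<bar>f y - f x\<bar>) \<le> (LINT y:?B|lebesgue. \<bar>f y - of_rat q\<bar> + \<bar>of_rat q - f x\<bar>)"
          by (intro set_integral_mono i set_integral_add const) linarith
        also have "\<dots> = (LINT y:?B|lebesgue. \<bar>f y - of_rat q\<bar>) + \<bar>of_rat q - f x\<bar> * t ^ DIM('a)"
          by (subst set_integral_add(2)[OF i const]) (simp add: B set_integral_const emeasure_completion set_lebesgue_integral_def)
        also have "\<dots> \<le> e / 2 * t ^ DIM('a) + e / 2 * t ^ DIM('a)"
          using 1 q t e by (intro add_mono less_imp_le[OF 1] mult_right_mono) (auto simp: abs_minus_commute)
        finally show ?thesis by (simp add: algebra_simps)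
      qed
      with d(1) show "\<exists>d>0. \<forall>t. 0 < t \<and> t < d \<longrightarrow> (LINT y:cbox x (x + t *\<^sub>R One)|lebesgue. \<bar>f y - f x\<bar>) \<le> e * t ^ DIM('a)"
        by blast
    qed
  qed
qed

lemma kernel_ball_subset_box:
  fixes x :: "'a::euclidean_space"
  shows "cball (x + (t / 2) *\<^sub>R One) (t / 2) \<subseteq> cbox x (x + t *\<^sub>R One)"
proof
  fix y assume y: "y \<in> cball (x + (t / 2) *\<^sub>R One) (t / 2)"
  have "x \<bullet> b \<le> y \<bullet> b \<and> y \<bullet> b \<le> (x + t *\<^sub>R One) \<bullet> b" if b: "b \<in> Basis" for b
  proof -
    have "\<bar>(y - (x + (t / 2) *\<^sub>R One)) \<bullet> b\<bar> \<le> t / 2"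
      using Basis_le_norm[OF b, of "y - (x + (t / 2) *\<^sub>R One)"] y
      by (simp add: dist_norm norm_minus_commute)
    then have "\<bar>y \<bullet> b - (x \<bullet> b + t / 2)\<bar> \<le> t / 2"
      using b by (simp add: inner_diff_left inner_add_left)
    then have "x \<bullet> b \<le> y \<bullet> b" "y \<bullet> b \<le> x \<bullet> b + t" by linarith+
    then show ?thesis using b by (simp add: inner_add_left)
  qed
  then show "y \<in> cbox x (x + t *\<^sub>R One)" by (simp add: mem_box)
qed

lemma box_subset_cball:
  fixes x :: "'a::euclidean_space"
  shows "cbox x (x + t *\<^sub>R One) \<subseteq> cball x (real DIM('a) * t)"
proof
  fix y assume y: "y \<in> cbox x (x + t *\<^sub>R One)"
  have "norm (y - x) \<le> (\<Sum>b\<in>Basis. \<bar>(y - x) \<bullet> b\<bar>)" by (rule norm_le_l1)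
  also have "\<dots> \<le> (\<Sum>b\<in>(Basis::'a set). t)"
  proof (rule sum_mono)
    fix b :: 'a assume b: "b \<in> Basis"
    then have "x \<bullet> b \<le> y \<bullet> b \<and> y \<bullet> b \<le> x \<bullet> b + t"
      using y by (auto simp: mem_box inner_add_left)
    then show "\<bar>(y - x) \<bullet> b\<bar> \<le> t" by (auto simp: inner_diff_left)
  qed
  finally show "y \<in> cball x (real DIM('a) * t)"
    by (simp add: dist_norm norm_minus_commute)
qed

lemma eventually_at_right_small:
  fixes d r k :: real
  assumes "0 < d" "0 < r"
  shows "eventually (\<lambda>t. 0 < t \<and> t < d \<and> k * t \<le> r) (at_right 0)"
proof -
  have "((\<lambda>t. k * t) \<longlongrightarrow> k * 0) (at_right 0)" "((\<lambda>t. t) \<longlongrightarrow> 0) (at_right (0::real))"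
    by (intro tendsto_intros)+
  then have "eventually (\<lambda>t. k * t < r) (at_right 0)" "eventually (\<lambda>t. t < d) (at_right 0)"
    using assms by (auto intro: order_tendstoD(2))
  moreover have "eventually (\<lambda>t. 0 < t) (at_right (0::real))" by (rule eventually_at_right_less)
  ultimately show ?thesis by eventually_elim auto
qed

text \<open>The balls are inscribed in boxes that have \<open>x\<close> as a corner, because these boxes shrink to a Lebesgue
  point.\<close>

lemma avg_tendsto_AE:
  fixes h :: "'a::euclidean_space \<Rightarrow> real"
  assumes "open U" and loc: "\<And>K. compact K \<Longrightarrow> K \<subseteq> U \<Longrightarrow> set_integrable lebesgue K h"
  shows "AE x in lebesgue. x \<in> U \<longrightarrow>
    ((\<lambda>t. avg U (x + (t / 2) *\<^sub>R One) (t / 2) h) \<longlongrightarrow> h x) (at_right 0)"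
proof -
  obtain C where C: "\<And>n. compact (C n)" "\<And>n. C n \<subseteq> U" "\<And>n. C n \<subseteq> interior (C (Suc n))" "\<Union>(range C) = U"
    using open_Union_compact_subsets[OF \<open>open U\<close>] by metis
  define f where "f n y = indicat_real (C n) y *\<^sub>R h y" for n y
  have "integrable lebesgue (f n)" for n
    using loc[OF C(1,2), of n] unfolding f_def set_integrable_def .
  then have "AE x in lebesgue. \<forall>n. \<forall>e>0. \<exists>d>0. \<forall>t. 0 < t \<and> t < d \<longrightarrow>
    (LINT y:cbox x (x + t *\<^sub>R One)|lebesgue. \<bar>f n y - f n x\<bar>) \<le> e * t ^ DIM('a)"
    unfolding AE_all_countable using lebesgue_point_boxes by blast
  then show ?thesis
  proof eventually_elim
    case (elim x)
    show ?case
    proof (intro impI tendstoI)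
      fix e :: real assume xU: "x \<in> U" and e: "0 < e"
      let ?I = "bump_mass TYPE('a)"
      define c where "c = 2 ^ DIM('a) / ?I"
      have c: "0 < c" using bump_mass_pos[where 'a='a] by (simp add: c_def)
      obtain n where "x \<in> C n" using C(4) xU by blast
      with C(3) have "x \<in> interior (C (Suc n))" by blast
      then obtain r where r: "0 < r" "cball x r \<subseteq> C (Suc n)"
        by (meson mem_interior_cball)
      obtain d where d: "0 < d" "\<And>t. 0 < t \<Longrightarrow> t < d \<Longrightarrow>
          (LINT y:cbox x (x + t *\<^sub>R One)|lebesgue. \<bar>f (Suc n) y - f (Suc n) x\<bar>) \<le> (e / (2 * c)) * t ^ DIM('a)"
        using elim[rule_format, of "e / (2 * c)" "Suc n"] e c by auto
      have "dist (avg U (x + (t / 2) *\<^sub>R One) (t / 2) h) (h x) < e"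
        if t: "0 < t" "t < d" "real DIM('a) * t \<le> r" for t
      proof -
        let ?B = "cbox x (x + t *\<^sub>R One)" and ?z = "x + (t / 2) *\<^sub>R One"
        let ?\<psi> = "\<lambda>y. mollifier (t / 2) (y - ?z)"
        have BC: "?B \<subseteq> C (Suc n)"
          using box_subset_cball[of x t] r(2) t(3) by (meson order_trans subset_cball)
        then have BU: "?B \<subseteq> U" using C(2) by blast
        have h: "set_integrable lebesgue ?B h" by (intro loc compact_cbox BU)
        have 0: "?\<psi> y = 0" if "y \<notin> ?B" for y
          using kernel_ball_subset_box[of x t] that t(1) by (intro mollifier_support) auto
        have const: "set_integrable lebesgue ?B (\<lambda>y. h x)"
          using lmeasurable_cbox[of x "x + t *\<^sub>R One"] unfolding set_integrable_def
          by (intro integrable_scaleR_left integrable_real_indicator) (auto simp: fmeasurable_def)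
        have \<psi>: "?\<psi> \<in> borel_measurable borel" by measurable
        have bd: "\<bar>?\<psi> y\<bar> \<le> inverse ((t / 2) ^ DIM('a) * ?I)" for y
          using mollifier_nonneg[of "t / 2" "y - ?z"] mollifier_le[of "t / 2" "y - ?z"] t by simp
        have "1 = (LINT y|lebesgue. ?\<psi> y)"
          using integral_mollifier[of "t / 2" ?z] t by (subst integral_completion) (auto)
        also have "\<dots> = (LINT y:?B|lebesgue. ?\<psi> y)"
          unfolding set_lebesgue_integral_def using 0
          by (intro Bochner_Integration.integral_cong) (auto split: split_indicator)
        finally have one: "(LINT y:?B|lebesgue. ?\<psi> y) = 1" by simp
        have "avg U ?z (t / 2) h - h x = (LINT y:?B|lebesgue. h y * ?\<psi> y) - (LINT y:?B|lebesgue. h x * ?\<psi> y)"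
          unfolding avg_def using set_integral_mult_supported[OF h BU \<psi> bd 0] one by simp
        also have "\<dots> = (LINT y:?B|lebesgue. (h y - h x) * ?\<psi> y)"
          using set_integrable_mult_supported[OF h order_refl \<psi> bd 0] set_integrable_mult_supported[OF const order_refl \<psi> bd 0]
          by (simp add: set_integral_diff(2)[symmetric] left_diff_distrib)
        finally have "\<bar>avg U ?z (t / 2) h - h x\<bar>
            \<le> inverse ((t / 2) ^ DIM('a) * ?I) * (LINT y:?B|lebesgue. \<bar>h y - h x\<bar>)"
          using set_integral_mult_supported_bound[OF set_integral_diff(1)[OF h const] order_refl \<psi> bd 0] by simp
        also have "(LINT y:?B|lebesgue. \<bar>h y - h x\<bar>) = (LINT y:?B|lebesgue. \<bar>f (Suc n) y - f (Suc n) x\<bar>)"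
          using BC \<open>x \<in> interior (C (Suc n))\<close> interior_subset
          by (intro set_lebesgue_integral_cong) (auto simp: f_def split: split_indicator)
        also have "inverse ((t / 2) ^ DIM('a) * ?I) * \<dots> \<le> inverse ((t / 2) ^ DIM('a) * ?I) * ((e / (2 * c)) * t ^ DIM('a))"
          using d(2)[OF t(1,2)] t bump_mass_pos[where 'a='a] by (intro mult_left_mono) auto
        also have "\<dots> = e / 2"
          using t c bump_mass_pos[where 'a='a] by (simp add: c_def power_divide field_simps)
        finally show ?thesis using e by (simp add: dist_real_def)
      qed
      then show "\<forall>\<^sub>F t in at_right 0. dist (avg U (x + (t / 2) *\<^sub>R One) (t / 2) h) (h x) < e"
        using eventually_at_right_small[OF d(1) r(1), of "real DIM('a)"] by (rule eventually_mono[rotated]) auto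
    qed
  qed
qed

lemma is_weak_partialD:
  assumes "is_weak_partial U b u g" "test_function U \<phi>"
  shows "(LINT y:U|lebesgue. g y * \<phi> y) = - (LINT y:U|lebesgue. u y * frechet_derivative \<phi> (at y) b)"
  using assms unfolding is_weak_partial_def by simp

text \<open>The fundamental lemma of the calculus of variations, with mollifiers as test functions.\<close>

lemma is_weak_partial_unique:
  assumes "open U" and g: "is_weak_partial U b u g" and h: "is_weak_partial U b u h"
  shows "AE x in lebesgue. x \<in> U \<longrightarrow> g x = h x"
proof -
  have "AE x in lebesgue. x \<in> U \<longrightarrow>
      ((\<lambda>t. avg U (x + (t / 2) *\<^sub>R One) (t / 2) g) \<longlongrightarrow> g x) (at_right 0)"
    "AE x in lebesgue. x \<in> U \<longrightarrow>
      ((\<lambda>t. avg U (x + (t / 2) *\<^sub>R One) (t / 2) h) \<longlongrightarrow> h x) (at_right 0)"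
    using g h by (simp_all add: is_weak_partial_def avg_tendsto_AE[OF \<open>open U\<close>])
  then show ?thesis
  proof eventually_elim
    case (elim x)
    show ?case
    proof
      assume x: "x \<in> U"
      then obtain r where r: "0 < r" "cball x r \<subseteq> U"
        using \<open>open U\<close> open_contains_cball by blast
      have "avg U (x + (t / 2) *\<^sub>R One) (t / 2) g = avg U (x + (t / 2) *\<^sub>R One) (t / 2) h"
        if t: "0 < t" "real DIM('a) * t \<le> r" for t
      proof -
        let ?z = "x + (t / 2) *\<^sub>R One"
        have "cball ?z (t / 2) \<subseteq> U"
          using kernel_ball_subset_box[of x t] box_subset_cball[of x t] r(2) t(2)
          by (meson order_trans subset_cball)
        then have "test_function U (\<lambda>y. mollifier (t / 2) (y - ?z))"
          using t by (intro test_function_mollifier) auto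
        then show ?thesis
          unfolding avg_def using is_weak_partialD[OF g] is_weak_partialD[OF h] by simp
      qed
      then have "\<forall>\<^sub>F t in at_right 0. avg U (x + (t / 2) *\<^sub>R One) (t / 2) g = avg U (x + (t / 2) *\<^sub>R One) (t / 2) h"
        using eventually_at_right_small[OF r(1) r(1), of "real DIM('a)"] by (rule eventually_mono[rotated]) auto
      then have "((\<lambda>t. avg U (x + (t / 2) *\<^sub>R One) (t / 2) h) \<longlongrightarrow> g x) (at_right 0)"
        by (rule Lim_transform_eventually[OF elim(1)[rule_format, OF x]])
      then show "g x = h x"
        by (rule tendsto_unique[OF trivial_limit_at_right_real _ elim(2)[rule_format, OF x]])
    qed
  qed
qed

text \<open>\<^const>\<open>W1p_norm\<close> is built from arbitrarily chosen weak derivatives.  Uniqueness shows that the chosen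
  ones have the required integrability, so that the norm really controls the gradient.\<close>

lemma Lp_on_weak_partial:
  assumes "open U" "u \<in> W1p p U" "b \<in> Basis"
  shows is_weak_partial_weak_partial: "is_weak_partial U b u (weak_partial U b u)"
    and "Lp_on p U (weak_partial U b u)"
proof -
  obtain g where g: "is_weak_partial U b u g" "Lp_on p U g"
    using assms by (auto simp: W1p_def)
  then show w: "is_weak_partial U b u (weak_partial U b u)"
    unfolding weak_partial_def by (metis someI)
  have ae: "AE x in lebesgue. x \<in> U \<longrightarrow> g x = weak_partial U b u x"
    by (rule is_weak_partial_unique[OF \<open>open U\<close> g(1) w])
  have eq: "AE x in lebesgue. indicat_real U x *\<^sub>R g x = indicat_real U x *\<^sub>R weak_partial U b u x"
    "AE x in lebesgue. indicat_real U x *\<^sub>R \<bar>g x\<bar> powr p = indicat_real U x *\<^sub>R \<bar>weak_partial U b u x\<bar> powr p"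
    using ae by (eventually_elim; auto split: split_indicator)+
  have gm: "(\<lambda>x. indicat_real U x *\<^sub>R g x) \<in> borel_measurable lebesgue"
    and gi: "integrable lebesgue (\<lambda>x. indicat_real U x *\<^sub>R \<bar>g x\<bar> powr p)"
    using g(2) by (auto simp: Lp_on_def set_borel_measurable_def set_integrable_def)
  have "(\<lambda>x. indicat_real U x *\<^sub>R \<bar>weak_partial U b u x\<bar> powr p) \<in> borel_measurable lebesgue"
    using borel_measurable_AE[OF borel_measurable_integrable[OF gi] eq(2)] .
  then show "Lp_on p U (weak_partial U b u)"
    unfolding Lp_on_def set_borel_measurable_def set_integrable_def
    using borel_measurable_AE[OF gm eq(1)] integrable_cong_AE[OF borel_measurable_integrable[OF gi] _ eq(2)] gi
    by blast
qed

text \<open>Hoelder's inequality against a constant: integrate \<open>\<bar>g\<bar> \<le> t + t powr (1 - p) * \<bar>g\<bar> powr p\<close> and balance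
  the two terms.\<close>

lemma
  fixes g :: "'a::euclidean_space \<Rightarrow> real"
  assumes p: "1 < p" and B: "B \<in> lmeasurable" "measure lebesgue B \<le> V" "0 < V" "B \<subseteq> U"
    and g: "Lp_on p U g" and N: "0 \<le> N" "(LINT y:U|lebesgue. \<bar>g y\<bar> powr p) \<le> N powr p"
  shows Lp_on_set_integrable: "set_integrable lebesgue B g"
    and Lp_on_integral_bound: "(LINT y:B|lebesgue. \<bar>g y\<bar>) \<le> 2 * N * V powr (1 - 1 / p)"
proof -
  have Bs: "B \<in> sets lebesgue" using B(1) by (rule fmeasurableD)
  have gU: "integrable lebesgue (\<lambda>y. indicat_real U y *\<^sub>R \<bar>g y\<bar> powr p)"
    using g by (simp add: Lp_on_def set_integrable_def)
  have gB: "set_integrable lebesgue B (\<lambda>y. \<bar>g y\<bar> powr p)"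
    using g unfolding Lp_on_def by (rule set_integrable_subset[OF conjunct2 Bs B(4)])
  have const: "set_integrable lebesgue B (\<lambda>_. t :: real)" for t
    using B(1) unfolding set_integrable_def
    by (intro integrable_scaleR_left integrable_real_indicator) (auto simp: fmeasurable_def)
  have ptw: "\<bar>g y\<bar> \<le> t + t powr (1 - p) * \<bar>g y\<bar> powr p" if "0 < t" for t y
  proof (cases "\<bar>g y\<bar> \<le> t")
    case False
    then have "\<bar>g y\<bar> powr (1 - p) \<le> t powr (1 - p)"
      using that p by (intro powr_mono2') auto
    then have "\<bar>g y\<bar> powr (1 - p) * \<bar>g y\<bar> powr p \<le> t powr (1 - p) * \<bar>g y\<bar> powr p"
      by (intro mult_right_mono) auto
    moreover have "\<bar>g y\<bar> powr (1 - p) * \<bar>g y\<bar> powr p = \<bar>g y\<bar>"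
      using False that by (simp add: powr_add[symmetric])
    ultimately show ?thesis using that by linarith
  qed (auto intro: add_increasing2)
  have bound_int: "set_integrable lebesgue B (\<lambda>y. t + t powr (1 - p) * \<bar>g y\<bar> powr p)" for t
    by (intro set_integral_add const set_integrable_mult_right gB)
  have "(\<lambda>y. indicat_real B y *\<^sub>R (indicat_real U y *\<^sub>R g y)) \<in> borel_measurable lebesgue"
    using g unfolding Lp_on_def set_borel_measurable_def
    by (intro borel_measurable_scaleR[OF borel_measurable_indicator[OF Bs]]) (rule conjunct1)
  moreover have "(\<lambda>y. indicat_real B y *\<^sub>R (indicat_real U y *\<^sub>R g y)) = (\<lambda>y. indicat_real B y *\<^sub>R g y)"
    using B(4) by (auto simp: fun_eq_iff split: split_indicator)
  ultimately have "set_borel_measurable lebesgue B g"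
    by (simp add: set_borel_measurable_def)
  moreover have "AE y in lebesgue. y \<in> B \<longrightarrow> norm (g y) \<le> norm (1 + 1 powr (1 - p) * \<bar>g y\<bar> powr p)"
    using ptw[of 1] by (intro AE_I2 impI) (auto intro: order_trans[OF _ abs_ge_self])
  ultimately show gi: "set_integrable lebesgue B g"
    by (rule set_integrable_bound[OF bound_int])
  have le: "(LINT y:B|lebesgue. \<bar>g y\<bar>) \<le> t * V + t powr (1 - p) * N powr p" if t: "0 < t" for t
  proof -
    have "(LINT y:B|lebesgue. \<bar>g y\<bar>) \<le> (LINT y:B|lebesgue. t + t powr (1 - p) * \<bar>g y\<bar> powr p)"
      using ptw[OF t] by (intro set_integral_mono set_integrable_abs gi bound_int)
    also have "\<dots> = (LINT y:B|lebesgue. t) + t powr (1 - p) * (LINT y:B|lebesgue. \<bar>g y\<bar> powr p)"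
      by (subst set_integral_add(2)[OF const]) (auto intro: set_integrable_mult_right gB)
    also have "(LINT y:B|lebesgue. t) = t * measure lebesgue B"
      by (simp add: set_lebesgue_integral_def)
    also have "(LINT y:B|lebesgue. \<bar>g y\<bar> powr p) \<le> (LINT y:U|lebesgue. \<bar>g y\<bar> powr p)"
      using gB gU B(4) unfolding set_lebesgue_integral_def set_integrable_def
      by (intro integral_mono) (auto split: split_indicator)
    finally show ?thesis
      using mult_left_mono[OF B(2), of t] mult_left_mono[OF N(2), of "t powr (1 - p)"] t
      by (smt (verit) mult_left_mono powr_ge_zero)
  qed
  show "(LINT y:B|lebesgue. \<bar>g y\<bar>) \<le> 2 * N * V powr (1 - 1 / p)"
  proof (cases "N = 0")
    case True
    have "(LINT y:B|lebesgue. \<bar>g y\<bar>) \<le> 0 + e" if "0 < e" for e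
      using le[of "e / V"] True that B(3) by simp
    then have "(LINT y:B|lebesgue. \<bar>g y\<bar>) \<le> 0" by (rule field_le_epsilon)
    then show ?thesis using True by simp
  next
    case False
    then have N0: "0 < N" using N by simp
    have "(N * V powr (- (1 / p))) * V + (N * V powr (- (1 / p))) powr (1 - p) * N powr p = 2 * N * V powr (1 - 1 / p)"
    proof -
      have 1: "V powr (- (1 / p)) * V = V powr (1 - 1 / p)"
        using powr_add[of V "- (1 / p)" 1] B(3) by simp
      have "- (1 / p) * (1 - p) = 1 - 1 / p" using p by (simp add: field_simps)
      then have "(V powr (- (1 / p))) powr (1 - p) = V powr (1 - 1 / p)" by (simp add: powr_powr)
      moreover have "N powr (1 - p) * N powr p = N" using N0 by (simp add: powr_add[symmetric])
      ultimately have 2: "(N * V powr (- (1 / p))) powr (1 - p) * N powr p = N * V powr (1 - 1 / p)"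
        using N0 B(3) by (simp add: powr_mult mult_ac)
      show ?thesis unfolding 2 by (simp add: mult.assoc 1)
    qed
    then show ?thesis using le[of "N * V powr (- (1 / p))"] N0 B(3) by simp
  qed
qed

lemma
  assumes "1 < p" "u \<in> W1p p U"
  shows W1p_norm_nonneg: "0 \<le> W1p_norm p U u"
    and W1p_norm_fun: "(LINT y:U|lebesgue. \<bar>u y\<bar> powr p) \<le> W1p_norm p U u powr p"
    and W1p_norm_partial: "b \<in> Basis \<Longrightarrow> (LINT y:U|lebesgue. \<bar>weak_partial U b u y\<bar> powr p) \<le> W1p_norm p U u powr p"
proof -
  let ?A = "LINT y:U|lebesgue. \<bar>u y\<bar> powr p"
  let ?D = "\<lambda>b. LINT y:U|lebesgue. \<bar>weak_partial U b u y\<bar> powr p"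
  have 0: "0 \<le> ?A" "\<And>b. 0 \<le> ?D b"
    unfolding set_lebesgue_integral_def by (auto intro!: integral_nonneg_AE AE_I2)
  then have s: "0 \<le> ?A + sum ?D Basis" by (intro add_nonneg_nonneg sum_nonneg) auto
  have N: "W1p_norm p U u powr p = ?A + sum ?D Basis"
    using assms(1) s by (simp add: W1p_norm_def powr_powr)
  show "0 \<le> W1p_norm p U u" by (simp add: W1p_norm_def)
  show "?A \<le> W1p_norm p U u powr p" unfolding N using 0 by (simp add: sum_nonneg)
  show "?D b \<le> W1p_norm p U u powr p" if "b \<in> Basis"
    unfolding N using 0 member_le_sum[OF that, of ?D] by fastforce
qed

lemma W1p_set_integrable:
  assumes "open U" "bounded U" "1 < p" "u \<in> W1p p U"
  shows "set_integrable lebesgue U u"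
proof -
  have "U \<in> lmeasurable" by (rule lmeasurable_open[OF assms(2,1)])
  then show ?thesis
    using Lp_on_set_integrable[OF assms(3) _ _ _ order_refl _ W1p_norm_nonneg[OF assms(3,4)] W1p_norm_fun[OF assms(3,4)],
        of "measure lebesgue U + 1"] assms(4)
    by (simp add: W1p_def add_nonneg_pos)
qed

lemma DERIV_integral:
  fixes f f' :: "real \<Rightarrow> 'b \<Rightarrow> real"
  assumes "0 < \<epsilon>" and int: "\<And>s. \<bar>s - s0\<bar> < \<epsilon> \<Longrightarrow> integrable M (f s)"
    and deriv: "\<And>s y. \<bar>s - s0\<bar> < \<epsilon> \<Longrightarrow> ((\<lambda>s. f s y) has_real_derivative f' s y) (at s)"
    and meas: "f' s0 \<in> borel_measurable M"
    and w: "integrable M w" and bd: "\<And>s y. \<bar>s - s0\<bar> < \<epsilon> \<Longrightarrow> \<bar>f' s y\<bar> \<le> w y"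
  shows "((\<lambda>s. \<integral>y. f s y \<partial>M) has_real_derivative (\<integral>y. f' s0 y \<partial>M)) (at s0)"
proof -
  have quot: "\<bar>(f (s0 + h) y - f s0 y) / h\<bar> \<le> w y" if "h \<noteq> 0" "\<bar>h\<bar> < \<epsilon>" for h y
  proof -
    have ball: "s \<in> ball s0 \<epsilon> \<longleftrightarrow> \<bar>s - s0\<bar> < \<epsilon>" for s
      using dist_commute[of s0 s] by (simp add: dist_real_def)
    have "norm (f (s0 + h) y - f s0 y) \<le> w y * norm (s0 + h - s0)"
    proof (rule field_differentiable_bound[of "ball s0 \<epsilon>" "\<lambda>s. f s y" "\<lambda>s. f' s y"])
      show "((\<lambda>s. f s y) has_field_derivative f' s y) (at s within ball s0 \<epsilon>)" if "s \<in> ball s0 \<epsilon>" for s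
        using that unfolding ball by (rule has_field_derivative_at_within[OF deriv])
      show "norm (f' s y) \<le> w y" if "s \<in> ball s0 \<epsilon>" for s
        using that bd[of s y] unfolding ball by simp
      show "s0 + h \<in> ball s0 \<epsilon>" "s0 \<in> ball s0 \<epsilon>"
        unfolding ball using that \<open>0 < \<epsilon>\<close> by simp_all
    qed (rule convex_ball)
    then show ?thesis using that by (simp add: divide_le_eq)
  qed
  have "((\<lambda>h. ((\<integral>y. f (s0 + h) y \<partial>M) - (\<integral>y. f s0 y \<partial>M)) / h) \<longlongrightarrow> (\<integral>y. f' s0 y \<partial>M)) (at 0)"
    unfolding tendsto_at_iff_sequentially o_def
  proof (intro allI impI)
    fix X :: "nat \<Rightarrow> real" assume X: "\<forall>i. X i \<in> UNIV - {0}" and X0: "X \<longlonglongrightarrow> 0"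
    define Y where "Y i = (if \<bar>X i\<bar> < \<epsilon> then X i else \<epsilon> / 2)" for i
    have Y: "Y i \<noteq> 0" "\<bar>Y i\<bar> < \<epsilon>" for i using X \<open>0 < \<epsilon>\<close> by (auto simp: Y_def)
    have "eventually (\<lambda>i. \<bar>X i\<bar> < \<epsilon>) sequentially"
      using tendstoD[OF X0 \<open>0 < \<epsilon>\<close>] by (simp add: dist_real_def)
    then have XY: "eventually (\<lambda>i. X i = Y i) sequentially"
      by eventually_elim (auto simp: Y_def)
    have Y0: "Y \<longlonglongrightarrow> 0" using Lim_transform_eventually[OF X0 XY] .
    have "(\<lambda>i. \<integral>y. (f (s0 + Y i) y - f s0 y) / Y i \<partial>M) \<longlonglongrightarrow> (\<integral>y. f' s0 y \<partial>M)"
    proof (rule integral_dominated_convergence[OF meas _ w])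
      show "(\<lambda>y. (f (s0 + Y i) y - f s0 y) / Y i) \<in> borel_measurable M" for i
        using int[of "s0 + Y i"] int[of s0] Y \<open>0 < \<epsilon>\<close> by (intro borel_measurable_divide borel_measurable_diff) auto
      show "AE y in M. norm ((f (s0 + Y i) y - f s0 y) / Y i) \<le> w y" for i
        using quot[OF Y] by (intro AE_I2) simp
      show "AE y in M. (\<lambda>i. (f (s0 + Y i) y - f s0 y) / Y i) \<longlonglongrightarrow> f' s0 y"
      proof (rule AE_I2)
        fix y
        have "((\<lambda>h. (f (s0 + h) y - f s0 y) / h) \<longlongrightarrow> f' s0 y) (at 0)"
          using deriv[of s0 y] \<open>0 < \<epsilon>\<close> by (simp add: DERIV_def)
        then show "(\<lambda>i. (f (s0 + Y i) y - f s0 y) / Y i) \<longlonglongrightarrow> f' s0 y"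
          using Y(1) Y0 unfolding tendsto_at_iff_sequentially o_def by blast
      qed
    qed
    moreover have "(\<integral>y. (f (s0 + Y i) y - f s0 y) / Y i \<partial>M) = ((\<integral>y. f (s0 + Y i) y \<partial>M) - (\<integral>y. f s0 y \<partial>M)) / Y i" for i
      using int[of "s0 + Y i"] int[of s0] Y \<open>0 < \<epsilon>\<close> by simp
    ultimately have "(\<lambda>i. ((\<integral>y. f (s0 + Y i) y \<partial>M) - (\<integral>y. f s0 y \<partial>M)) / Y i) \<longlonglongrightarrow> (\<integral>y. f' s0 y \<partial>M)"
      using Y(1) by simp
    then show "(\<lambda>i. ((\<integral>y. f (s0 + X i) y \<partial>M) - (\<integral>y. f s0 y \<partial>M)) / X i) \<longlonglongrightarrow> (\<integral>y. f' s0 y \<partial>M)"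
      by (rule Lim_transform_eventually) (use XY in eventually_elim, simp)
  qed
  then show ?thesis by (simp only: DERIV_def)
qed

lemma test_function_deriv_bounded:
  fixes \<phi> :: "'a::euclidean_space \<Rightarrow> real"
  assumes "test_function U \<phi>" and b: "b \<in> Basis"
  obtains B where "\<And>y. \<bar>frechet_derivative \<phi> (at y) b\<bar> \<le> B"
    and "(\<lambda>y. frechet_derivative \<phi> (at y) b) \<in> borel_measurable borel"
proof -
  let ?S = "closure {y. \<phi> y \<noteq> 0}" and ?D = "\<lambda>y. frechet_derivative \<phi> (at y) b"
  have "Ck (Suc 0) \<phi>" and S: "compact ?S" using assms(1) unfolding test_function_def by blast+
  then have cont: "continuous_on UNIV ?D" using b by simp
  then have "compact (?D ` ?S)" using S by (intro compact_continuous_image) (auto intro: continuous_on_subset)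
  then obtain B where B: "0 < B" "\<And>y. y \<in> ?S \<Longrightarrow> \<bar>?D y\<bar> \<le> B"
    by (auto simp: bounded_pos dest!: compact_imp_bounded)
  have "\<bar>?D y\<bar> \<le> B" for y
  proof (cases "y \<in> ?S")
    case False
    have "(\<phi> has_derivative (\<lambda>_. 0)) (at y)"
    proof (rule has_derivative_transform_within_open[of "\<lambda>_. 0" _ _ _ "- ?S"])
      show "0 = \<phi> z" if "z \<in> - ?S" for z
        using that closure_subset[of "{y. \<phi> y \<noteq> 0}"] by auto
    qed (use False in auto)
    then have "?D y = 0" by (metis frechet_derivative_at)
    then show ?thesis using B by simp
  qed (use B in auto)
  then show ?thesis using that borel_measurable_continuous_onI[OF cont] by blast
qed

lemma measure_cball_le: 
  fixes x :: "'a::euclidean_space"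
  assumes "0 \<le> r" shows "measure lebesgue (cball x r) \<le> (2 * r) ^ DIM('a)"
proof -
  have sub: "cball x r \<subseteq> cbox (x - r *\<^sub>R One) (x + r *\<^sub>R One)"
  proof
    fix y assume y: "y \<in> cball x r"
    have "x \<bullet> b - r \<le> y \<bullet> b \<and> y \<bullet> b \<le> x \<bullet> b + r" if b: "b \<in> Basis" for b
    proof -
      have "\<bar>y \<bullet> b - x \<bullet> b\<bar> \<le> r"
        using Basis_le_norm[OF b, of "y - x"] y by (simp add: dist_norm norm_minus_commute inner_diff_left)
      then show ?thesis by linarith
    qed
    then show "y \<in> cbox (x - r *\<^sub>R One) (x + r *\<^sub>R One)"
      by (simp add: mem_box inner_add_left inner_diff_left)
  qed
  have "measure lebesgue (cball x r) \<le> measure lebesgue (cbox (x - r *\<^sub>R One) (x + r *\<^sub>R One))"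
    by (rule measure_mono_fmeasurable[OF sub]) auto
  also have "\<dots> = (\<Prod>b\<in>(Basis :: 'a set). (x + r *\<^sub>R One) \<bullet> b - (x - r *\<^sub>R One) \<bullet> b)"
    using assms by (simp add: content_cbox_if box_eq_empty inner_add_left inner_diff_left not_less)
  also have "\<dots> = (\<Prod>b\<in>(Basis :: 'a set). 2 * r)"
    by (rule prod.cong) (auto simp: inner_add_left inner_diff_left)
  finally show ?thesis by simp
qed

lemma borel_measurable_flow_divergence:
  fixes x :: "'a::euclidean_space"
  assumes "0 < r"
  shows "(\<lambda>y. \<Sum>b\<in>Basis. frechet_derivative (\<lambda>y. (flow x r x' r' y \<bullet> b) * mollifier r (y - x)) (at y) b) \<in> borel_measurable borel"
proof -
  have "continuous_on UNIV (\<lambda>y. std_bump ((y - x) /\<^sub>R r))" "continuous_on UNIV (\<lambda>y. bump_grad ((y - x) /\<^sub>R r))"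
    by (rule continuous_on_compose2[OF continuous_std_bump] continuous_on_compose2[OF continuous_bump_grad];
      auto intro!: continuous_intros)+
  then show ?thesis
    unfolding flow_divergence[OF assms] unfolding flow_def
    by (intro borel_measurable_continuous_onI continuous_intros) (use assms in auto)
qed

definition path_const :: "'a::euclidean_space itself \<Rightarrow> real \<Rightarrow> real" where
  "path_const _ p = real DIM('a) * (2 * (2 ^ DIM('a)) powr (1 - 1 / p) / bump_mass TYPE('a))"

lemma path_const_nonneg: "0 \<le> path_const TYPE('a::euclidean_space) p"
  using bump_mass_pos[where 'a='a] by (simp add: path_const_def)

lemma avg_path_deriv:
  fixes x x' :: "'a::euclidean_space" and r r' :: real
  defines "X \<equiv> (\<lambda>s. x + s *\<^sub>R x')" and "R \<equiv> (\<lambda>s. r + s * r')"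
  assumes U: "open U" "bounded U" and p: "1 < p" and u: "u \<in> W1p p U"
    and R: "0 < R s" and ball: "cball (X s) (R s) \<subseteq> U"
  shows "((\<lambda>s. avg U (X s) (R s) u) has_real_derivative
    (\<Sum>b\<in>Basis. LINT y:U|lebesgue. weak_partial U b u y * ((flow (X s) (R s) x' r' y \<bullet> b) * mollifier (R s) (y - X s)))) (at s)"
proof -
  let ?\<phi> = "\<lambda>s b y. (flow (X s) (R s) x' r' y \<bullet> b) * mollifier (R s) (y - X s)"
  let ?d = "\<lambda>s y. \<Sum>b\<in>Basis. frechet_derivative (?\<phi> s b) (at y) b"
  have ui: "set_integrable lebesgue U u" by (rule W1p_set_integrable[OF U p u])
  obtain M where M: "\<And>x y r. R s / 2 \<le> r \<Longrightarrow>
      \<bar>\<Sum>b\<in>Basis. frechet_derivative (\<lambda>y. (flow x r x' r' y \<bullet> b) * mollifier r (y - x)) (at y) b\<bar> \<le> M"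
    using flow_divergence_bounded[of "R s / 2" x' r'] R by auto
  \<comment> \<open>On this neighbourhood of \<open>s\<close> the radii stay above \<open>R s / 2\<close>, so that the derivatives of the kernel have a common
    bound.\<close>
  define \<epsilon> where "\<epsilon> = R s / (2 * (\<bar>r'\<bar> + 1))"
  have \<epsilon>: "0 < \<epsilon>" using R by (simp add: \<epsilon>_def)
  have R2: "R s / 2 \<le> R t" if "\<bar>t - s\<bar> < \<epsilon>" for t
  proof -
    have "\<bar>R t - R s\<bar> = \<bar>t - s\<bar> * \<bar>r'\<bar>"
      by (simp add: R_def abs_mult[symmetric] left_diff_distrib)
    also have "\<dots> \<le> \<epsilon> * (\<bar>r'\<bar> + 1)" using that \<epsilon> by (intro mult_mono) auto
    also have "\<dots> = R s / 2" by (simp add: \<epsilon>_def field_simps add_pos_nonneg)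
    finally show ?thesis by linarith
  qed
  have Rpos: "0 < R t" if "\<bar>t - s\<bar> < \<epsilon>" for t using R2[OF that] R by linarith
  have int: "set_integrable lebesgue U (\<lambda>y. u y * mollifier (R t) (y - X t))" if "\<bar>t - s\<bar> < \<epsilon>" for t
  proof (rule set_integrable_mult_supported[OF ui order_refl])
    show "(\<lambda>y. mollifier (R t) (y - X t)) \<in> borel_measurable borel" by measurable
    show "\<bar>mollifier (R t) (y - X t)\<bar> \<le> inverse (R t ^ DIM('a) * bump_mass TYPE('a))" for y
      using mollifier_nonneg[of "R t" "y - X t"] mollifier_le[of "R t" "y - X t"] Rpos[OF that] by simp
  qed simp
  have "((\<lambda>s. LINT y|lebesgue. indicat_real U y *\<^sub>R (u y * mollifier (R s) (y - X s))) has_real_derivative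
      (LINT y|lebesgue. indicat_real U y *\<^sub>R (u y * - ?d s y))) (at s)"
  proof (rule DERIV_integral[OF \<epsilon>])
    show "integrable lebesgue (\<lambda>y. indicat_real U y *\<^sub>R (u y * mollifier (R t) (y - X t)))" if "\<bar>t - s\<bar> < \<epsilon>" for t
      using int[OF that] unfolding set_integrable_def .
    show "((\<lambda>s. indicat_real U y *\<^sub>R (u y * mollifier (R s) (y - X s))) has_real_derivative
        indicat_real U y *\<^sub>R (u y * - ?d t y)) (at t)" if "\<bar>t - s\<bar> < \<epsilon>" for t y
      using Rpos[OF that] unfolding X_def R_def real_scaleR_def
      by (intro DERIV_cmult mollifier_path_deriv) simp
    have "(\<lambda>y. (indicat_real U y *\<^sub>R u y) * - ?d s y) \<in> borel_measurable lebesgue"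
      using ui unfolding set_integrable_def
      by (intro borel_measurable_times borel_measurable_uminus borel_in_lebesgue[OF borel_measurable_flow_divergence[OF R]])
         (rule borel_measurable_integrable)
    then show "(\<lambda>y. indicat_real U y *\<^sub>R (u y * - ?d s y)) \<in> borel_measurable lebesgue"
      by (simp add: mult.assoc)
    show "integrable lebesgue (\<lambda>y. M * (indicat_real U y *\<^sub>R \<bar>u y\<bar>))"
      using set_integrable_abs[OF ui] unfolding set_integrable_def by (intro integrable_mult_right)
    show "\<bar>indicat_real U y *\<^sub>R (u y * - ?d t y)\<bar> \<le> M * (indicat_real U y *\<^sub>R \<bar>u y\<bar>)" if "\<bar>t - s\<bar> < \<epsilon>" for t y
      using mult_left_mono[OF M[OF R2[OF that]], of "\<bar>u y\<bar>"]
      by (auto simp: abs_mult mult.commute[of M] split: split_indicator)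
  qed
  also have "(LINT y|lebesgue. indicat_real U y *\<^sub>R (u y * - ?d s y))
      = (\<Sum>b\<in>Basis. LINT y:U|lebesgue. weak_partial U b u y * ?\<phi> s b y)"
  proof -
    have tf: "test_function U (?\<phi> s b)" for b by (rule test_function_flow[OF R ball])
    have i: "integrable lebesgue (\<lambda>y. indicat_real U y *\<^sub>R (u y * frechet_derivative (?\<phi> s b) (at y) b))"
      if b: "b \<in> Basis" for b
    proof -
      obtain B where B: "\<And>y. \<bar>frechet_derivative (?\<phi> s b) (at y) b\<bar> \<le> B"
        "(\<lambda>y. frechet_derivative (?\<phi> s b) (at y) b) \<in> borel_measurable borel"
        by (rule test_function_deriv_bounded[OF tf b]) blast
      show ?thesis
        using set_integrable_mult_supported[OF ui order_refl B(2) B(1)] unfolding set_integrable_def by simp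
    qed
    have "(LINT y|lebesgue. indicat_real U y *\<^sub>R (u y * - ?d s y))
        = (LINT y|lebesgue. (\<Sum>b\<in>Basis. - (indicat_real U y *\<^sub>R (u y * frechet_derivative (?\<phi> s b) (at y) b))))"
      by (intro Bochner_Integration.integral_cong refl) (simp add: sum_distrib_left sum_negf)
    also have "\<dots> = (\<Sum>b\<in>Basis. - (LINT y:U|lebesgue. u y * frechet_derivative (?\<phi> s b) (at y) b))"
      unfolding set_lebesgue_integral_def using i
      by (subst Bochner_Integration.integral_sum) (auto intro!: sum.cong)
    also have "\<dots> = (\<Sum>b\<in>Basis. LINT y:U|lebesgue. weak_partial U b u y * ?\<phi> s b y)"
      using is_weak_partialD[OF is_weak_partial_weak_partial[OF U(1) u] tf] by (intro sum.cong) auto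
    finally show ?thesis .
  qed
  finally show ?thesis unfolding avg_def set_lebesgue_integral_def .
qed

text \<open>Moving the ball along a straight path inside \<open>U\<close> changes the average by the flux of the
  gradient through the swept balls, which Hoelder's inequality bounds.\<close>

lemma avg_path:
  fixes x x' :: "'a::euclidean_space"
  assumes U: "open U" "bounded U" and p: "1 < p" and u: "u \<in> W1p p U"
    and \<rho>: "0 < \<rho>" "\<And>s. 0 \<le> s \<Longrightarrow> s \<le> 1 \<Longrightarrow> \<rho> \<le> r + s * r'"
    and ball: "\<And>s. 0 \<le> s \<Longrightarrow> s \<le> 1 \<Longrightarrow> cball (x + s *\<^sub>R x') (r + s * r') \<subseteq> U"
  shows "\<bar>avg U (x + x') (r + r') u - avg U x r u\<bar>
    \<le> path_const TYPE('a) p * (norm x' + \<bar>r'\<bar>) * \<rho> powr (- (real DIM('a) / p)) * W1p_norm p U u"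
proof -
  define X where "X = (\<lambda>s. x + s *\<^sub>R x')"
  define R where "R = (\<lambda>s. r + s * r')"
  let ?N = "W1p_norm p U u" and ?I = "bump_mass TYPE('a)" and ?v = "norm x' + \<bar>r'\<bar>"
  let ?\<phi> = "\<lambda>s b y. (flow (X s) (R s) x' r' y \<bullet> b) * mollifier (R s) (y - X s)"
  let ?D = "\<lambda>s. \<Sum>b\<in>Basis. LINT y:U|lebesgue. weak_partial U b u y * ?\<phi> s b y"
  let ?C = "path_const TYPE('a) p * ?v * \<rho> powr (- (real DIM('a) / p)) * ?N"
  have N: "0 \<le> ?N" by (rule W1p_norm_nonneg[OF p u])
  have D: "((\<lambda>s. avg U (X s) (R s) u) has_real_derivative ?D s) (at s)" if "0 \<le> s" "s \<le> 1" for s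
    unfolding X_def R_def using \<rho>(1) \<rho>(2)[OF that] ball[OF that]
    by (intro avg_path_deriv[OF U p u]) auto
  have bound: "\<bar>?D s\<bar> \<le> ?C" if s: "0 \<le> s" "s \<le> 1" for s
  proof -
    have R: "\<rho> \<le> R s" "0 < R s" using \<rho>(1) \<rho>(2)[OF s] by (auto simp: R_def)
    let ?B = "cball (X s) (R s)" and ?V = "(2 * R s) ^ DIM('a)"
    have BU: "?B \<subseteq> U" using ball[OF s] by (simp add: X_def R_def)
    let ?K = "?v * inverse (R s ^ DIM('a) * ?I)"
    have one: "\<bar>LINT y:U|lebesgue. weak_partial U b u y * ?\<phi> s b y\<bar> \<le> ?K * (2 * ?N * ?V powr (1 - 1 / p))"
      if b: "b \<in> Basis" for b
    proof -
      note Lp = Lp_on_weak_partial(2)[OF U(1) u b]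
      note B = p lmeasurable_cball[of "X s" "R s"] measure_cball_le[of "R s" "X s"] _ BU Lp N W1p_norm_partial[OF p u b]
      have i: "set_integrable lebesgue ?B (weak_partial U b u)"
        by (rule Lp_on_set_integrable[OF B]) (use R in auto)
      have "\<bar>LINT y:U|lebesgue. weak_partial U b u y * ?\<phi> s b y\<bar> \<le> ?K * (LINT y:?B|lebesgue. \<bar>weak_partial U b u y\<bar>)"
      proof (rule set_integral_mult_supported_bound[OF i BU])
        show "?\<phi> s b \<in> borel_measurable borel" unfolding flow_def by measurable
        show "?\<phi> s b y = 0" if "y \<notin> ?B" for y using mollifier_support[OF R(2) that] by simp
        show "\<bar>?\<phi> s b y\<bar> \<le> ?K" if "y \<in> ?B" for y
        proof -
          have "\<bar>flow (X s) (R s) x' r' y \<bullet> b\<bar> \<le> norm (flow (X s) (R s) x' r' y)" by (rule Basis_le_norm[OF b])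
          also have "\<dots> \<le> ?v" using that R by (intro norm_flow_le) (auto simp: dist_norm norm_minus_commute)
          finally show ?thesis
            unfolding abs_mult using mollifier_nonneg[of "R s" "y - X s"] mollifier_le[of "R s" "y - X s"] R
            by (intro mult_mono) auto
        qed
      qed
      also have "\<dots> \<le> ?K * (2 * ?N * ?V powr (1 - 1 / p))"
        using R bump_mass_pos[where 'a='a]
        by (intro mult_left_mono Lp_on_integral_bound[OF B]) auto
      finally show ?thesis .
    qed
    have "\<bar>?D s\<bar> \<le> (\<Sum>b\<in>(Basis :: 'a set). ?K * (2 * ?N * ?V powr (1 - 1 / p)))"
      by (rule order_trans[OF sum_abs sum_mono]) (rule one)
    also have "\<dots> = path_const TYPE('a) p * ?v * (inverse (R s ^ DIM('a)) * (R s ^ DIM('a)) powr (1 - 1 / p)) * ?N"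
      using R by (simp add: path_const_def power_mult_distrib powr_mult divide_inverse)
    also have "inverse (R s ^ DIM('a)) * (R s ^ DIM('a)) powr (1 - 1 / p) = R s powr (- (real DIM('a) / p))"
    proof -
      have "R s ^ DIM('a) = R s powr real DIM('a)" using R by (simp add: powr_realpow)
      then have "inverse (R s ^ DIM('a)) * (R s ^ DIM('a)) powr (1 - 1 / p)
          = R s powr (- real DIM('a)) * R s powr (real DIM('a) * (1 - 1 / p))"
        by (simp add: powr_powr powr_minus)
      also have "\<dots> = R s powr (- (real DIM('a) / p))"
        by (simp add: powr_add[symmetric] algebra_simps)
      finally show ?thesis .
    qed
    also have "path_const TYPE('a) p * ?v * R s powr (- (real DIM('a) / p)) * ?N \<le> ?C"
      using R \<rho>(1) p N path_const_nonneg[where 'a='a, of p]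
      by (intro mult_right_mono mult_left_mono powr_mono2') auto
    finally show ?thesis .
  qed
  have "norm (avg U (X 1) (R 1) u - avg U (X 0) (R 0) u) \<le> ?C * norm (1 - 0 :: real)"
  proof (rule field_differentiable_bound[of "{0..1}" "\<lambda>s. avg U (X s) (R s) u" ?D])
    show "((\<lambda>s. avg U (X s) (R s) u) has_field_derivative ?D s) (at s within {0..1})" if "s \<in> {0..1}" for s
      using that by (intro has_field_derivative_at_within[OF D]) auto
    show "norm (?D s) \<le> ?C" if "s \<in> {0..1}" for s
      unfolding real_norm_def using that by (intro bound) auto
  qed auto
  then show ?thesis by (simp add: X_def R_def)
qed

section \<open>Point evaluation in a domain with interior cones\<close>

lemma geometric_Cauchy_limit:
  fixes f :: "nat \<Rightarrow> real"
  assumes q: "0 \<le> q" "q < 1" and f: "\<And>k. \<bar>f (Suc k) - f k\<bar> \<le> c * q ^ k"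
  shows "f \<longlonglongrightarrow> lim f" and "\<bar>lim f - f k\<bar> \<le> c * q ^ k / (1 - q)"
proof -
  have g: "summable (\<lambda>k. c * q ^ k)" using q by (intro summable_mult summable_geometric) auto
  then have s: "summable (\<lambda>k. \<bar>f (Suc k) - f k\<bar>)"
    by (rule summable_comparison_test'[of _ 0]) (use f in auto)
  then have s': "summable (\<lambda>k. f (Suc k) - f k)" by (rule summable_rabs_cancel)
  have "(\<lambda>n. \<Sum>k<n. f (Suc k) - f k) \<longlonglongrightarrow> (\<Sum>k. f (Suc k) - f k)"
    by (rule summable_LIMSEQ[OF s'])
  then have "(\<lambda>n. f 0 + (f n - f 0)) \<longlonglongrightarrow> f 0 + (\<Sum>k. f (Suc k) - f k)"
    unfolding sum_lessThan_telescope by (intro tendsto_add tendsto_const)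
  then show L: "f \<longlonglongrightarrow> lim f" by (simp add: limI)
  have b: "\<bar>f (k + n) - f k\<bar> \<le> c * q ^ k / (1 - q)" for n
  proof -
    have "f (k + n) - f k = (\<Sum>j<n. f (Suc (k + j)) - f (k + j))"
      using sum_lessThan_telescope[of "\<lambda>j. f (k + j)" n] by simp
    then have "\<bar>f (k + n) - f k\<bar> \<le> (\<Sum>j<n. \<bar>f (Suc (k + j)) - f (k + j)\<bar>)" by simp
    also have "\<dots> \<le> (\<Sum>j<n. (c * q ^ k) * q ^ j)"
    proof (rule sum_mono)
      show "\<bar>f (Suc (k + j)) - f (k + j)\<bar> \<le> (c * q ^ k) * q ^ j" for j
        using f[of "k + j"] by (simp add: power_add mult.assoc)
    qed
    also have "\<dots> \<le> (\<Sum>j. (c * q ^ k) * q ^ j)"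
    proof (rule sum_le_suminf)
      have "0 \<le> c * q ^ j" for j using f[of j] by linarith
      then show "0 \<le> c * q ^ k * q ^ j" for j using q by simp
    qed (use q in \<open>auto intro!: summable_mult summable_geometric\<close>)
    also have "\<dots> = c * q ^ k / (1 - q)"
      using q by (subst suminf_mult) (auto simp: suminf_geometric)
    finally show ?thesis .
  qed
  have "(\<lambda>n. f (n + k)) \<longlonglongrightarrow> lim f" by (rule LIMSEQ_ignore_initial_segment[OF L])
  then have "(\<lambda>n. \<bar>f (n + k) - f k\<bar>) \<longlonglongrightarrow> \<bar>lim f - f k\<bar>" by (intro tendsto_intros)
  then show "\<bar>lim f - f k\<bar> \<le> c * q ^ k / (1 - q)"
    by (rule LIMSEQ_le_const2) (use b in \<open>auto simp: add.commute\<close>)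
qed

lemma avg_add:
  assumes "open U" "bounded U" "1 < p" "u \<in> W1p p U" "w \<in> W1p p U" "0 < r"
  shows "avg U x r (\<lambda>y. u y + w y) = avg U x r u + avg U x r w"
proof -
  have i: "set_integrable lebesgue U (\<lambda>y. g y * mollifier r (y - x))" if "g \<in> W1p p U" for g
  proof (rule set_integrable_mult_supported[OF W1p_set_integrable[OF assms(1-3) that] order_refl])
    show "(\<lambda>y. mollifier r (y - x)) \<in> borel_measurable borel" by measurable
    show "\<bar>mollifier r (y - x)\<bar> \<le> inverse (r ^ DIM('a) * bump_mass TYPE('a))" for y
      using mollifier_nonneg[of r "y - x"] mollifier_le[of r "y - x"] assms(6) by simp
  qed simp
  show ?thesis
    unfolding avg_def distrib_right by (rule set_integral_add(2)[OF i i]) fact+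
qed

lemma avg_cmult: "avg U x r (\<lambda>y. a * u y) = a * avg U x r u"
  by (simp add: avg_def mult.assoc)

lemma avg_bound:
  fixes U :: "'a::euclidean_space set"
  assumes "open U" "bounded U" "1 < p" "0 < r"
  obtains C where "\<And>x u. u \<in> W1p p U \<Longrightarrow> \<bar>avg U x r u\<bar> \<le> C * W1p_norm p U u"
proof -
  let ?K = "inverse (r ^ DIM('a) * bump_mass TYPE('a))" and ?V = "measure lebesgue U + 1"
  have Um: "U \<in> lmeasurable" by (rule lmeasurable_open[OF assms(2,1)])
  have "\<bar>avg U x r u\<bar> \<le> ?K * (2 * W1p_norm p U u * ?V powr (1 - 1 / p))" if u: "u \<in> W1p p U" for x u
  proof -
    have "\<bar>avg U x r u\<bar> \<le> ?K * (LINT y:U|lebesgue. \<bar>u y\<bar>)"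
      unfolding avg_def
    proof (rule set_integral_mult_supported_bound[OF W1p_set_integrable[OF assms(1-3) u] order_refl])
      show "(\<lambda>y. mollifier r (y - x)) \<in> borel_measurable borel" by measurable
      show "\<bar>mollifier r (y - x)\<bar> \<le> ?K" for y
        using mollifier_nonneg[of r "y - x"] mollifier_le[of r "y - x"] assms(4) by simp
    qed simp
    also have "\<dots> \<le> ?K * (2 * W1p_norm p U u * ?V powr (1 - 1 / p))"
    proof (rule mult_left_mono)
      have "Lp_on p U u" using u by (simp add: W1p_def)
      then show "(LINT y:U|lebesgue. \<bar>u y\<bar>) \<le> 2 * W1p_norm p U u * ?V powr (1 - 1 / p)"
        by (intro Lp_on_integral_bound[OF assms(3) Um _ _ order_refl _ W1p_norm_nonneg[OF assms(3) u] W1p_norm_fun[OF assms(3) u]])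
           (auto simp: add_nonneg_pos)
    qed (use assms bump_mass_pos[where 'a='a] in auto)
    finally show ?thesis .
  qed
  then show ?thesis by (intro that[of "?K * (2 * ?V powr (1 - 1 / p))"]) (simp add: mult_ac)
qed

text \<open>Averages over balls that shrink towards the vertex of a cone, by the factor two in each step, converge
  at a geometric rate that is uniform in the vertex; this is where the exponent has to exceed the
  dimension.  Two vertices at distance at most the radius of the \<open>k\<close>-th ball are compared through their
  \<open>k\<close>-th averages.  At a Lebesgue point the limit is the value of the function, because the balls in the
  cone can be moved into the boxes of \<open>avg_tendsto_AE\<close>.\<close>

lemma point_evaluation:
  fixes U W :: "'a::euclidean_space set"
  assumes U: "open U" "bounded U" and p: "real DIM('a) < p"
    and T: "0 < T" and \<kappa>: "0 < \<kappa>"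
    and cone: "\<And>y t. y \<in> W \<Longrightarrow> 0 < t \<Longrightarrow> t \<le> T \<Longrightarrow> cball (y - t *\<^sub>R v) (\<kappa> * t) \<subseteq> U"
  obtains E :: "'a \<Rightarrow> ('a \<Rightarrow> real) \<Rightarrow> real"
  where "\<And>y. y \<in> W \<Longrightarrow> E y \<in> W1p_dual p U"
    and "\<And>e. 0 < e \<Longrightarrow> \<exists>d>0. \<forall>y\<in>W. \<forall>y'\<in>W. dist y y' < d \<longrightarrow>
           (\<forall>u\<in>W1p p U. \<bar>E y u - E y' u\<bar> \<le> e * W1p_norm p U u)"
    and "\<And>u. u \<in> W1p p U \<Longrightarrow> AE y in lebesgue. y \<in> U \<inter> W \<longrightarrow> E y u = u y"
proof -
  have "1 \<le> real DIM('a)" using DIM_positive[where 'a='a] by linarith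
  then have p1: "1 < p" using p by linarith
  define \<alpha> where "\<alpha> = 1 - real DIM('a) / p"
  have \<alpha>: "0 < \<alpha>" using p p1 by (simp add: \<alpha>_def)
  define q where "q = 2 powr (- \<alpha>)"
  have q: "0 < q" "q < 1" using \<alpha> powr_less_mono[of "- \<alpha>" 0 2] by (simp_all add: q_def)
  define t where "t k = T / 2 ^ k" for k :: nat
  have t: "0 < t k" "t k \<le> T" "t (Suc k) = t k / 2" for k
    using T by (auto simp: t_def divide_le_eq_1 mult_le_cancel_left1 field_simps)
  have tq: "t k powr \<alpha> = T powr \<alpha> * q ^ k" for k
  proof -
    have "(2 ^ k) powr \<alpha> = (2 powr \<alpha>) ^ k"
      by (simp add: powr_powr powr_realpow[symmetric] mult.commute)
    then show ?thesis
      using T unfolding t_def q_def powr_minus power_inverse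
      by (subst powr_divide) (simp_all add: divide_inverse)
  qed
  have t0: "t \<longlonglongrightarrow> 0"
    unfolding t_def using LIMSEQ_divide_realpow_zero[of 2 T] by simp
  define F where "F k y u = avg U (y - t k *\<^sub>R v) (\<kappa> / 2 * t k) u" for k y u
  let ?N = "W1p_norm p U" and ?P = "path_const TYPE('a) p"
  have N: "0 \<le> ?N u" if "u \<in> W1p p U" for u using W1p_norm_nonneg[OF p1 that] .
  have scale: "(a * s) powr (- (real DIM('a) / p)) * s = a powr (- (real DIM('a) / p)) * s powr \<alpha>"
    if "0 < a" "0 < s" for a s :: real
  proof -
    have "s powr (- (real DIM('a) / p)) * s = s powr (- (real DIM('a) / p) + 1)"
      using that powr_add[of s "- (real DIM('a) / p)" 1] by simp
    then show ?thesis using that by (simp add: powr_mult \<alpha>_def)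
  qed
  define A where "A = ?P * (norm v + \<kappa> / 2) * (\<kappa> / 2) powr (- (real DIM('a) / p)) * T powr \<alpha>"
  have A: "0 \<le> A" unfolding A_def using path_const_nonneg[where 'a='a, of p] \<kappa> by simp
  have step: "\<bar>F (Suc k) y u - F k y u\<bar> \<le> (A * ?N u * q) * q ^ k" if y: "y \<in> W" and u: "u \<in> W1p p U" for k y u
  proof -
    let ?t = "t (Suc k)"
    have tk: "t k = 2 * ?t" using t(3)[of k] by simp
    have "\<bar>avg U ((y - t k *\<^sub>R v) + ?t *\<^sub>R v) (\<kappa> / 2 * t k + (- (\<kappa> / 2 * ?t))) u - avg U (y - t k *\<^sub>R v) (\<kappa> / 2 * t k) u\<bar>
       \<le> ?P * (norm (?t *\<^sub>R v) + \<bar>- (\<kappa> / 2 * ?t)\<bar>) * (\<kappa> / 2 * ?t) powr (- (real DIM('a) / p)) * ?N u"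
    proof (rule avg_path[OF U p1 u])
      show "0 < \<kappa> / 2 * ?t" using \<kappa> t by simp
      fix s :: real assume s: "0 \<le> s" "s \<le> 1"
      let ?s = "t k - s * ?t"
      have "0 \<le> s * ?t" "s * ?t \<le> ?t"
        using s t(1)[of "Suc k"] mult_right_mono[OF s(2), of ?t] by simp_all
      then have s1: "?t \<le> ?s" "?s \<le> T" "0 < ?s"
        using t(1)[of "Suc k"] t(2)[of k] tk by linarith+
      have eq: "\<kappa> / 2 * t k + s * - (\<kappa> / 2 * ?t) = \<kappa> / 2 * ?s" by (simp add: algebra_simps)
      show "\<kappa> / 2 * ?t \<le> \<kappa> / 2 * t k + s * - (\<kappa> / 2 * ?t)"
        unfolding eq using s1 \<kappa> by (intro mult_left_mono) auto
      have "cball (y - ?s *\<^sub>R v) (\<kappa> / 2 * ?s) \<subseteq> cball (y - ?s *\<^sub>R v) (\<kappa> * ?s)"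
        using s1 \<kappa> by (intro subset_cball mult_right_mono) auto
      also have "\<dots> \<subseteq> U" by (rule cone[OF y s1(3,2)])
      finally show "cball (y - t k *\<^sub>R v + s *\<^sub>R ?t *\<^sub>R v) (\<kappa> / 2 * t k + s * - (\<kappa> / 2 * ?t)) \<subseteq> U"
        unfolding eq by (simp add: algebra_simps)
    qed
    also have "(y - t k *\<^sub>R v) + ?t *\<^sub>R v = y - ?t *\<^sub>R v"
      using scaleR_add_left[of ?t ?t v] tk by simp
    also have "\<kappa> / 2 * t k + (- (\<kappa> / 2 * ?t)) = \<kappa> / 2 * ?t" unfolding tk by simp
    also have "norm (?t *\<^sub>R v) + \<bar>- (\<kappa> / 2 * ?t)\<bar> = (norm v + \<kappa> / 2) * ?t"
      using t(1)[of "Suc k"] \<kappa> by (simp add: algebra_simps)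
    also have "?P * ((norm v + \<kappa> / 2) * ?t) * (\<kappa> / 2 * ?t) powr (- (real DIM('a) / p)) * ?N u
        = ?P * (norm v + \<kappa> / 2) * ((\<kappa> / 2 * ?t) powr (- (real DIM('a) / p)) * ?t) * ?N u"
      by (simp only: mult_ac)
    also have "\<dots> = (A * ?N u * q) * q ^ k"
      using \<kappa> t(1)[of "Suc k"] by (subst scale) (auto simp: tq A_def)
    finally show ?thesis by (simp add: F_def)
  qed
  define E where "E y u = lim (\<lambda>k. F k y u)" for y u
  have E: "(\<lambda>k. F k y u) \<longlonglongrightarrow> E y u" "\<bar>E y u - F k y u\<bar> \<le> A * ?N u * q * q ^ k / (1 - q)"
    if "y \<in> W" "u \<in> W1p p U" for y u k
    unfolding E_def using geometric_Cauchy_limit[OF _ q(2) step[OF that]] q(1) by auto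
  show thesis
  proof (rule that[of E])
    fix y assume y: "y \<in> W"
    have \<kappa>t: "0 < \<kappa> / 2 * t k" for k using \<kappa> t by simp
    obtain C where C: "\<And>x u. u \<in> W1p p U \<Longrightarrow> \<bar>avg U x (\<kappa> / 2 * t 0) u\<bar> \<le> C * ?N u"
      using avg_bound[OF U p1 \<kappa>t] by blast
    have "\<bar>E y u\<bar> \<le> (C + A * q / (1 - q)) * ?N u" if u: "u \<in> W1p p U" for u
    proof -
      have "\<bar>F 0 y u\<bar> \<le> C * ?N u" unfolding F_def by (rule C[OF u])
      then have "\<bar>E y u\<bar> \<le> C * ?N u + A * ?N u * q * q ^ 0 / (1 - q)"
        using E(2)[OF y u, of 0] by linarith
      then show ?thesis by (simp add: algebra_simps)
    qed
    moreover have "E y (\<lambda>x. u x + w x) = E y u + E y w" if "u \<in> W1p p U" "w \<in> W1p p U" for u w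
    proof -
      have "(\<lambda>k. F k y (\<lambda>x. u x + w x)) \<longlonglongrightarrow> E y u + E y w"
        unfolding F_def avg_add[OF U p1 that \<kappa>t] unfolding F_def[symmetric]
        by (intro tendsto_add E(1) y that)
      then show ?thesis unfolding E_def by (rule limI)
    qed
    moreover have "E y (\<lambda>x. a * u x) = a * E y u" if "u \<in> W1p p U" for a u
    proof -
      have "(\<lambda>k. F k y (\<lambda>x. a * u x)) \<longlonglongrightarrow> a * E y u"
        unfolding F_def avg_cmult unfolding F_def[symmetric]
        by (intro tendsto_mult tendsto_const E(1) y that)
      then show ?thesis unfolding E_def by (rule limI)
    qed
    ultimately show "E y \<in> W1p_dual p U" unfolding W1p_dual_def by blast
  next
    fix e :: real assume e: "0 < e"
    define G where "G = ?P * (\<kappa> / 2) powr \<alpha> * T powr \<alpha>"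
    define H where "H = 2 * (A * q / (1 - q)) + G"
    have "(\<lambda>k. H * q ^ k) \<longlonglongrightarrow> H * 0" using q by (intro tendsto_intros LIMSEQ_power_zero) auto
    then have "eventually (\<lambda>k. H * q ^ k < e) sequentially" using e by (intro order_tendstoD) auto
    then obtain k where k: "H * q ^ k < e" by (auto simp: eventually_sequentially)
    show "\<exists>d>0. \<forall>y\<in>W. \<forall>y'\<in>W. dist y y' < d \<longrightarrow> (\<forall>u\<in>W1p p U. \<bar>E y u - E y' u\<bar> \<le> e * ?N u)"
    proof (intro exI[of _ "\<kappa> / 2 * t k"] conjI ballI impI)
      show \<kappa>t: "0 < \<kappa> / 2 * t k" using \<kappa> t by simp
      fix y y' u assume y: "y \<in> W" "y' \<in> W" "dist y y' < \<kappa> / 2 * t k" and u: "u \<in> W1p p U"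
      let ?r = "\<kappa> / 2 * t k"
      have n: "norm (y' - y) \<le> ?r" using y(3) by (simp add: dist_norm norm_minus_commute)
      have "\<bar>avg U ((y - t k *\<^sub>R v) + (y' - y)) (?r + 0) u - avg U (y - t k *\<^sub>R v) ?r u\<bar>
         \<le> ?P * (norm (y' - y) + \<bar>0\<bar>) * ?r powr (- (real DIM('a) / p)) * ?N u"
      proof (rule avg_path[OF U p1 u \<kappa>t])
        fix s :: real assume s: "0 \<le> s" "s \<le> 1"
        have "cball ((y - t k *\<^sub>R v) + s *\<^sub>R (y' - y)) (?r + s * 0) \<subseteq> cball (y - t k *\<^sub>R v) (\<kappa> * t k)"
        proof
          fix z assume "z \<in> cball ((y - t k *\<^sub>R v) + s *\<^sub>R (y' - y)) (?r + s * 0)"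
          then have "dist (y - t k *\<^sub>R v) z \<le> ?r + norm (s *\<^sub>R (y' - y))"
            using dist_triangle[of "y - t k *\<^sub>R v" z "(y - t k *\<^sub>R v) + s *\<^sub>R (y' - y)"]
            by (simp add: dist_norm)
          also have "norm (s *\<^sub>R (y' - y)) \<le> 1 * ?r"
            using s n unfolding norm_scaleR by (intro mult_mono) auto
          finally show "z \<in> cball (y - t k *\<^sub>R v) (\<kappa> * t k)" by simp
        qed
        also have "\<dots> \<subseteq> U" by (rule cone[OF y(1) t(1,2)])
        finally show "cball ((y - t k *\<^sub>R v) + s *\<^sub>R (y' - y)) (?r + s * 0) \<subseteq> U" .
      qed simp
      also have "\<dots> \<le> ?P * ?r * ?r powr (- (real DIM('a) / p)) * ?N u"
        using n N[OF u] path_const_nonneg[where 'a='a, of p]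
        by (intro mult_right_mono mult_left_mono) auto
      also have "\<dots> = ?P * ((1 * ?r) powr (- (real DIM('a) / p)) * ?r) * ?N u" by (simp only: mult_ac mult_1)
      also have "(1 * ?r) powr (- (real DIM('a) / p)) * ?r = 1 powr (- (real DIM('a) / p)) * ?r powr \<alpha>"
        by (rule scale[OF zero_less_one \<kappa>t])
      also have "?r powr \<alpha> = (\<kappa> / 2) powr \<alpha> * (T powr \<alpha> * q ^ k)"
        using \<kappa> t(1)[of k] by (subst powr_mult) (auto simp: tq)
      also have "?P * (1 powr (- (real DIM('a) / p)) * ((\<kappa> / 2) powr \<alpha> * (T powr \<alpha> * q ^ k))) * ?N u = G * q ^ k * ?N u"
        by (simp add: G_def)
      finally have "\<bar>F k y' u - F k y u\<bar> \<le> G * q ^ k * ?N u" by (simp add: F_def)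
      then have "\<bar>E y u - E y' u\<bar> \<le> 2 * (A * ?N u * q * q ^ k / (1 - q)) + G * q ^ k * ?N u"
        using E(2)[OF y(1) u, of k] E(2)[OF y(2) u, of k] by linarith
      also have "\<dots> = (H * q ^ k) * ?N u" by (simp add: H_def algebra_simps)
      also have "\<dots> \<le> e * ?N u" using k N[OF u] by (intro mult_right_mono) auto
      finally show "\<bar>E y u - E y' u\<bar> \<le> e * ?N u" .
    qed
  next
    fix u assume u: "u \<in> W1p p U"
    have ui: "set_integrable lebesgue U u" by (rule W1p_set_integrable[OF U p1 u])
    have "AE y in lebesgue. y \<in> U \<longrightarrow> ((\<lambda>t. avg U (y + (t / 2) *\<^sub>R One) (t / 2) u) \<longlongrightarrow> u y) (at_right 0)"
      by (rule avg_tendsto_AE[OF U(1)]) (rule set_integrable_subset[OF ui fmeasurableD[OF lmeasurable_compact]])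
    then show "AE y in lebesgue. y \<in> U \<inter> W \<longrightarrow> E y u = u y"
    proof eventually_elim
      case (elim y)
      show ?case
      proof
        assume y: "y \<in> U \<inter> W"
        have tr: "filterlim t (at_right 0) sequentially"
        proof -
          have "t k \<in> {0<..} \<and> t k \<noteq> 0" for k using t(1)[of k] by auto
          then show ?thesis unfolding filterlim_at using t0 by simp
        qed
        have a: "(\<lambda>k. avg U (y + (t k / 2) *\<^sub>R One) (t k / 2) u) \<longlonglongrightarrow> u y"
          by (rule filterlim_compose[OF _ tr]) (use elim y in blast)
        define m where "m = min (1 / 2) (\<kappa> / 2)"
        have m: "0 < m" "m \<le> 1 / 2" "m \<le> \<kappa> / 2" using \<kappa> by (auto simp: m_def)
        define J where "J = ?P * (norm (v + (1 / 2) *\<^sub>R One) + \<bar>1 / 2 - \<kappa> / 2\<bar>) * (m powr (- (real DIM('a) / p)) * T powr \<alpha>) * ?N u"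
        obtain r where r: "0 < r" "cball y r \<subseteq> U"
          using y U(1) open_contains_cball by blast
        let ?L = "norm v + norm (v + (1 / 2) *\<^sub>R One) + (\<kappa> + 1)"
        have "(\<lambda>k. t k * ?L) \<longlonglongrightarrow> 0 * ?L" by (intro tendsto_intros t0)
        then have "eventually (\<lambda>k. t k * ?L < r) sequentially" using r by (intro order_tendstoD) auto
        then have "eventually (\<lambda>k. norm (avg U (y + (t k / 2) *\<^sub>R One) (t k / 2) u - F k y u) \<le> J * q ^ k) sequentially"
        proof eventually_elim
          case (elim k)
          let ?x' = "t k *\<^sub>R (v + (1 / 2) *\<^sub>R One)" and ?r' = "t k * (1 / 2 - \<kappa> / 2)"
          have "\<bar>avg U ((y - t k *\<^sub>R v) + ?x') (\<kappa> / 2 * t k + ?r') u - avg U (y - t k *\<^sub>R v) (\<kappa> / 2 * t k) u\<bar>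
             \<le> ?P * (norm ?x' + \<bar>?r'\<bar>) * (m * t k) powr (- (real DIM('a) / p)) * ?N u"
          proof (rule avg_path[OF U p1 u])
            show "0 < m * t k" using m t by simp
            fix s :: real assume s: "0 \<le> s" "s \<le> 1"
            have eq: "\<kappa> / 2 * t k + s * ?r' = ((1 - s) * (\<kappa> / 2) + s * (1 / 2)) * t k"
              by (simp add: field_simps)
            have "m = (1 - s) * m + s * m" by (simp add: algebra_simps)
            also have "\<dots> \<le> (1 - s) * (\<kappa> / 2) + s * (1 / 2)"
              using s m by (intro add_mono mult_left_mono) auto
            finally show "m * t k \<le> \<kappa> / 2 * t k + s * ?r'"
              unfolding eq using t(1)[of k] by (intro mult_right_mono) auto
            have "cball ((y - t k *\<^sub>R v) + s *\<^sub>R ?x') (\<kappa> / 2 * t k + s * ?r') \<subseteq> cball y r"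
            proof
              fix z assume z: "z \<in> cball ((y - t k *\<^sub>R v) + s *\<^sub>R ?x') (\<kappa> / 2 * t k + s * ?r')"
              have "(1 - s) * (\<kappa> / 2) + s * (1 / 2) \<le> 1 * (\<kappa> / 2) + 1 * (1 / 2)"
                using s \<kappa> by (intro add_mono mult_right_mono) auto
              then have "\<kappa> / 2 * t k + s * ?r' \<le> (\<kappa> + 1) * t k"
                unfolding eq using \<kappa> t(1)[of k] by (intro mult_right_mono) auto
              moreover have "norm (s *\<^sub>R ?x') \<le> 1 * norm ?x'" using s unfolding norm_scaleR[of s] by (intro mult_right_mono) auto
              moreover have "norm (y - z) \<le> norm (y - t k *\<^sub>R v + s *\<^sub>R ?x' - z) + (norm (t k *\<^sub>R v) + norm (s *\<^sub>R ?x'))"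
              proof -
                have e: "y - z = (y - t k *\<^sub>R v + s *\<^sub>R ?x' - z) + (t k *\<^sub>R v - s *\<^sub>R ?x')" by simp
                show ?thesis unfolding e
                  by (rule order_trans[OF norm_triangle_ineq add_left_mono[OF norm_triangle_ineq4]])
              qed
              ultimately have "norm (y - z) \<le> (\<kappa> + 1) * t k + (norm (t k *\<^sub>R v) + norm ?x')"
                using z by (simp add: dist_norm)
              also have "\<dots> = t k * ?L" unfolding norm_scaleR abs_of_pos[OF t(1)] by algebra
              finally show "z \<in> cball y r" using elim by (simp add: dist_norm)
            qed
            then show "cball ((y - t k *\<^sub>R v) + s *\<^sub>R ?x') (\<kappa> / 2 * t k + s * ?r') \<subseteq> U" using r(2) by blast
          qed
          also have "(y - t k *\<^sub>R v) + ?x' = y + (t k / 2) *\<^sub>R One" by (simp add: scaleR_add_right)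
          also have "\<kappa> / 2 * t k + ?r' = t k / 2" by (simp add: algebra_simps)
          also have "norm ?x' + \<bar>?r'\<bar> = (norm (v + (1 / 2) *\<^sub>R One) + \<bar>1 / 2 - \<kappa> / 2\<bar>) * t k"
            unfolding norm_scaleR abs_mult abs_of_pos[OF t(1)] by algebra
          also have "?P * ((norm (v + (1 / 2) *\<^sub>R One) + \<bar>1 / 2 - \<kappa> / 2\<bar>) * t k) * (m * t k) powr (- (real DIM('a) / p)) * ?N u
             = ?P * (norm (v + (1 / 2) *\<^sub>R One) + \<bar>1 / 2 - \<kappa> / 2\<bar>) * ((m * t k) powr (- (real DIM('a) / p)) * t k) * ?N u"
            by (simp only: mult_ac)
          also have "\<dots> = J * q ^ k"
            using m t(1)[of k] by (subst scale) (auto simp: tq J_def)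
          finally show ?case by (simp add: F_def)
        qed
        moreover have "(\<lambda>k. J * q ^ k) \<longlonglongrightarrow> J * 0" using q by (intro tendsto_intros LIMSEQ_power_zero) auto
        ultimately have "(\<lambda>k. avg U (y + (t k / 2) *\<^sub>R One) (t k / 2) u - F k y u) \<longlonglongrightarrow> 0"
          unfolding mult_zero_right by (rule Lim_null_comparison)
        from tendsto_diff[OF a this] have "(\<lambda>k. F k y u) \<longlonglongrightarrow> u y" by simp
        with E(1)[OF _ u] y show "E y u = u y" by (intro LIMSEQ_unique[of "\<lambda>k. F k y u"]) auto
      qed
    qed
  qed
qed

section \<open>Weak convergence implies uniform convergence\<close>

lemma W1p_dual_add: "l \<in> W1p_dual p U \<Longrightarrow> u \<in> W1p p U \<Longrightarrow> w \<in> W1p p U \<Longrightarrow> l (\<lambda>x. u x + w x) = l u + l w"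
  by (simp add: W1p_dual_def)

lemma W1p_dual_cmult: "l \<in> W1p_dual p U \<Longrightarrow> u \<in> W1p p U \<Longrightarrow> l (\<lambda>x. a * u x) = a * l u"
  by (simp add: W1p_dual_def)

lemma W1p_dual_diff:
  assumes l: "l \<in> W1p_dual p U" and m: "m \<in> W1p_dual p U"
  shows "(\<lambda>u. l u - m u) \<in> W1p_dual p U"
proof -
  obtain C D where C: "\<And>u. u \<in> W1p p U \<Longrightarrow> \<bar>l u\<bar> \<le> C * W1p_norm p U u"
    and D: "\<And>u. u \<in> W1p p U \<Longrightarrow> \<bar>m u\<bar> \<le> D * W1p_norm p U u"
    using assms unfolding W1p_dual_def by blast
  have "\<bar>l u - m u\<bar> \<le> (C + D) * W1p_norm p U u" if "u \<in> W1p p U" for u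
    using C[OF that] D[OF that] by (simp add: distrib_right)
  then show ?thesis
    using l m unfolding W1p_dual_def by (auto simp: right_diff_distrib)
qed

text \<open>Functionals whose norms tend to zero converge along a weakly convergent sequence.  If this
  fails, a sufficiently sparse sum of the functionals is a bounded functional that violates weak
  convergence.\<close>

lemma gliding_hump:
  assumes p: "1 < p" and us: "\<And>n. us n \<in> W1p p U" and u: "u \<in> W1p p U"
    and weak: "W1p_weakly_tendsto p U us u"
    and l: "\<And>n. l n \<in> W1p_dual p U"
    and small: "\<And>e. 0 < e \<Longrightarrow> eventually (\<lambda>n. \<forall>w\<in>W1p p U. \<bar>l n w\<bar> \<le> e * W1p_norm p U w) sequentially"
  shows "(\<lambda>n. l n (us n) - l n u) \<longlonglongrightarrow> 0"
proof (rule ccontr)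
  let ?N = "W1p_norm p U"
  define d where "d n k = l n (us k) - l n u" for n k
  define M where "M k = ?N (us k) + ?N u" for k
  have N: "0 \<le> ?N w" if "w \<in> W1p p U" for w by (rule W1p_norm_nonneg[OF p that])
  have M: "0 \<le> M k" for k unfolding M_def using N us u by simp
  assume "\<not> (\<lambda>n. l n (us n) - l n u) \<longlonglongrightarrow> 0"
  then obtain e where e: "0 < e" "\<And>n0. \<exists>n\<ge>n0. e \<le> \<bar>d n n\<bar>"
    unfolding LIMSEQ_iff d_def by (auto simp: not_less)
  have d0: "d n \<longlonglongrightarrow> 0" for n
  proof -
    have "(\<lambda>k. l n (us k) - l n u) \<longlonglongrightarrow> l n u - l n u"
      using weak l unfolding W1p_weakly_tendsto_def by (intro tendsto_diff tendsto_const) blast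
    then show ?thesis by (simp add: d_def[abs_def])
  qed
  \<comment> \<open>The first entry makes the sum of the chosen functionals bounded; the second one makes all later
    functionals negligible on the functions that were chosen before.\<close>
  define \<epsilon> where "\<epsilon> j n = min ((1 / 2) ^ j) (e / 8 * (1 / 2) ^ j / (1 + (\<Sum>m\<le>n. M m)))" for j :: nat and n :: nat
  have S: "0 \<le> (\<Sum>m\<le>n. M m)" for n using M by (intro sum_nonneg)
  have \<epsilon>: "0 < \<epsilon> j n" for j n
    using e S[of n] by (simp add: \<epsilon>_def add_pos_nonneg)
  define Q where "Q j n k \<longleftrightarrow> n < k \<and> e \<le> \<bar>d k k\<bar> \<and> (\<Sum>m\<le>n. \<bar>d m k\<bar>) \<le> e / 4
      \<and> (\<forall>w\<in>W1p p U. \<bar>l k w\<bar> \<le> \<epsilon> j n * ?N w)" for j n k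
  have "\<exists>k. Q j n k" for j n
  proof -
    have "(\<lambda>k. \<Sum>m\<le>n. \<bar>d m k\<bar>) \<longlonglongrightarrow> (\<Sum>m\<le>n. \<bar>0\<bar>)"
      by (intro tendsto_sum tendsto_rabs d0)
    then have "eventually (\<lambda>k. (\<Sum>m\<le>n. \<bar>d m k\<bar>) < e / 4) sequentially"
      by (rule order_tendstoD(2)) (use e in simp)
    then have "eventually (\<lambda>k. n < k \<and> (\<Sum>m\<le>n. \<bar>d m k\<bar>) \<le> e / 4
        \<and> (\<forall>w\<in>W1p p U. \<bar>l k w\<bar> \<le> \<epsilon> j n * ?N w)) sequentially"
      using small[OF \<epsilon>[of j n]] eventually_gt_at_top[of n] by eventually_elim auto
    then obtain n0 where "\<And>k. n0 \<le> k \<Longrightarrow> n < k \<and> (\<Sum>m\<le>n. \<bar>d m k\<bar>) \<le> e / 4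
        \<and> (\<forall>w\<in>W1p p U. \<bar>l k w\<bar> \<le> \<epsilon> j n * ?N w)"
      by (auto simp: eventually_sequentially)
    with e(2)[of n0] show ?thesis unfolding Q_def by blast
  qed
  then obtain s where s: "\<And>j. Q j (s j) (s (Suc j))"
    using dependent_nat_choice[of "\<lambda>_ _. True" Q] by auto
  have s_mono: "strict_mono s" using s by (simp add: strict_mono_Suc_iff Q_def)
  have ls: "\<bar>l (s (Suc j)) w\<bar> \<le> \<epsilon> j (s j) * ?N w" if "w \<in> W1p p U" for j w
    using s[of j] that by (simp add: Q_def)
  have ls': "\<bar>l (s (Suc j)) w\<bar> \<le> ?N w * (1 / 2) ^ j" if "w \<in> W1p p U" for j w
  proof -
    have "\<epsilon> j (s j) * ?N w \<le> (1 / 2) ^ j * ?N w"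
      using N[OF that] by (intro mult_right_mono) (simp_all add: \<epsilon>_def)
    with ls[OF that, of j] show ?thesis by (simp add: mult.commute)
  qed
  have sl: "summable (\<lambda>j. l (s (Suc j)) w)" if "w \<in> W1p p U" for w
    by (rule summable_comparison_test'[of "\<lambda>j. ?N w * (1 / 2) ^ j" 0])
      (use ls'[OF that] in \<open>auto intro!: summable_mult summable_geometric\<close>)
  \<comment> \<open>At the function chosen in step \<open>j\<close>, the earlier functionals are small because the step was late
    enough, the later ones because of their norms, and the one of step \<open>j\<close> is at least \<open>e\<close>.\<close>
  define L where "L w = (\<Sum>j. l (s (Suc j)) w)" for w
  have "L \<in> W1p_dual p U"
  proof -
    have "L (\<lambda>x. v x + w x) = L v + L w" if "v \<in> W1p p U" "w \<in> W1p p U" for v w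
      unfolding L_def using suminf_add[OF sl[OF that(1)] sl[OF that(2)]] W1p_dual_add[OF l that] by simp
    moreover have "L (\<lambda>x. a * w x) = a * L w" if "w \<in> W1p p U" for a w
      unfolding L_def using suminf_mult[OF sl[OF that]] W1p_dual_cmult[OF l that] by simp
    moreover have "\<bar>L w\<bar> \<le> 2 * ?N w" if "w \<in> W1p p U" for w
    proof -
      have "\<bar>L w\<bar> \<le> (\<Sum>j. ?N w * (1 / 2) ^ j)"
        unfolding L_def real_norm_def[symmetric]
        by (rule norm_suminf_le) (use ls'[OF that] in \<open>auto intro!: summable_mult summable_geometric\<close>)
      also have "\<dots> = 2 * ?N w" by (subst suminf_mult) (auto simp: suminf_geometric intro!: summable_geometric)
      finally show ?thesis .
    qed
    ultimately show ?thesis unfolding W1p_dual_def by blast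
  qed
  then have "(\<lambda>k. L (us k)) \<longlonglongrightarrow> L u" using weak by (simp add: W1p_weakly_tendsto_def)
  then have "(\<lambda>k. L (us k) - L u) \<longlonglongrightarrow> L u - L u" by (intro tendsto_diff tendsto_const)
  then have "((\<lambda>k. L (us k) - L u) \<circ> (\<lambda>j. s (Suc j))) \<longlonglongrightarrow> 0"
    using s_mono by (intro LIMSEQ_subseq_LIMSEQ) (auto simp: strict_mono_def)
  then have "eventually (\<lambda>j. \<bar>L (us (s (Suc j))) - L u\<bar> < e / 2) sequentially"
    using tendstoD[of "(\<lambda>k. L (us k) - L u) \<circ> (\<lambda>j. s (Suc j))" 0 sequentially "e / 2"] e
    by (simp add: o_def dist_real_def)
  then obtain j where j: "\<bar>L (us (s (Suc j))) - L u\<bar> < e / 2" by (auto simp: eventually_sequentially)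
  let ?k = "s (Suc j)"
  have sd: "summable (\<lambda>i. d (s (Suc i)) ?k)" unfolding d_def by (intro summable_diff sl us u)
  have "L (us ?k) - L u = (\<Sum>i. d (s (Suc i)) ?k)"
    unfolding L_def d_def by (rule suminf_diff[OF sl[OF us] sl[OF u]])
  also have "\<dots> = (\<Sum>i. d (s (Suc (i + Suc j))) ?k) + (\<Sum>i<Suc j. d (s (Suc i)) ?k)"
    by (rule suminf_split_initial_segment[OF sd])
  finally have eq: "L (us ?k) - L u = (\<Sum>i. d (s (Suc (i + Suc j))) ?k) + (\<Sum>i<j. d (s (Suc i)) ?k) + d ?k ?k"
    by simp
  have "\<bar>\<Sum>i<j. d (s (Suc i)) ?k\<bar> \<le> (\<Sum>m\<in>(\<lambda>i. s (Suc i)) ` {..<j}. \<bar>d m ?k\<bar>)"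
    using s_mono by (subst sum.reindex) (auto simp: inj_on_def strict_mono_eq)
  also have "\<dots> \<le> (\<Sum>m\<le>s j. \<bar>d m ?k\<bar>)"
    using s_mono by (intro sum_mono2) (auto simp: strict_mono_less_eq)
  also have "\<dots> \<le> e / 4" using s[of j] by (simp add: Q_def)
  finally have 1: "\<bar>\<Sum>i<j. d (s (Suc i)) ?k\<bar> \<le> e / 4" .
  have dd: "\<bar>d (s (Suc (i + Suc j))) ?k\<bar> \<le> e / 8 * (1 / 2) ^ i" for i
  proof -
    let ?i = "i + Suc j"
    have Mk: "M ?k \<le> (\<Sum>m\<le>s ?i. M m)"
      using s_mono M by (intro member_le_sum) (auto simp: strict_mono_less_eq)
    have "\<bar>d (s (Suc ?i)) ?k\<bar> \<le> \<epsilon> ?i (s ?i) * M ?k"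
      using ls[OF us, of ?i ?k] ls[OF u, of ?i] by (simp add: d_def M_def distrib_left)
    also have "\<dots> \<le> (e / 8 * (1 / 2) ^ ?i / (1 + (\<Sum>m\<le>s ?i. M m))) * (1 + (\<Sum>m\<le>s ?i. M m))"
      using M[of ?k] Mk e S[of "s ?i"] \<epsilon>[of ?i "s ?i"] by (intro mult_mono) (auto simp: \<epsilon>_def add_nonneg_nonneg)
    also have "\<dots> = e / 8 * (1 / 2) ^ ?i" using S[of "s ?i"] by (intro nonzero_eq_divide_eq[THEN iffD1]) auto
    also have "\<dots> \<le> e / 8 * (1 / 2) ^ i" using e by (intro mult_left_mono power_decreasing) auto
    finally show ?thesis .
  qed
  have "\<bar>\<Sum>i. d (s (Suc (i + Suc j))) ?k\<bar> \<le> (\<Sum>i. e / 8 * (1 / 2) ^ i)"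
    unfolding real_norm_def[symmetric]
    by (rule norm_suminf_le) (use dd in \<open>auto intro!: summable_mult summable_geometric\<close>)
  also have "\<dots> = e / 4" by (subst suminf_mult) (auto simp: suminf_geometric intro!: summable_geometric)
  finally have "\<bar>\<Sum>i. d (s (Suc (i + Suc j))) ?k\<bar> \<le> e / 4" .
  moreover have "e \<le> \<bar>d ?k ?k\<bar>" using s[of j] by (simp add: Q_def)
  ultimately show False using 1 j unfolding eq by linarith
qed

text \<open>If uniform convergence failed, it would fail at points converging to some \<open>z\<close>.  The evaluation at \<open>z\<close>
  converges by weak convergence, and the difference between the evaluations has small norm, so the gliding
  hump applies to it.\<close>

lemma weak_imp_uniform_on_cone:
  fixes U W :: "'a::euclidean_space set"
  assumes U: "open U" "bounded U" and p: "real DIM('a) < p"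
    and T: "0 < T" and \<kappa>: "0 < \<kappa>" and W: "compact W"
    and cone: "\<And>y t. y \<in> W \<Longrightarrow> 0 < t \<Longrightarrow> t \<le> T \<Longrightarrow> cball (y - t *\<^sub>R v) (\<kappa> * t) \<subseteq> U"
    and us: "\<And>n. us n \<in> W1p p U" and u: "u \<in> W1p p U"
    and weak: "W1p_weakly_tendsto p U us u" and e: "0 < e"
  shows "eventually (\<lambda>n. AE y in lebesgue. y \<in> U \<inter> W \<longrightarrow> \<bar>us n y - u y\<bar> \<le> e) sequentially"
proof -
  have "1 \<le> real DIM('a)" using DIM_positive[where 'a='a] by linarith
  then have p1: "1 < p" using p by linarith
  obtain E where E: "\<And>y. y \<in> W \<Longrightarrow> E y \<in> W1p_dual p U"
    and equi: "\<And>e. 0 < e \<Longrightarrow> \<exists>d>0. \<forall>y\<in>W. \<forall>y'\<in>W. dist y y' < d \<longrightarrow>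
           (\<forall>u\<in>W1p p U. \<bar>E y u - E y' u\<bar> \<le> e * W1p_norm p U u)"
    and ae: "\<And>u. u \<in> W1p p U \<Longrightarrow> AE y in lebesgue. y \<in> U \<inter> W \<longrightarrow> E y u = u y"
    by (rule point_evaluation[of U p T \<kappa> W v, OF U p T \<kappa>]) (rule cone, assumption+, rule that)
  have "eventually (\<lambda>n. \<forall>y\<in>W. \<bar>E y (us n) - E y u\<bar> \<le> e) sequentially"
  proof (rule ccontr)
    assume "\<not> ?thesis"
    then have "\<exists>\<^sub>F n in sequentially. \<exists>y\<in>W. e < \<bar>E y (us n) - E y u\<bar>"
      by (simp add: frequently_def not_less)
    then have "\<forall>m. \<exists>n>m. \<exists>y\<in>W. e < \<bar>E y (us n) - E y u\<bar>"
      unfolding frequently_sequentially by (meson Suc_le_eq)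
    then have "\<exists>r::nat\<Rightarrow>nat. strict_mono r \<and> (\<forall>n. \<exists>y\<in>W. e < \<bar>E y (us (r n)) - E y u\<bar>)"
    proof -
      assume a: "\<forall>m. \<exists>n>m. \<exists>y\<in>W. e < \<bar>E y (us n) - E y u\<bar>"
      have "infinite {n. \<exists>y\<in>W. e < \<bar>E y (us n) - E y u\<bar>}"
        unfolding infinite_nat_iff_unbounded using a by simp
      then show ?thesis using infinite_enumerate by fastforce
    qed
    then obtain r :: "nat \<Rightarrow> nat" where r: "strict_mono r" and "\<forall>n. \<exists>y. y \<in> W \<and> e < \<bar>E y (us (r n)) - E y u\<bar>"
      unfolding Bex_def by blast
    from choice[OF this(2)] obtain y
      where y: "\<And>n. y n \<in> W" "\<And>n. e < \<bar>E (y n) (us (r n)) - E (y n) u\<bar>" by blast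
    obtain z q where z: "z \<in> W" "strict_mono q" "(y \<circ> q) \<longlonglongrightarrow> z"
      by (rule seq_compactE[OF compact_imp_seq_compact[OF W], of y]) (use y(1) in blast)+
    define us' where "us' = us \<circ> (r \<circ> q)"
    have rq: "strict_mono (r \<circ> q)" using r z(2) by (rule strict_mono_o)
    have weak': "W1p_weakly_tendsto p U us' u"
      unfolding W1p_weakly_tendsto_def us'_def
    proof
      fix l assume "l \<in> W1p_dual p U"
      then have "(\<lambda>n. l (us n)) \<longlonglongrightarrow> l u" using weak by (simp add: W1p_weakly_tendsto_def)
      from LIMSEQ_subseq_LIMSEQ[OF this rq] show "(\<lambda>n. l ((us \<circ> (r \<circ> q)) n)) \<longlonglongrightarrow> l u" by (simp add: o_def)
    qed
    let ?l = "\<lambda>n w. E (y (q n)) w - E z w"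
    have "(\<lambda>n. ?l n (us' n) - ?l n u) \<longlonglongrightarrow> 0"
    proof (rule gliding_hump[OF p1 _ u weak'])
      show "us' n \<in> W1p p U" for n by (simp add: us'_def us)
      show "?l n \<in> W1p_dual p U" for n by (intro W1p_dual_diff E y z)
      fix e' :: real assume "0 < e'"
      then obtain d where d: "0 < d" "\<And>a b w. a \<in> W \<Longrightarrow> b \<in> W \<Longrightarrow> dist a b < d \<Longrightarrow> w \<in> W1p p U \<Longrightarrow>
          \<bar>E a w - E b w\<bar> \<le> e' * W1p_norm p U w"
        using equi by metis
      have "eventually (\<lambda>n. dist (y (q n)) z < d) sequentially"
        using tendstoD[OF z(3) d(1)] by simp
      then show "eventually (\<lambda>n. \<forall>w\<in>W1p p U. \<bar>?l n w\<bar> \<le> e' * W1p_norm p U w) sequentially"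
        by eventually_elim (use d(2) y z in blast)
    qed
    moreover have "(\<lambda>n. E z (us' n)) \<longlonglongrightarrow> E z u"
      using weak' E[OF z(1)] by (simp add: W1p_weakly_tendsto_def)
    then have "(\<lambda>n. E z (us' n) - E z u) \<longlonglongrightarrow> E z u - E z u" by (intro tendsto_diff tendsto_const)
    ultimately have "(\<lambda>n. (?l n (us' n) - ?l n u) + (E z (us' n) - E z u)) \<longlonglongrightarrow> 0 + (E z u - E z u)"
      by (rule tendsto_add)
    then have "(\<lambda>n. E (y (q n)) (us' n) - E (y (q n)) u) \<longlonglongrightarrow> 0" by simp
    from tendstoD[OF this e] obtain n where "\<bar>E (y (q n)) (us' n) - E (y (q n)) u\<bar> < e"
      by (auto simp: eventually_sequentially)
    with y(2)[of "q n"] show False by (simp add: us'_def)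
  qed
  then show ?thesis
  proof eventually_elim
    case (elim n)
    show ?case
      using ae[OF us[of n]] ae[OF u] by eventually_elim (use elim in auto)
  qed
qed

section \<open>Lipschitz domains\<close>

lemma norm_perp_le:
  fixes w v :: "'a::real_inner"
  assumes "norm v = 1"
  shows "norm (w - (w \<bullet> v) *\<^sub>R v) \<le> norm w"
proof -
  have "v \<bullet> v = 1" using assms by (simp add: dot_square_norm)
  then have "(norm (w - (w \<bullet> v) *\<^sub>R v))\<^sup>2 = (norm w)\<^sup>2 - (w \<bullet> v)\<^sup>2"
    unfolding power2_norm_eq_inner
    by (simp add: inner_diff_left inner_diff_right inner_commute[of v w] power2_eq_square)
  then have "(norm (w - (w \<bullet> v) *\<^sub>R v))\<^sup>2 \<le> (norm w)\<^sup>2" by simp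
  then show ?thesis by (rule power2_le_imp_le) simp
qed

lemma lipschitz_boundaryE:
  assumes "lipschitz_boundary S" "x \<in> frontier S"
  obtains v r h L and g :: "'a::euclidean_space \<Rightarrow> real"
  where "norm v = 1" "0 < r" "0 < h" "L-lipschitz_on {z. z \<bullet> v = 0} g"
    "\<And>y. norm ((y - x) - ((y - x) \<bullet> v) *\<^sub>R v) < r \<Longrightarrow> \<bar>(y - x) \<bullet> v\<bar> < h \<Longrightarrow>
       (y \<in> interior S \<longleftrightarrow> (y - x) \<bullet> v < g ((y - x) - ((y - x) \<bullet> v) *\<^sub>R v))"
    "\<And>y. norm ((y - x) - ((y - x) \<bullet> v) *\<^sub>R v) < r \<Longrightarrow> \<bar>(y - x) \<bullet> v\<bar> < h \<Longrightarrow>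
       (y \<in> frontier S \<longleftrightarrow> (y - x) \<bullet> v = g ((y - x) - ((y - x) \<bullet> v) *\<^sub>R v))"
  using assms unfolding lipschitz_boundary_def Let_def by metis

text \<open>A cone around the axis that is narrow compared with the Lipschitz constant stays below the graph.  For
  an interior point, \<open>v = 0\<close> gives balls around \<open>y\<close> itself.\<close>

lemma lipschitz_boundary_cone:
  fixes S :: "'a::euclidean_space set"
  assumes S: "closed S" "lipschitz_boundary S" and x: "x \<in> S"
  obtains v \<kappa> T \<epsilon> where "0 < \<kappa>" "0 < T" "0 < \<epsilon>"
    "\<And>y t. y \<in> S \<inter> cball x \<epsilon> \<Longrightarrow> 0 < t \<Longrightarrow> t \<le> T \<Longrightarrow> cball (y - t *\<^sub>R v) (\<kappa> * t) \<subseteq> interior S"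
proof (cases "x \<in> interior S")
  case True
  then obtain R where R: "0 < R" "cball x R \<subseteq> interior S"
    using open_contains_cball[of "interior S"] by auto
  have "cball (y - t *\<^sub>R 0) (1 * t) \<subseteq> interior S" if "y \<in> S \<inter> cball x (R / 2)" "0 < t" "t \<le> R / 2" for y t
  proof
    fix z assume "z \<in> cball (y - t *\<^sub>R 0) (1 * t)"
    then have "dist x z \<le> R" using that dist_triangle[of x z y] by simp
    then show "z \<in> interior S" using R(2) by auto
  qed
  then show thesis using that[of 1 "R / 2" "R / 2" 0] R(1) by simp
next
  case False
  then have xf: "x \<in> frontier S" using x S(1) by (simp add: frontier_def)
  obtain v r h L and g :: "'a \<Rightarrow> real"
    where v: "norm v = 1" and rh: "0 < r" "0 < h" and lip: "L-lipschitz_on {z. z \<bullet> v = 0} g"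
    and int: "\<And>y. norm ((y - x) - ((y - x) \<bullet> v) *\<^sub>R v) < r \<Longrightarrow> \<bar>(y - x) \<bullet> v\<bar> < h \<Longrightarrow>
       (y \<in> interior S \<longleftrightarrow> (y - x) \<bullet> v < g ((y - x) - ((y - x) \<bullet> v) *\<^sub>R v))"
    and fr: "\<And>y. norm ((y - x) - ((y - x) \<bullet> v) *\<^sub>R v) < r \<Longrightarrow> \<bar>(y - x) \<bullet> v\<bar> < h \<Longrightarrow>
       (y \<in> frontier S \<longleftrightarrow> (y - x) \<bullet> v = g ((y - x) - ((y - x) \<bullet> v) *\<^sub>R v))"
    by (rule lipschitz_boundaryE[OF S(2) xf]) (rule that)
  have L: "0 \<le> L" using lip by (rule lipschitz_on_nonneg)
  have vv: "v \<bullet> v = 1" using v by (simp add: dot_square_norm)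
  define P where "P w = w - (w \<bullet> v) *\<^sub>R v" for w
  have P0: "P w \<bullet> v = 0" for w by (simp add: P_def inner_diff_left vv)
  have Pn: "norm (P w) \<le> norm w" for w unfolding P_def by (rule norm_perp_le[OF v])
  have vn: "\<bar>w \<bullet> v\<bar> \<le> norm w" for w using Cauchy_Schwarz_ineq2[of w v] v by simp
  define \<kappa> where "\<kappa> = 1 / (2 * (1 + L))"
  have \<kappa>: "0 < \<kappa>" "\<kappa> \<le> 1" using L by (auto simp: \<kappa>_def field_simps)
  have "\<kappa> * (1 + L) = 1 / 2" using L by (simp add: \<kappa>_def field_simps)
  then have \<kappa>L: "\<kappa> + L * \<kappa> = 1 / 2" by (simp add: distrib_left mult.commute)
  define \<epsilon> where "\<epsilon> = min r h / 4"
  have \<epsilon>: "0 < \<epsilon>" "3 * \<epsilon> < r" "3 * \<epsilon> < h" using rh by (auto simp: \<epsilon>_def)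
  have "z \<in> interior S" if y: "y \<in> S \<inter> cball x \<epsilon>" and t: "0 < t" "t \<le> \<epsilon>" and z: "z \<in> cball (y - t *\<^sub>R v) (\<kappa> * t)" for y t z
  proof -
    have yx: "norm (y - x) \<le> \<epsilon>" using y by (simp add: dist_norm norm_minus_commute)
    define w where "w = z - (y - t *\<^sub>R v)"
    have w: "norm w \<le> \<kappa> * t" using z by (simp add: w_def dist_norm norm_minus_commute)
    have zx: "z - x = (y - x) - t *\<^sub>R v + w" by (simp add: w_def)
    have "\<kappa> * t \<le> 1 * \<epsilon>" using \<kappa> t by (intro mult_mono) auto
    moreover have "norm (t *\<^sub>R v) \<le> \<epsilon>" using t v by simp
    ultimately have zn: "norm (z - x) \<le> 3 * \<epsilon>"
      unfolding zx using norm_triangle_ineq[of "(y - x) - t *\<^sub>R v" w] norm_triangle_ineq4[of "y - x" "t *\<^sub>R v"] yx w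
      by linarith
    have cyl: "norm (P a) < r" "\<bar>a \<bullet> v\<bar> < h" if "norm a \<le> 3 * \<epsilon>" for a
      using Pn[of a] vn[of a] that \<epsilon> by linarith+
    have "norm (y - x) \<le> 3 * \<epsilon>" using yx \<epsilon> by linarith
    note cy = cyl[OF this] and cz = cyl[OF zn]
    have "y \<in> interior S \<or> y \<in> frontier S" using y S(1) by (auto simp: frontier_def)
    then have ty: "(y - x) \<bullet> v \<le> g (P (y - x))"
      using int[of y] fr[of y] cy unfolding P_def by auto
    have Pz: "P (z - x) = P (y - x) + P w"
      unfolding zx by (simp add: P_def inner_add_left inner_diff_left vv algebra_simps)
    have "dist (g (P (z - x))) (g (P (y - x))) \<le> L * dist (P (z - x)) (P (y - x))"
      using P0 by (intro lipschitz_onD[OF lip]) auto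
    then have "\<bar>g (P (z - x)) - g (P (y - x))\<bar> \<le> L * norm (P w)"
      by (simp add: Pz dist_norm)
    also have "\<dots> \<le> L * (\<kappa> * t)" using Pn[of w] w L by (intro mult_left_mono) auto
    finally have 1: "g (P (y - x)) - L * \<kappa> * t \<le> g (P (z - x))" by simp
    have "(z - x) \<bullet> v = (y - x) \<bullet> v - t + w \<bullet> v"
      unfolding zx by (simp add: inner_add_left inner_diff_left vv)
    also have "\<dots> \<le> g (P (y - x)) - t + \<kappa> * t" using ty vn[of w] w by linarith
    also have "\<dots> = (g (P (y - x)) - L * \<kappa> * t) - t / 2"
    proof -
      have "\<kappa> * t = t / 2 - L * \<kappa> * t" using arg_cong[OF \<kappa>L, of "\<lambda>a. a * t"] by (simp add: distrib_right)
      then show ?thesis by linarith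
    qed
    also have "\<dots> < g (P (z - x))" using 1 t by linarith
    finally show ?thesis using int[of z] cz unfolding P_def by blast
  qed
  then show thesis by (intro that[OF \<kappa>(1) \<epsilon>(1) \<epsilon>(1)]) blast
qed

text \<open>Pieces of the graph, translated by different amounts in the direction of the axis, are disjoint
  and have the same measure, while they stay in a bounded set.\<close>

lemma lipschitz_boundary_negligible:
  fixes S :: "'a::euclidean_space set"
  assumes "lipschitz_boundary S"
  shows "negligible (frontier S)"
proof (rule locally_negligible_alt[THEN iffD2], rule ballI)
  fix x assume x: "x \<in> frontier S"
  obtain v r h L and g :: "'a \<Rightarrow> real"
    where v: "norm v = 1" and rh: "0 < r" "0 < h"
    and fr: "\<And>y. norm ((y - x) - ((y - x) \<bullet> v) *\<^sub>R v) < r \<Longrightarrow> \<bar>(y - x) \<bullet> v\<bar> < h \<Longrightarrow>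
       (y \<in> frontier S \<longleftrightarrow> (y - x) \<bullet> v = g ((y - x) - ((y - x) \<bullet> v) *\<^sub>R v))"
    by (rule lipschitz_boundaryE[OF assms x]) (rule that)
  have vv: "v \<bullet> v = 1" using v by (simp add: dot_square_norm)
  define \<epsilon> where "\<epsilon> = min r h / 2"
  have \<epsilon>: "0 < \<epsilon>" "\<epsilon> < r" "\<epsilon> < h" using rh by (auto simp: \<epsilon>_def)
  define G where "G = frontier S \<inter> cball x \<epsilon>"
  have Gc: "compact G" unfolding G_def by (intro closed_Int_compact frontier_closed compact_cball)
  have graph: "(y - x) \<bullet> v = g ((y - x) - ((y - x) \<bullet> v) *\<^sub>R v)" if "y \<in> G" for y
  proof -
    have "norm (y - x) \<le> \<epsilon>" using that by (simp add: G_def dist_norm norm_minus_commute)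
    moreover have "\<bar>(y - x) \<bullet> v\<bar> \<le> norm (y - x)" using Cauchy_Schwarz_ineq2[of "y - x" v] v by simp
    ultimately show ?thesis
      using norm_perp_le[OF v, of "y - x"] \<epsilon> that by (intro iffD1[OF fr]) (auto simp: G_def)
  qed
  define A where "A n = (+) ((1 / real (Suc n)) *\<^sub>R v) ` G" for n
  have Ac: "compact (A n)" for n unfolding A_def by (rule compact_translation[OF Gc])
  have disj: "disjoint_family A"
    unfolding disjoint_family_on_def
  proof (intro ballI impI)
    fix m n :: nat assume "m \<noteq> n"
    show "A m \<inter> A n = {}"
    proof (rule ccontr)
      assume "A m \<inter> A n \<noteq> {}"
      then obtain y z where yz: "y \<in> G" "z \<in> G" "(1 / real (Suc m)) *\<^sub>R v + y = (1 / real (Suc n)) *\<^sub>R v + z"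
        unfolding A_def by blast
      define c where "c = 1 / real (Suc n) - 1 / real (Suc m)"
      have y: "y - x = (z - x) + c *\<^sub>R v" using yz(3) by (simp add: c_def algebra_simps)
      have e: "(y - x) - ((y - x) \<bullet> v) *\<^sub>R v = (z - x) - ((z - x) \<bullet> v) *\<^sub>R v"
        unfolding y by (simp add: inner_add_left vv algebra_simps)
      have "(y - x) \<bullet> v = (z - x) \<bullet> v"
        using trans[OF trans[OF graph[OF yz(1)] arg_cong[OF e, of g]] graph[OF yz(2), symmetric]] .
      then have "c = 0" unfolding y by (simp add: inner_add_left vv)
      then show False using \<open>m \<noteq> n\<close> by (simp add: c_def)
    qed
  qed
  have sub: "(\<Union>n. A n) \<subseteq> cball x (\<epsilon> + 1)"
  proof
    fix a assume "a \<in> (\<Union>n. A n)"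
    then obtain n y where y: "y \<in> G" "a = (1 / real (Suc n)) *\<^sub>R v + y" unfolding A_def by blast
    have "norm (a - x) \<le> norm ((1 / real (Suc n)) *\<^sub>R v) + norm (y - x)"
      unfolding y(2) add_diff_eq[symmetric] by (rule norm_triangle_ineq)
    moreover have "norm ((1 / real (Suc n)) *\<^sub>R v) \<le> 1" using v by (simp add: field_simps)
    moreover have "norm (y - x) \<le> \<epsilon>" using y(1) by (simp add: G_def dist_norm norm_minus_commute)
    ultimately show "a \<in> cball x (\<epsilon> + 1)"
      unfolding mem_cball dist_norm norm_minus_commute[of x a] by linarith
  qed
  have As: "range A \<subseteq> sets lebesgue" using Ac by (auto intro: fmeasurableD[OF lmeasurable_compact])
  have "(\<Union>n. A n) \<in> lmeasurable"
    using As by (intro bounded_set_imp_lmeasurable bounded_subset[OF bounded_cball sub]) auto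
  then have "(\<lambda>n. measure lebesgue (A n)) sums measure lebesgue (\<Union>n. A n)"
    by (intro measure_UNION[OF As disj]) (auto simp: fmeasurable_def)
  moreover have "measure lebesgue (A n) = measure lebesgue G" for n
    unfolding A_def by (rule measure_translation)
  ultimately have "summable (\<lambda>n::nat. measure lebesgue G)" by (simp add: sums_iff)
  then have "(\<lambda>n::nat. measure lebesgue G) \<longlonglongrightarrow> 0" by (rule summable_LIMSEQ_zero)
  then have "measure lebesgue G = 0" by (simp add: LIMSEQ_const_iff)
  then have "negligible G"
    using lmeasurable_compact[OF Gc] by (simp add: negligible_iff_measure)
  then have "negligible (frontier S \<inter> ball x \<epsilon>)"
    by (rule negligible_subset) (auto simp: G_def)
  moreover have "openin (top_of_set (frontier S)) (frontier S \<inter> ball x \<epsilon>)" by (intro openin_open_Int open_ball)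
  ultimately show "\<exists>V. openin (top_of_set (frontier S)) V \<and> x \<in> V \<and> negligible V"
    using x \<epsilon>(1) by (intro exI[of _ "frontier S \<inter> ball x \<epsilon>"]) simp
qed

text \<open>What compactness of the embedding into the continuous functions gives for a weakly convergent sequence:
  the local statements on cones are patched together by compactness of \<open>S\<close>.\<close>

lemma weak_imp_uniform:
  fixes S :: "'a::euclidean_space set"
  assumes S: "compact S" "lipschitz_boundary S" and p: "real DIM('a) < p"
    and us: "\<And>n. us n \<in> W1p p (interior S)" and u: "u \<in> W1p p (interior S)"
    and weak: "W1p_weakly_tendsto p (interior S) us u" and e: "0 < e"
  shows "eventually (\<lambda>n. AE y in lebesgue. y \<in> S \<longrightarrow> \<bar>us n y - u y\<bar> \<le> e) sequentially"
proof -
  let ?U = "interior S"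
  have U: "open ?U" "bounded ?U"
    using S(1) compact_imp_bounded bounded_interior by auto
  have cl: "closed S" using S(1) by (rule compact_imp_closed)
  have loc: "\<exists>\<epsilon>>0. eventually (\<lambda>n. AE y in lebesgue. y \<in> ?U \<inter> (S \<inter> cball x \<epsilon>) \<longrightarrow> \<bar>us n y - u y\<bar> \<le> e) sequentially"
    if x: "x \<in> S" for x
  proof -
    obtain v \<kappa> T \<epsilon> where c: "0 < \<kappa>" "0 < T" "0 < \<epsilon>"
      "\<And>y t. y \<in> S \<inter> cball x \<epsilon> \<Longrightarrow> 0 < t \<Longrightarrow> t \<le> T \<Longrightarrow> cball (y - t *\<^sub>R v) (\<kappa> * t) \<subseteq> ?U"
      by (rule lipschitz_boundary_cone[OF cl S(2) x]) (rule that)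
    have "compact (S \<inter> cball x \<epsilon>)" using S(1) by (intro compact_Int_closed closed_cball)
    from weak_imp_uniform_on_cone[OF U p c(2,1) this c(4) us u weak e] c(3) show ?thesis by blast
  qed
  from bchoice[OF ballI[OF loc]] obtain \<epsilon> where "\<forall>x\<in>S. 0 < \<epsilon> x \<and>
      eventually (\<lambda>n. AE y in lebesgue. y \<in> ?U \<inter> (S \<inter> cball x (\<epsilon> x)) \<longrightarrow> \<bar>us n y - u y\<bar> \<le> e) sequentially" ..
  then have \<epsilon>: "\<And>x. x \<in> S \<Longrightarrow> 0 < \<epsilon> x"
    "\<And>x. x \<in> S \<Longrightarrow> eventually (\<lambda>n. AE y in lebesgue. y \<in> ?U \<inter> (S \<inter> cball x (\<epsilon> x)) \<longrightarrow> \<bar>us n y - u y\<bar> \<le> e) sequentially"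
    by simp_all
  have "S \<subseteq> (\<Union>x\<in>S. ball x (\<epsilon> x))" using \<epsilon>(1) by auto
  then obtain F where F: "F \<subseteq> S" "finite F" "S \<subseteq> (\<Union>x\<in>F. ball x (\<epsilon> x))"
    using compactE_image[OF S(1), of S "\<lambda>x. ball x (\<epsilon> x)"] by auto
  have null: "AE y in lebesgue. y \<notin> frontier S"
    using lipschitz_boundary_negligible[OF S(2)] by (simp add: AE_not_in negligible_iff_null_sets)
  have "eventually (\<lambda>n. \<forall>x\<in>F. AE y in lebesgue. y \<in> ?U \<inter> (S \<inter> cball x (\<epsilon> x)) \<longrightarrow> \<bar>us n y - u y\<bar> \<le> e) sequentially"
    using \<epsilon>(2) F by (intro eventually_ball_finite) auto
  then show ?thesis
  proof eventually_elim
    case (elim n)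
    then have "AE y in lebesgue. \<forall>x\<in>F. y \<in> ?U \<inter> (S \<inter> cball x (\<epsilon> x)) \<longrightarrow> \<bar>us n y - u y\<bar> \<le> e"
      by (intro AE_finite_allI[OF F(2)]) (rule bspec)
    with null show ?case
    proof eventually_elim
      case (elim y)
      show ?case
      proof
        assume y: "y \<in> S"
        then have "y \<in> ?U" using elim(1) cl by (simp add: frontier_def)
        moreover obtain x where "x \<in> F" "y \<in> cball x (\<epsilon> x)"
          using F(3) y ball_subset_cball by blast
        ultimately show "\<bar>us n y - u y\<bar> \<le> e" using elim(2) y by blast
      qed
    qed
  qed
qed

section \<open>Signed measures as differences of measures\<close>

definition ctbl_add :: "'a::topological_space set \<Rightarrow> ('a set \<Rightarrow> real) \<Rightarrow> bool" where
  "ctbl_add X \<nu> \<longleftrightarrow> (\<forall>A :: nat \<Rightarrow> 'a set. range A \<subseteq> borel_sets_on X \<longrightarrow> disjoint_family A \<longrightarrow>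
        (\<lambda>n. \<nu> (A n)) sums \<nu> (\<Union>n. A n))"

lemma ctbl_addD:
  fixes A :: "nat \<Rightarrow> 'a::topological_space set"
  shows "ctbl_add X \<nu> \<Longrightarrow> range A \<subseteq> borel_sets_on X \<Longrightarrow> disjoint_family A \<Longrightarrow> (\<lambda>n. \<nu> (A n)) sums \<nu> (\<Union>n. A n)"
  by (simp add: ctbl_add_def)

definition measure_on :: "'a::topological_space set \<Rightarrow> ('a set \<Rightarrow> real) \<Rightarrow> 'a measure" where
  "measure_on X \<nu> = measure_of X (borel_sets_on X) (\<lambda>A. ennreal (\<nu> A))"

lemma sigma_algebra_borel_sets_on: "sigma_algebra X (borel_sets_on X)"
  using sets.sigma_algebra_axioms[of "restrict_space borel X"] by (simp add: space_restrict_space)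

lemma borel_sets_on_subset: "A \<in> borel_sets_on X \<Longrightarrow> A \<subseteq> X"
  using sets.sets_into_space[of A "restrict_space borel X"] by (simp add: space_restrict_space)

lemma borel_sets_on_self: "X \<in> borel_sets_on X"
  using sets.top[of "restrict_space borel X"] by (simp add: space_restrict_space)

lemma borel_sets_onI: "A \<in> sets borel \<Longrightarrow> A \<inter> X \<in> borel_sets_on X"
  by (auto simp: sets_restrict_space)

lemma sets_measure_on [simp]: "sets (measure_on X \<nu>) = borel_sets_on X"
  unfolding measure_on_def
  by (simp add: sigma_algebra.sets_measure_of_eq[OF sigma_algebra_borel_sets_on])

lemma space_measure_on [simp]: "space (measure_on X \<nu>) = X"
  unfolding measure_on_def
  by (simp add: sigma_algebra.space_measure_of_eq[OF sigma_algebra_borel_sets_on])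

lemma measure_on_cong: "(\<And>A. A \<in> borel_sets_on X \<Longrightarrow> \<nu> A = \<mu> A) \<Longrightarrow> measure_on X \<nu> = measure_on X \<mu>"
  unfolding measure_on_def
  by (rule measure_of_eq) (auto dest: borel_sets_on_subset simp: sigma_algebra.sigma_sets_eq[OF sigma_algebra_borel_sets_on])

lemma ctbl_add_empty: "ctbl_add X \<nu> \<Longrightarrow> \<nu> {} = 0"
proof -
  assume "ctbl_add X \<nu>"
  from this[unfolded ctbl_add_def, rule_format, of "\<lambda>_. {}"]
  have "(\<lambda>n::nat. \<nu> {}) sums \<nu> {}" by (simp add: disjoint_family_on_def)
  then have "(\<lambda>n::nat. \<nu> {}) \<longlonglongrightarrow> 0" by (intro summable_LIMSEQ_zero sums_summable)
  then show ?thesis by (simp add: LIMSEQ_const_iff)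
qed

lemma ctbl_add_Un:
  assumes "ctbl_add X \<nu>" and A: "A \<in> borel_sets_on X" and B: "B \<in> borel_sets_on X" and "A \<inter> B = {}"
  shows "\<nu> (A \<union> B) = \<nu> A + \<nu> B"
proof -
  have "range (binaryset A B) \<subseteq> borel_sets_on X" using A B by (auto simp: range_binaryset_eq)
  moreover have "disjoint_family (binaryset A B)"
    using \<open>A \<inter> B = {}\<close> by (simp add: disjoint_family_on_def binaryset_def Int_commute)
  ultimately have "(\<lambda>n. \<nu> (binaryset A B n)) sums \<nu> (A \<union> B)"
    using assms(1) unfolding ctbl_add_def by (metis UN_binaryset_eq)
  moreover have "(\<lambda>n. \<nu> (binaryset A B n)) sums (\<nu> A + \<nu> B)"
    using ctbl_add_empty[OF assms(1)] by (intro binaryset_sums)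
  ultimately show ?thesis by (rule sums_unique2)
qed

lemma ctbl_add_Diff:
  assumes "ctbl_add X \<nu>" and A: "A \<in> borel_sets_on X" and B: "B \<in> borel_sets_on X" and "B \<subseteq> A"
  shows "\<nu> (A - B) = \<nu> A - \<nu> B"
proof -
  have "\<nu> (B \<union> (A - B)) = \<nu> B + \<nu> (A - B)"
    by (rule ctbl_add_Un[OF assms(1)]) (use A B in auto)
  then show ?thesis using \<open>B \<subseteq> A\<close> by (simp add: Un_absorb1)
qed

text \<open>If the values were unbounded, one could split off infinitely many disjoint sets on which the
  values have modulus more than one.\<close>

lemma ctbl_add_bounded:
  assumes ca: "ctbl_add X \<nu>"
  obtains c where "\<And>A. A \<in> borel_sets_on X \<Longrightarrow> \<bar>\<nu> A\<bar> \<le> c"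
proof (rule ccontr)
  assume no: "\<not> thesis"
  define big where "big E \<longleftrightarrow> E \<in> borel_sets_on X \<and> (\<forall>c. \<exists>B\<in>borel_sets_on X. B \<subseteq> E \<and> c < \<bar>\<nu> B\<bar>)" for E
  have not_big: "\<exists>c. \<forall>A\<in>borel_sets_on X. A \<subseteq> E \<longrightarrow> \<bar>\<nu> A\<bar> \<le> c" if "E \<in> borel_sets_on X" "\<not> big E" for E
    using that by (simp add: big_def not_less)
  have "big X"
  proof (rule ccontr)
    assume "\<not> big X"
    from not_big[OF borel_sets_on_self this] obtain c where "\<forall>A\<in>borel_sets_on X. A \<subseteq> X \<longrightarrow> \<bar>\<nu> A\<bar> \<le> c" ..
    then show False using no that[of c] borel_sets_on_subset by blast
  qed
  have step: "\<exists>E'. big E' \<and> E' \<subseteq> E \<and> 1 < \<bar>\<nu> (E - E')\<bar>" if E: "big E" for E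
  proof -
    obtain B where B: "B \<in> borel_sets_on X" "B \<subseteq> E" "1 + \<bar>\<nu> E\<bar> < \<bar>\<nu> B\<bar>"
      using E unfolding big_def by blast
    have EX: "E \<in> borel_sets_on X" using E by (simp add: big_def)
    have EB: "\<nu> (E - B) = \<nu> E - \<nu> B" by (rule ctbl_add_Diff[OF ca EX B(1,2)])
    have "big B \<or> big (E - B)"
    proof (rule ccontr)
      assume "\<not> ?thesis"
      then have nb: "\<not> big B" "\<not> big (E - B)" by simp_all
      from not_big[OF B(1) nb(1)] obtain c where c: "\<forall>A\<in>borel_sets_on X. A \<subseteq> B \<longrightarrow> \<bar>\<nu> A\<bar> \<le> c" ..
      from not_big[OF sets.Diff[OF EX B(1)] nb(2)]
      obtain d where d: "\<forall>A\<in>borel_sets_on X. A \<subseteq> E - B \<longrightarrow> \<bar>\<nu> A\<bar> \<le> d" ..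
      obtain A where A: "A \<in> borel_sets_on X" "A \<subseteq> E" "c + d < \<bar>\<nu> A\<bar>"
        using E unfolding big_def by blast
      have "\<nu> A = \<nu> (A \<inter> B) + \<nu> (A - B)"
      proof -
        have "\<nu> ((A \<inter> B) \<union> (A - B)) = \<nu> (A \<inter> B) + \<nu> (A - B)"
          by (rule ctbl_add_Un[OF ca]) (use A(1) B(1) in auto)
        then show ?thesis by (simp add: Int_Diff_Un)
      qed
      moreover have "\<bar>\<nu> (A \<inter> B)\<bar> \<le> c" "\<bar>\<nu> (A - B)\<bar> \<le> d"
        using A B(1) by (auto intro!: c[rule_format] d[rule_format])
      ultimately show False using A(3) by linarith
    qed
    then show ?thesis
    proof
      assume "big B"
      then show ?thesis using B(2,3) EB by (intro exI[of _ B]) linarith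
    next
      assume "big (E - B)"
      moreover have "E - (E - B) = B" using B(2) by auto
      ultimately show ?thesis using B(3) by (intro exI[of _ "E - B"]) auto
    qed
  qed
  have "\<exists>E. \<forall>n. big (E n) \<and> (E (Suc n) \<subseteq> E n \<and> 1 < \<bar>\<nu> (E n - E (Suc n))\<bar>)"
  proof (rule dependent_nat_choice)
    show "\<exists>E. big E" using \<open>big X\<close> ..
    show "\<exists>E'. big E' \<and> E' \<subseteq> E \<and> 1 < \<bar>\<nu> (E - E')\<bar>" if "big E" for E :: "'a set" and n :: nat
      by (rule step[OF that])
  qed
  then obtain E where E: "\<And>n. big (E n)" "\<And>n. E (Suc n) \<subseteq> E n" "\<And>n. 1 < \<bar>\<nu> (E n - E (Suc n))\<bar>"
    by auto
  define A where "A n = E n - E (Suc n)" for n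
  have mono: "E n \<subseteq> E m" if "m \<le> n" for m n
    using that by (rule lift_Suc_antimono_le[of E, rotated]) (rule E(2))
  have "A m \<inter> A n = {}" if "m < n" for m n
    using mono[of "Suc m" n] that by (auto simp: A_def)
  then have "disjoint_family A"
    unfolding disjoint_family_on_def by (metis Int_commute linorder_neqE_nat)
  moreover have "range A \<subseteq> borel_sets_on X"
    using E(1) unfolding A_def big_def by auto
  ultimately have "(\<lambda>n. \<nu> (A n)) sums \<nu> (\<Union>n. A n)" by (intro ctbl_addD[OF ca])
  then have "(\<lambda>n. \<nu> (A n)) \<longlonglongrightarrow> 0" by (intro summable_LIMSEQ_zero sums_summable)
  from tendstoD[OF this zero_less_one] obtain n where "\<bar>\<nu> (A n)\<bar> < 1"
    by (auto simp: eventually_sequentially)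
  with E(3)[of n] show False by (simp add: A_def)
qed

lemma neg_part_conv: "neg_part X \<nu> = pos_part X (\<lambda>A. - \<nu> A)"
  by (simp add: fun_eq_iff neg_part_def pos_part_def)

lemma ctbl_add_uminus: "ctbl_add X \<nu> \<Longrightarrow> ctbl_add X (\<lambda>A. - \<nu> A)"
  unfolding ctbl_add_def by (intro allI impI sums_minus) simp

lemma pos_part_upper:
  assumes "ctbl_add X \<nu>" "B \<in> borel_sets_on X" "B \<subseteq> A"
  shows "\<nu> B \<le> pos_part X \<nu> A"
proof -
  obtain c where "\<And>A. A \<in> borel_sets_on X \<Longrightarrow> \<bar>\<nu> A\<bar> \<le> c" using ctbl_add_bounded[OF assms(1)] by blast
  then have "bdd_above (\<nu> ` {B \<in> borel_sets_on X. B \<subseteq> A})"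
    by (intro bdd_aboveI[of _ c]) (auto simp: abs_le_iff)
  then show ?thesis unfolding pos_part_def using assms by (intro cSUP_upper) auto
qed

lemma pos_part_least:
  assumes "\<And>B. B \<in> borel_sets_on X \<Longrightarrow> B \<subseteq> A \<Longrightarrow> \<nu> B \<le> c"
  shows "pos_part X \<nu> A \<le> c"
  unfolding pos_part_def by (rule cSUP_least) (use assms in auto)

lemma pos_part_nonneg: "ctbl_add X \<nu> \<Longrightarrow> 0 \<le> pos_part X \<nu> A"
  using pos_part_upper[of X \<nu> "{}" A] ctbl_add_empty[of X \<nu>] by simp

lemma pos_part_mono:
  assumes "ctbl_add X \<nu>" "A \<subseteq> B" shows "pos_part X \<nu> A \<le> pos_part X \<nu> B"
  by (rule pos_part_least) (use assms in \<open>auto intro!: pos_part_upper\<close>)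

lemma pos_part_superadditive:
  assumes ca: "ctbl_add X \<nu>" and "A \<inter> B = {}"
  shows "pos_part X \<nu> A + pos_part X \<nu> B \<le> pos_part X \<nu> (A \<union> B)"
proof -
  have "pos_part X \<nu> A \<le> pos_part X \<nu> (A \<union> B) - pos_part X \<nu> B"
  proof (rule pos_part_least)
    fix C assume C: "C \<in> borel_sets_on X" "C \<subseteq> A"
    have "pos_part X \<nu> B \<le> pos_part X \<nu> (A \<union> B) - \<nu> C"
    proof (rule pos_part_least)
      fix D assume D: "D \<in> borel_sets_on X" "D \<subseteq> B"
      have "\<nu> (C \<union> D) = \<nu> C + \<nu> D"
        by (rule ctbl_add_Un[OF ca C(1) D(1)]) (use C D assms in auto)
      moreover have "\<nu> (C \<union> D) \<le> pos_part X \<nu> (A \<union> B)"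
        by (rule pos_part_upper[OF ca]) (use C D in auto)
      ultimately show "\<nu> D \<le> pos_part X \<nu> (A \<union> B) - \<nu> C" by simp
    qed
    then show "\<nu> C \<le> pos_part X \<nu> (A \<union> B) - pos_part X \<nu> B" by simp
  qed
  then show ?thesis by simp
qed

lemma pos_part_sums:
  assumes ca: "ctbl_add X \<nu>" and A: "range A \<subseteq> borel_sets_on X" "disjoint_family A"
  shows "(\<lambda>n::nat. pos_part X \<nu> (A n)) sums pos_part X \<nu> (\<Union>n. A n)"
proof -
  let ?P = "pos_part X \<nu>"
  have partial: "(\<Sum>n<N. ?P (A n)) \<le> ?P (\<Union>n<N. A n)" for N
  proof (induction N)
    case 0
    then show ?case using pos_part_nonneg[OF ca] by simp
  next
    case (Suc N)
    have "(\<Union>n<N. A n) \<inter> A N = {}"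
    proof -
      have "A n \<inter> A N = {}" if "n < N" for n
        using A(2) that by (simp add: disjoint_family_on_def)
      then show ?thesis by blast
    qed
    from pos_part_superadditive[OF ca this] Suc show ?case
      by (simp add: lessThan_Suc Un_commute)
  qed
  have le: "(\<Sum>n<N. ?P (A n)) \<le> ?P (\<Union>n. A n)" for N
    by (rule order_trans[OF partial pos_part_mono[OF ca]]) auto
  have s: "summable (\<lambda>n. ?P (A n))"
    by (rule summableI_nonneg_bounded[OF _ le]) (rule pos_part_nonneg[OF ca])
  have "?P (\<Union>n. A n) \<le> (\<Sum>n. ?P (A n))"
  proof (rule pos_part_least)
    fix B assume B: "B \<in> borel_sets_on X" "B \<subseteq> (\<Union>n. A n)"
    have "range (\<lambda>n. B \<inter> A n) \<subseteq> borel_sets_on X" "disjoint_family (\<lambda>n. B \<inter> A n)"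
      using A B by (auto simp: disjoint_family_on_def)
    then have "(\<lambda>n. \<nu> (B \<inter> A n)) sums \<nu> (\<Union>n. B \<inter> A n)" by (rule ctbl_addD[OF ca])
    moreover have "(\<Union>n. B \<inter> A n) = B" using B(2) by auto
    ultimately have B_sums: "(\<lambda>n. \<nu> (B \<inter> A n)) sums \<nu> B" by simp
    have "\<nu> (B \<inter> A n) \<le> ?P (A n)" for n
      by (rule pos_part_upper[OF ca]) (use A B in auto)
    then show "\<nu> B \<le> (\<Sum>n. ?P (A n))"
      using sums_le[OF _ B_sums summable_sums[OF s]] by blast
  qed
  moreover have "(\<Sum>n. ?P (A n)) \<le> ?P (\<Union>n. A n)"
    by (rule suminf_le_const[OF s le])
  ultimately show ?thesis using summable_sums[OF s] by (metis antisym)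
qed

lemma emeasure_measure_on:
  assumes ca: "ctbl_add X \<nu>" and nn: "\<And>A. A \<in> borel_sets_on X \<Longrightarrow> 0 \<le> \<nu> A" and A: "A \<in> borel_sets_on X"
  shows "emeasure (measure_on X \<nu>) A = ennreal (\<nu> A)"
  unfolding measure_on_def
proof (rule emeasure_measure_of_sigma[OF sigma_algebra_borel_sets_on _ _ A])
  show "positive (borel_sets_on X) (\<lambda>A. ennreal (\<nu> A))"
    using ctbl_add_empty[OF ca] by (simp add: positive_def)
  show "countably_additive (borel_sets_on X) (\<lambda>A. ennreal (\<nu> A))"
  proof (rule countably_additiveI)
    fix A :: "nat \<Rightarrow> 'a set"
    assume "range A \<subseteq> borel_sets_on X" "disjoint_family A"
    with ca nn show "(\<Sum>i. ennreal (\<nu> (A i))) = ennreal (\<nu> (\<Union> (range A)))"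
      by (intro suminf_ennreal_eq) (auto simp: ctbl_add_def)
  qed
qed

lemma
  assumes ca: "ctbl_add X \<nu>" and nn: "\<And>A. A \<in> borel_sets_on X \<Longrightarrow> 0 \<le> \<nu> A"
  shows finite_measure_on: "finite_measure (measure_on X \<nu>)"
    and measure_measure_on: "A \<in> borel_sets_on X \<Longrightarrow> measure (measure_on X \<nu>) A = \<nu> A"
proof -
  show "finite_measure (measure_on X \<nu>)"
    by (rule finite_measureI) (simp add: emeasure_measure_on[OF assms borel_sets_on_self])
  show "measure (measure_on X \<nu>) A = \<nu> A" if "A \<in> borel_sets_on X"
    using emeasure_measure_on[of X \<nu> A, OF ca nn that] nn[OF that] by (simp add: measure_def)
qed

lemma ctbl_add_pos_part: "ctbl_add X \<nu> \<Longrightarrow> ctbl_add X (pos_part X \<nu>)"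
  unfolding ctbl_add_def[of X "pos_part X \<nu>"] by (intro allI impI pos_part_sums)

lemma signed_measures_ctbl_add: "\<nu> \<in> signed_measures X \<Longrightarrow> ctbl_add X \<nu>"
  by (simp add: signed_measures_def ctbl_add_def)

lemma jordan_decomposition:
  assumes ca: "ctbl_add X \<nu>" and A: "A \<in> borel_sets_on X"
  shows "\<nu> A = pos_part X \<nu> A - neg_part X \<nu> A"
proof (rule antisym)
  note ca' = ctbl_add_uminus[OF ca]
  have "neg_part X \<nu> A \<le> pos_part X \<nu> A - \<nu> A"
    unfolding neg_part_conv
  proof (rule pos_part_least)
    fix B assume B: "B \<in> borel_sets_on X" "B \<subseteq> A"
    then have "\<nu> (A - B) \<le> pos_part X \<nu> A" using A by (intro pos_part_upper[OF ca]) auto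
    then show "- \<nu> B \<le> pos_part X \<nu> A - \<nu> A" using ctbl_add_Diff[OF ca A B] by simp
  qed
  then show "\<nu> A \<le> pos_part X \<nu> A - neg_part X \<nu> A" by simp
  have "pos_part X \<nu> A \<le> neg_part X \<nu> A + \<nu> A"
  proof (rule pos_part_least)
    fix B assume B: "B \<in> borel_sets_on X" "B \<subseteq> A"
    then have "- \<nu> (A - B) \<le> neg_part X \<nu> A"
      unfolding neg_part_conv using A by (intro pos_part_upper[OF ca']) auto
    then show "\<nu> B \<le> neg_part X \<nu> A + \<nu> A" using ctbl_add_Diff[OF ca A B] by simp
  qed
  then show "pos_part X \<nu> A - neg_part X \<nu> A \<le> \<nu> A" by simp
qed

lemma sintegral_alt:
  "sintegral X \<nu> f = integral\<^sup>L (measure_on X (pos_part X \<nu>)) f - integral\<^sup>L (measure_on X (neg_part X \<nu>)) f"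
  by (simp add: sintegral_def measure_on_def)

lemma
  assumes ca: "ctbl_add X \<nu>" and nn: "\<And>A. A \<in> borel_sets_on X \<Longrightarrow> 0 \<le> \<nu> A" and A: "A \<in> borel_sets_on X"
  shows pos_part_of_nonneg: "pos_part X \<nu> A = \<nu> A"
    and neg_part_of_nonneg: "neg_part X \<nu> A = 0"
proof -
  show "pos_part X \<nu> A = \<nu> A"
  proof (rule antisym)
    show "pos_part X \<nu> A \<le> \<nu> A"
    proof (rule pos_part_least)
      fix B assume B: "B \<in> borel_sets_on X" "B \<subseteq> A"
      then have "0 \<le> \<nu> (A - B)" using A by (intro nn) auto
      then show "\<nu> B \<le> \<nu> A" using ctbl_add_Diff[OF ca A B] by simp
    qed
  qed (use pos_part_upper[OF ca A] in auto)
  then show "neg_part X \<nu> A = 0" using jordan_decomposition[OF ca A] by simp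
qed

lemma sintegral_nonneg_measure:
  assumes ca: "ctbl_add X \<nu>" and nn: "\<And>A. A \<in> borel_sets_on X \<Longrightarrow> 0 \<le> \<nu> A"
  shows "sintegral X \<nu> f = integral\<^sup>L (measure_on X \<nu>) f"
proof -
  have 1: "measure_on X (pos_part X \<nu>) = measure_on X \<nu>"
    by (rule measure_on_cong) (rule pos_part_of_nonneg[OF ca nn])
  have 2: "measure_on X (neg_part X \<nu>) = measure_on X (\<lambda>_. 0)"
    by (rule measure_on_cong) (rule neg_part_of_nonneg[OF ca nn])
  have "emeasure (measure_on X (\<lambda>_. 0)) X = ennreal 0"
    by (rule emeasure_measure_on[OF _ _ borel_sets_on_self]) (auto simp: ctbl_add_def)
  then have "AE x in measure_on X (\<lambda>_. 0). f x = 0"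
    by (intro AE_I[of _ _ X]) (auto simp: borel_sets_on_self)
  then have "integral\<^sup>L (measure_on X (\<lambda>_. 0)) f = 0" by (rule integral_eq_zero_AE)
  then show ?thesis unfolding sintegral_alt 1 2 by simp
qed

section \<open>Finite Borel measures tested against continuous functions\<close>

lemma continuous_on_measurable:
  assumes "sets M = borel_sets_on X" "continuous_on X f"
  shows "f \<in> borel_measurable M"
  using borel_measurable_continuous_on_restrict[OF assms(2)] measurable_cong_sets[OF assms(1) refl] by blast

lemma continuous_on_integrable:
  fixes f :: "'a::topological_space \<Rightarrow> real"
  assumes "sets M = borel_sets_on X" "continuous_on X f" "compact X" "finite_measure M"
  shows "integrable M f"
proof -
  have sp: "space M = X"
    using sets_eq_imp_space_eq[OF assms(1)] by (simp add: space_restrict_space)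
  have "bounded (f ` X)" using assms(2,3) by (intro compact_imp_bounded compact_continuous_image)
  then obtain B where "\<And>x. x \<in> X \<Longrightarrow> norm (f x) \<le> B" by (auto simp: bounded_iff)
  then show ?thesis
    using sp by (intro finite_measure.integrable_const_bound[OF assms(4), of _ B] AE_I2 continuous_on_measurable[OF assms(1,2)]) auto
qed

definition bump_at :: "'a::metric_space set \<Rightarrow> nat \<Rightarrow> 'a \<Rightarrow> real" where
  "bump_at K k x = max 0 (1 - real k * infdist x K)"

lemma bump_at: 
  shows "0 \<le> bump_at K k x" "bump_at K k x \<le> 1" "continuous_on S (bump_at K k)"
  by (auto simp: bump_at_def infdist_nonneg intro!: continuous_intros)

lemma bump_at_tendsto:
  assumes "closed K" "K \<noteq> {}"
  shows "(\<lambda>k. bump_at K k x) \<longlonglongrightarrow> indicat_real K x"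
proof (cases "x \<in> K")
  case True
  then show ?thesis by (simp add: bump_at_def)
next
  case False
  then have pos: "0 < infdist x K"
    using in_closed_iff_infdist_zero[OF assms] infdist_nonneg[of x K] by (auto simp: less_le)
  obtain N :: nat where N: "1 < real N * infdist x K" using reals_Archimedean3[OF pos] by blast
  have "bump_at K k x = 0" if "N \<le> k" for k
  proof -
    have "real N * infdist x K \<le> real k * infdist x K" using that pos by simp
    then show ?thesis using N by (simp add: bump_at_def)
  qed
  then have "eventually (\<lambda>k. bump_at K k x = indicat_real K x) sequentially"
    using False by (auto simp: eventually_sequentially)
  then show ?thesis by (rule tendsto_eventually)
qed

lemma integral_bump_at_tendsto:
  fixes X :: "'a::metric_space set"
  assumes M: "sets M = borel_sets_on X" "finite_measure M" and K: "closed K" "K \<noteq> {}"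
  shows "(\<lambda>k. integral\<^sup>L M (bump_at K k)) \<longlonglongrightarrow> measure M (K \<inter> X)"
proof -
  have sp: "space M = X"
    using sets_eq_imp_space_eq[OF M(1)] by (simp add: space_restrict_space)
  have KX: "K \<inter> X \<in> sets M" unfolding M(1) using K by (intro borel_sets_onI) auto
  have "(\<lambda>k. integral\<^sup>L M (bump_at K k)) \<longlonglongrightarrow> integral\<^sup>L M (indicat_real (K \<inter> X))"
  proof (rule integral_dominated_convergence[where w = "\<lambda>_. 1"])
    show "AE x in M. (\<lambda>k. bump_at K k x) \<longlonglongrightarrow> indicat_real (K \<inter> X) x"
    proof (rule AE_I2)
      fix x assume "x \<in> space M"
      then have "indicat_real (K \<inter> X) x = indicat_real K x" using sp by (simp add: indicator_def)
      then show "(\<lambda>k. bump_at K k x) \<longlonglongrightarrow> indicat_real (K \<inter> X) x" using bump_at_tendsto[OF K] by simp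
    qed
    show "bump_at K k \<in> borel_measurable M" for k
      by (rule continuous_on_measurable[OF M(1) bump_at(3)])
    show "integrable M (\<lambda>_. 1 :: real)" by (rule finite_measure.integrable_const[OF M(2)])
    show "AE x in M. norm (bump_at K k x) \<le> 1" for k
      using bump_at(1,2)[of K k] by (intro AE_I2) (simp add: abs_le_iff)
  qed (use KX in simp)
  then show ?thesis using KX sp sets.sets_into_space[OF KX] by (simp add: Int_absorb2)
qed

lemma finite_measure_eqI_continuous:
  fixes X :: "'a::metric_space set"
  assumes X: "closed X" and M: "sets M = borel_sets_on X" "finite_measure M"
    and N: "sets N = borel_sets_on X" "finite_measure N"
    and eq: "\<And>f :: 'a \<Rightarrow> real. continuous_on X f \<Longrightarrow> integral\<^sup>L M f = integral\<^sup>L N f"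
  shows "M = N"
proof (rule measure_eqI_generator_eq[where E = "(\<lambda>K. K \<inter> X) ` {K. closed K}" and \<Omega> = X and A = "\<lambda>_. X"])
  show "Int_stable ((\<lambda>K. K \<inter> X) ` {K. closed K})"
  proof (rule Int_stableI, clarsimp)
    fix K L :: "'a set" assume "closed K" "closed L"
    then show "K \<inter> X \<inter> (L \<inter> X) \<in> (\<lambda>K. K \<inter> X) ` {K. closed K}"
      by (intro image_eqI[of _ _ "K \<inter> L"]) auto
  qed
  have s: "borel_sets_on X = sigma_sets X ((\<lambda>K. K \<inter> X) ` {K. closed K})"
  proof -
    have "sets (borel :: 'a measure) = sigma_sets UNIV {K. closed K}"
      by (subst borel_eq_closed) simp
    then have "borel_sets_on X = (\<inter>) X ` sigma_sets UNIV {K. closed K}"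
      by (simp add: sets_restrict_space)
    also have "\<dots> = sigma_sets X ((\<inter>) X ` {K. closed K})"
      using X by (intro sigma_sets_Int[of X UNIV "{K. closed K}"] sigma_sets.Basic) auto
    also have "(\<inter>) X ` {K. closed K} = (\<lambda>K. K \<inter> X) ` {K. closed K}"
      by (simp add: Int_commute)
    finally show ?thesis .
  qed
  show "sets M = sigma_sets X ((\<lambda>K. K \<inter> X) ` {K. closed K})"
    "sets N = sigma_sets X ((\<lambda>K. K \<inter> X) ` {K. closed K})"
    using M(1) N(1) s by simp_all
  fix Y assume "Y \<in> (\<lambda>K. K \<inter> X) ` {K. closed K}"
  then obtain K where K: "closed K" "Y = K \<inter> X" by blast
  show "emeasure M Y = emeasure N Y"
  proof (cases "K = {}")
    case False
    have "(\<lambda>k. integral\<^sup>L N (bump_at K k)) \<longlonglongrightarrow> measure M (K \<inter> X)"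
      using integral_bump_at_tendsto[OF M K(1) False] eq[OF bump_at(3)] by simp
    then have "measure M (K \<inter> X) = measure N (K \<inter> X)"
      using integral_bump_at_tendsto[OF N K(1) False] LIMSEQ_unique by blast
    then show ?thesis
      using M(2) N(2) K(2) by (simp add: finite_measure.emeasure_eq_measure)
  qed (simp add: K)
next
  show "emeasure M X \<noteq> \<infinity>" for i :: nat
    using M(2) by (simp add: finite_measure.emeasure_finite)
qed (auto intro!: image_eqI[of _ _ UNIV])

text \<open>Continuous functions that decrease to the indicator of a closed set show that closed sets have
  nonnegative measure, and regularity carries this over to Borel sets.\<close>

lemma nonneg_measureI:
  fixes X :: "'a::metric_space set"
  assumes \<nu>: "\<nu> \<in> signed_measures X"
    and nn: "\<And>f. continuous_on X f \<Longrightarrow> (\<And>x. 0 \<le> f x) \<Longrightarrow> 0 \<le> sintegral X \<nu> f"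
  shows "nonneg_measure \<nu>"
proof -
  have ca: "ctbl_add X \<nu>" using \<nu> by (rule signed_measures_ctbl_add)
  have ca': "ctbl_add X (pos_part X \<nu>)" "ctbl_add X (neg_part X \<nu>)"
    using ctbl_add_pos_part[OF ca] ctbl_add_pos_part[OF ctbl_add_uminus[OF ca]] by (simp_all add: neg_part_conv)
  have pn: "0 \<le> pos_part X \<nu> A" "0 \<le> neg_part X \<nu> A" for A
    using pos_part_nonneg[OF ca] pos_part_nonneg[OF ctbl_add_uminus[OF ca]] by (simp_all add: neg_part_conv)
  have closed: "0 \<le> \<nu> (K \<inter> X)" if "closed K" for K
  proof (cases "K = {}")
    case True
    then show ?thesis using ctbl_add_empty[OF ca] by simp
  next
    case False
    have KX: "K \<inter> X \<in> borel_sets_on X" using that by (intro borel_sets_onI) auto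
    have "(\<lambda>k. sintegral X \<nu> (bump_at K k)) \<longlonglongrightarrow>
        measure (measure_on X (pos_part X \<nu>)) (K \<inter> X) - measure (measure_on X (neg_part X \<nu>)) (K \<inter> X)"
      unfolding sintegral_alt
      by (intro tendsto_diff integral_bump_at_tendsto finite_measure_on ca' pn that False) auto
    then have "0 \<le> measure (measure_on X (pos_part X \<nu>)) (K \<inter> X) - measure (measure_on X (neg_part X \<nu>)) (K \<inter> X)"
      by (rule LIMSEQ_le_const) (auto intro!: nn bump_at)
    then show ?thesis
      using jordan_decomposition[OF ca KX] by (simp add: measure_measure_on ca' pn KX)
  qed
  have "- e \<le> \<nu> A" if A: "A \<in> borel_sets_on X" and e: "0 < e" for A e
  proof -
    obtain K U where K: "compact K" "K \<subseteq> A" "A \<subseteq> U" "total_variation X \<nu> (U - K) < e"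
      using \<nu> A e unfolding signed_measures_def by blast
    have KX: "K = K \<inter> X" using K(2) borel_sets_on_subset[OF A] by auto
    have Kb: "K \<in> borel_sets_on X" using KX K(1) borel_sets_onI[of K X] by (metis borel_compact)
    have "- \<nu> (A - K) \<le> neg_part X \<nu> (U - K)"
      unfolding neg_part_conv by (rule pos_part_upper[OF ctbl_add_uminus[OF ca]]) (use A Kb K in auto)
    also have "\<dots> \<le> total_variation X \<nu> (U - K)" using pn by (simp add: total_variation_def)
    finally have "- e \<le> \<nu> (A - K)" using K(4) by simp
    moreover have "0 \<le> \<nu> K" using closed[of K] KX K(1) compact_imp_closed by metis
    ultimately show ?thesis using ctbl_add_Diff[OF ca A Kb K(2)] by simp
  qed
  then have "0 \<le> \<nu> A" if "A \<in> borel_sets_on X" for A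
    using that by (metis add.inverse_inverse add_0 field_le_epsilon le_add_same_cancel1 neg_le_0_iff_le neg_le_iff_le)
  moreover have "\<nu> A = 0" if "A \<notin> borel_sets_on X" for A
    using \<nu> that by (simp add: signed_measures_def)
  ultimately show ?thesis unfolding nonneg_measure_def by (metis order_refl)
qed

section \<open>Weak limits of probability measures\<close>

lemma prob_measuresD:
  assumes "\<nu> \<in> prob_measures X"
  shows "ctbl_add X \<nu>" "\<And>A. 0 \<le> \<nu> A" "\<nu> X = 1" "\<nu> \<in> signed_measures X"
  using assms by (auto simp: prob_measures_def nonneg_measure_def signed_measures_ctbl_add)

lemma sintegral_const:
  assumes "ctbl_add X \<nu>" "\<And>A. A \<in> borel_sets_on X \<Longrightarrow> 0 \<le> \<nu> A"
  shows "sintegral X \<nu> (\<lambda>_. c) = c * \<nu> X"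
  using sintegral_nonneg_measure[OF assms] measure_measure_on[OF assms borel_sets_on_self] by simp

lemma weak_star_limit_nonneg:
  fixes X :: "'a::metric_space set"
  assumes "\<And>n. ctbl_add X (\<nu>s n)" "\<And>n A. 0 \<le> \<nu>s n A" "\<nu> \<in> signed_measures X" "weak_star_tendsto X \<nu>s \<nu>"
  shows "nonneg_measure \<nu>"
proof (rule nonneg_measureI[OF assms(3)])
  fix f :: "'a \<Rightarrow> real" assume f: "continuous_on X f" "\<And>x. 0 \<le> f x"
  have "(\<lambda>n. sintegral X (\<nu>s n) f) \<longlonglongrightarrow> sintegral X \<nu> f"
    using assms(4) f(1) by (simp add: weak_star_tendsto_def)
  then show "0 \<le> sintegral X \<nu> f"
  proof (rule LIMSEQ_le_const, intro exI allI impI)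
    show "0 \<le> sintegral X (\<nu>s n) f" for n
      unfolding sintegral_nonneg_measure[OF assms(1,2)] using f(2) by (intro integral_nonneg_AE AE_I2)
  qed
qed

lemma weak_star_limit_prob:
  fixes X :: "'a::metric_space set"
  assumes \<nu>s: "\<And>n. \<nu>s n \<in> prob_measures X" and \<nu>: "\<nu> \<in> signed_measures X" and lim: "weak_star_tendsto X \<nu>s \<nu>"
  shows "\<nu> \<in> prob_measures X"
proof -
  have nn: "nonneg_measure \<nu>"
    by (rule weak_star_limit_nonneg[OF prob_measuresD(1,2)[OF \<nu>s] \<nu> lim])
  have "sintegral X (\<nu>s n) (\<lambda>_. 1) = 1" for n
    using prob_measuresD[OF \<nu>s[of n]] by (subst sintegral_const) auto
  moreover have "sintegral X \<nu> (\<lambda>_. 1) = \<nu> X"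
    using signed_measures_ctbl_add[OF \<nu>] nn by (subst sintegral_const) (auto simp: nonneg_measure_def)
  moreover have "(\<lambda>n. sintegral X (\<nu>s n) (\<lambda>_. 1)) \<longlonglongrightarrow> sintegral X \<nu> (\<lambda>_. 1)"
    using lim[unfolded weak_star_tendsto_def, rule_format, of "\<lambda>_. 1"] by simp
  ultimately have "\<nu> X = 1" by (simp add: LIMSEQ_const_iff)
  with nn \<nu> show ?thesis by (simp add: prob_measures_def)
qed

lemma total_variation_nonneg_measure:
  assumes "ctbl_add X \<nu>" "\<And>A. A \<in> borel_sets_on X \<Longrightarrow> 0 \<le> \<nu> A" "A \<in> borel_sets_on X"
  shows "total_variation X \<nu> A = \<nu> A"
  using pos_part_of_nonneg[of X \<nu> A] neg_part_of_nonneg[of X \<nu> A] assms by (simp add: total_variation_def)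

text \<open>By Lindelof's theorem countably many open null sets cover the complement of the support.\<close>

lemma AE_msupport:
  fixes X :: "'a::second_countable_topology set"
  assumes ca: "ctbl_add X \<nu>" and nn: "\<And>A. A \<in> borel_sets_on X \<Longrightarrow> 0 \<le> \<nu> A"
  shows "AE x in measure_on X \<nu>. x \<in> msupport X \<nu>"
proof -
  let ?M = "measure_on X \<nu>"
  define F where "F = {U. open U \<and> \<nu> (U \<inter> X) = 0}"
  obtain F' where F': "F' \<subseteq> F" "countable F'" "\<Union>F' = \<Union>F"
    using Lindelof[of F] unfolding F_def by blast
  have b: "U \<inter> X \<in> borel_sets_on X" if "open U" for U using that by (intro borel_sets_onI) auto
  have "(\<Union>U\<in>F'. U \<inter> X) \<in> null_sets ?M"
  proof (rule null_sets_UN'[OF F'(2)])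
    fix U assume "U \<in> F'"
    then have U: "open U" "\<nu> (U \<inter> X) = 0" using F'(1) by (auto simp: F_def)
    then show "U \<inter> X \<in> null_sets ?M"
      using b[OF U(1)] emeasure_measure_on[OF ca nn b[OF U(1)]] by (intro null_setsI) auto
  qed
  moreover have "{x \<in> space ?M. x \<notin> msupport X \<nu>} \<subseteq> (\<Union>U\<in>F'. U \<inter> X)"
  proof
    fix x assume "x \<in> {x \<in> space ?M. x \<notin> msupport X \<nu>}"
    then have x: "x \<in> X" "x \<notin> msupport X \<nu>" by auto
    then obtain U where U: "open U" "x \<in> U" "\<not> 0 < total_variation X \<nu> (U \<inter> X)"
      unfolding msupport_def by blast
    then have "\<nu> (U \<inter> X) = 0"
      using total_variation_nonneg_measure[OF ca nn b[OF U(1)]] nn[OF b[OF U(1)]] by simp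
    then have "U \<in> F" using U by (simp add: F_def)
    then have "x \<in> \<Union>F'" using U(2) F'(3) by blast
    then show "x \<in> (\<Union>U\<in>F'. U \<inter> X)" using x(1) by blast
  qed
  ultimately show ?thesis by (rule AE_I')
qed

lemma ball_subset_of_frontier_dist:
  fixes X :: "'a::real_normed_vector set"
  assumes "x \<in> X" and far: "\<And>y. y \<in> frontier X \<Longrightarrow> \<rho> \<le> dist x y"
  shows "ball x \<rho> \<subseteq> X"
proof (rule ccontr)
  assume n: "\<not> ball x \<rho> \<subseteq> X"
  then have "0 < \<rho>" by (metis ball_eq_empty empty_subsetI not_le)
  then have "x \<in> ball x \<rho> \<inter> X" using assms(1) by simp
  with n have "ball x \<rho> \<inter> frontier X \<noteq> {}"
    by (intro connected_Int_frontier connected_ball) blast+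
  then obtain z where "dist x z < \<rho>" "z \<in> frontier X" by auto
  with far[of z] show False by simp
qed

text \<open>This is what the distance between the support and the boundary is for: a kernel of radius at most \<open>\<rho>\<close> that is
  centred at a typical point keeps all of its mass inside \<open>X\<close>.\<close>

lemma AE_ball_subset:
  fixes X :: "'a::euclidean_space set"
  assumes \<nu>: "\<nu> \<in> prob_measures X" and \<rho>: "\<rho> \<le> setdist (msupport X \<nu>) (frontier X)"
  shows "AE x in measure_on X \<nu>. ball x \<rho> \<subseteq> X"
  using AE_msupport[OF prob_measuresD(1,2)[OF \<nu>]]
proof eventually_elim
  case (elim x)
  show ?case
  proof (rule ball_subset_of_frontier_dist)
    show "x \<in> X" using elim by (simp add: msupport_def)
    show "\<rho> \<le> dist x y" if "y \<in> frontier X" for y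
      using setdist_le_dist[OF elim that] \<rho> by linarith
  qed
qed

text \<open>A point of the limit support that is too close to the boundary carries a tent function that is null for every
  member of the sequence but has a positive integral in the limit.\<close>

lemma weak_star_limit_support:
  fixes X :: "'a::euclidean_space set"
  assumes X: "compact X" and \<nu>s: "\<And>n. \<nu>s n \<in> prob_measures X" and \<nu>: "\<nu> \<in> prob_measures X"
    and lim: "weak_star_tendsto X \<nu>s \<nu>" and "0 < \<rho>"
    and far: "\<And>n. \<rho> \<le> setdist (msupport X (\<nu>s n)) (frontier X)"
  shows "\<rho> \<le> setdist (msupport X \<nu>) (frontier X)"
proof (rule le_setdistI)
  note D = prob_measuresD[OF \<nu>]
  show "msupport X \<nu> \<noteq> {}"
  proof
    assume "msupport X \<nu> = {}"
    then have "AE x in measure_on X \<nu>. False" using AE_msupport[OF D(1,2)] by simp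
    then have "emeasure (measure_on X \<nu>) X = 0"
      by (subst (asm) AE_iff_measurable[of X]) (auto simp: borel_sets_on_self)
    then show False using emeasure_measure_on[OF D(1,2) borel_sets_on_self] D(3) by simp
  qed
  show "frontier X \<noteq> {}" using far[of 0] \<open>0 < \<rho>\<close> by auto
  fix x y assume x: "x \<in> msupport X \<nu>" and y: "y \<in> frontier X"
  show "\<rho> \<le> dist x y"
  proof (rule ccontr)
    assume "\<not> \<rho> \<le> dist x y"
    define \<eta> where "\<eta> = \<rho> - dist x y"
    have \<eta>: "0 < \<eta>" using \<open>\<not> \<rho> \<le> dist x y\<close> by (simp add: \<eta>_def)
    define f where "f z = max 0 (1 - dist z x / \<eta>)" for z
    have f: "0 \<le> f z" for z by (simp add: f_def)
    have fc: "continuous_on X f" unfolding f_def using \<eta> by (intro continuous_intros) auto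
    have "sintegral X (\<nu>s n) f = 0" for n
    proof -
      note Dn = prob_measuresD[OF \<nu>s[of n]]
      have "AE z in measure_on X (\<nu>s n). f z = 0"
        using AE_msupport[OF Dn(1,2)]
      proof eventually_elim
        case (elim z)
        have "\<rho> \<le> dist z y" using setdist_le_dist[OF elim y] far[of n] by linarith
        then have "\<eta> \<le> dist z x" using dist_triangle[of z y x] by (simp add: \<eta>_def)
        then show ?case using \<eta> by (simp add: f_def)
      qed
      then show ?thesis
        unfolding sintegral_nonneg_measure[OF Dn(1,2)] by (rule integral_eq_zero_AE)
    qed
    moreover have "(\<lambda>n. sintegral X (\<nu>s n) f) \<longlonglongrightarrow> sintegral X \<nu> f"
      using lim fc by (simp add: weak_star_tendsto_def)
    ultimately have zero: "integral\<^sup>L (measure_on X \<nu>) f = 0"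
      using sintegral_nonneg_measure[OF D(1,2)] by (simp add: LIMSEQ_const_iff)
    have int: "integrable (measure_on X \<nu>) f"
      by (rule continuous_on_integrable[OF sets_measure_on fc X finite_measure_on[OF D(1,2)]])
    have U: "ball x (\<eta> / 2) \<inter> X \<in> borel_sets_on X" by (intro borel_sets_onI) auto
    have "\<forall>U. open U \<longrightarrow> x \<in> U \<longrightarrow> 0 < total_variation X \<nu> (U \<inter> X)"
      using x by (simp add: msupport_def)
    from this[rule_format, of "ball x (\<eta> / 2)"] \<eta> have "0 < \<nu> (ball x (\<eta> / 2) \<inter> X)"
      using total_variation_nonneg_measure[OF D(1,2) U] by simp
    also have "\<dots> = measure (measure_on X \<nu>) (ball x (\<eta> / 2) \<inter> X)"
      by (rule measure_measure_on[OF D(1,2) U, symmetric])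
    also have "\<dots> = (\<integral>z. indicat_real (ball x (\<eta> / 2) \<inter> X) z \<partial>measure_on X \<nu>)"
      by (simp add: Int_absorb2)
    also have "\<dots> \<le> (\<integral>z. 2 * f z \<partial>measure_on X \<nu>)"
    proof (rule integral_mono_AE)
      show "integrable (measure_on X \<nu>) (indicat_real (ball x (\<eta> / 2) \<inter> X))"
        using U finite_measure.emeasure_finite[OF finite_measure_on[OF D(1,2)]]
        by (intro integrable_real_indicator) (auto simp: less_top[symmetric])
      show "integrable (measure_on X \<nu>) (\<lambda>z. 2 * f z)" using int by simp
      have "indicat_real (ball x (\<eta> / 2) \<inter> X) z \<le> 2 * f z" for z
      proof (cases "z \<in> ball x (\<eta> / 2)")
        case True
        then have "dist z x / \<eta> < 1 / 2" using \<eta> by (simp add: dist_commute divide_less_eq)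
        then have "1 / 2 \<le> 1 - dist z x / \<eta>" by linarith
        also have "\<dots> \<le> f z" unfolding f_def by (rule max.cobounded2)
        finally show ?thesis by (simp split: split_indicator)
      qed (use f[of z] in simp)
      then show "AE z in measure_on X \<nu>. indicat_real (ball x (\<eta> / 2) \<inter> X) z \<le> 2 * f z" by simp
    qed
    also have "\<dots> = 0" using zero by simp
    finally show False by simp
  qed
qed

lemma pushforward_eqI:
  fixes X :: "'a::metric_space set" and Y :: "'b::metric_space set"
  assumes \<pi>: "\<pi> \<in> signed_measures X" "nonneg_measure \<pi>" and \<mu>: "\<mu> \<in> signed_measures Y" "nonneg_measure \<mu>"
    and Y: "closed Y" and h: "continuous_on X h" "h ` X \<subseteq> Y"
    and eq: "\<And>g. continuous_on Y g \<Longrightarrow> sintegral X \<pi> (\<lambda>x. g (h x)) = sintegral Y \<mu> g"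
  shows "pushforward X Y h \<pi> = \<mu>"
proof -
  have ca: "ctbl_add X \<pi>" "ctbl_add Y \<mu>" using \<pi> \<mu> by (auto intro: signed_measures_ctbl_add)
  have nn: "0 \<le> \<pi> A" "0 \<le> \<mu> B" for A B using \<pi> \<mu> by (auto simp: nonneg_measure_def)
  let ?P = "measure_on X \<pi>" and ?M = "measure_on Y \<mu>"
  have hm: "h \<in> measurable ?P (restrict_space borel Y)"
    using h by (intro measurable_restrict_space2 continuous_on_measurable) auto
  have "distr ?P (restrict_space borel Y) h = ?M"
  proof (rule finite_measure_eqI_continuous[OF Y])
    show "finite_measure (distr ?P (restrict_space borel Y) h)"
      by (rule finite_measure.finite_measure_distr[OF finite_measure_on[OF ca(1) nn(1)] hm])
    show "finite_measure ?M" by (rule finite_measure_on[OF ca(2) nn(2)])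
    fix g :: "'b \<Rightarrow> real" assume g: "continuous_on Y g"
    have "integral\<^sup>L (distr ?P (restrict_space borel Y) h) g = integral\<^sup>L ?P (\<lambda>x. g (h x))"
      by (rule integral_distr[OF hm borel_measurable_continuous_on_restrict[OF g]])
    then show "integral\<^sup>L (distr ?P (restrict_space borel Y) h) g = integral\<^sup>L ?M g"
      using eq[OF g] sintegral_nonneg_measure[OF ca(1) nn(1)] sintegral_nonneg_measure[OF ca(2) nn(2)] by simp
  qed simp_all
  then have "\<mu> B = \<pi> (h -` B \<inter> X)" if B: "B \<in> borel_sets_on Y" for B
  proof -
    have "\<mu> B = measure ?M B" by (rule measure_measure_on[OF ca(2) nn(2) B, symmetric])
    also have "\<dots> = measure (distr ?P (restrict_space borel Y) h) B"
      using \<open>distr ?P (restrict_space borel Y) h = ?M\<close> by simp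
    also have "\<dots> = measure ?P (h -` B \<inter> X)" using B by (subst measure_distr[OF hm]) auto
    also have "\<dots> = \<pi> (h -` B \<inter> X)"
      using measurable_sets[OF hm B] by (intro measure_measure_on[OF ca(1) nn(1)]) simp
    finally show ?thesis .
  qed
  moreover have "\<mu> B = 0" if "B \<notin> borel_sets_on Y" for B
    using \<mu>(1) that by (simp add: signed_measures_def)
  ultimately show ?thesis by (simp add: pushforward_def fun_eq_iff)
qed

section \<open>Measures with square integrable densities\<close>

lemma Lp_on_imp_integrable:
  assumes "1 < p" "U \<in> lmeasurable" "Lp_on p U g"
  shows "set_integrable lebesgue U g"
proof -
  let ?G = "LINT y:U|lebesgue. \<bar>g y\<bar> powr p"
  have "0 \<le> ?G" unfolding set_lebesgue_integral_def by (auto intro!: integral_nonneg_AE AE_I2)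
  then have "?G \<le> (?G powr (1 / p)) powr p" using assms(1) by (simp add: powr_powr)
  then show ?thesis
    by (intro Lp_on_set_integrable[OF assms(1,2) _ _ order_refl assms(3), of "measure lebesgue U + 1" "?G powr (1 / p)"])
      (auto simp: add_nonneg_pos)
qed

text \<open>The density is Lebesgue measurable, while the measure lives on the Borel sets; it is the image of the
  measure with density \<open>f\<close> under the identity.\<close>

lemma
  fixes S :: "'a::euclidean_space set"
  assumes S: "compact S" and f: "set_integrable lebesgue S f"
    and nn: "AE z in lebesgue. z \<in> S \<longrightarrow> 0 \<le> f z"
  shows density_measure_nonneg: "0 \<le> density_measure S f A"
    and sintegral_density_measure: "density_measure S f \<in> signed_measures S \<Longrightarrow> continuous_on S h \<Longrightarrow>
      sintegral S (density_measure S f) h = (LINT z:S|lebesgue. h z * f z)"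
proof -
  let ?\<nu> = "density_measure S f"
  have Ss: "S \<in> sets lebesgue" using S by (intro fmeasurableD lmeasurable_compact)
  have sub: "A \<in> sets lebesgue" "A \<subseteq> S" if "A \<in> borel_sets_on S" for A
    using that S by (auto simp: sets_restrict_space borel_compact intro!: sets_completionI_sets)
  have val: "?\<nu> A = (LINT z|lebesgue. indicat_real A z * f z)" if "A \<in> borel_sets_on S" for A
    using that by (simp add: density_measure_def set_lebesgue_integral_def)
  show nnA: "0 \<le> ?\<nu> A" for A
  proof (cases "A \<in> borel_sets_on S")
    case True
    show ?thesis unfolding val[OF True]
      using nn by (intro integral_nonneg_AE, eventually_elim) (use sub(2)[OF True] in \<open>auto split: split_indicator\<close>)
  qed (simp add: density_measure_def)
  assume \<nu>: "?\<nu> \<in> signed_measures S" and h: "continuous_on S h"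
  have ca: "ctbl_add S ?\<nu>" using \<nu> by (rule signed_measures_ctbl_add)
  let ?L = "restrict_space lebesgue S" and ?B = "restrict_space borel S"
  have fL: "integrable ?L f"
    using f Ss by (simp add: set_integrable_def integrable_restrict_space)
  have fm: "f \<in> borel_measurable ?L" using fL by (rule borel_measurable_integrable)
  have nnL: "AE z in ?L. 0 \<le> f z"
    using nn Ss by (subst AE_restrict_space_iff) auto
  have id: "(\<lambda>z. z) \<in> measurable ?L ?B"
  proof (rule measurableI)
    show "(\<lambda>z. z) -` A \<inter> space ?L \<in> sets ?L" if "A \<in> sets ?B" for A
      using sub[OF that] Ss by (auto simp: space_restrict_space sets_restrict_space_iff Int_absorb2)
  qed (auto simp: space_restrict_space)
  have id': "(\<lambda>z. z) \<in> measurable (density ?L (\<lambda>z. ennreal (f z))) ?B" using id by simp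
  have "measure_on S ?\<nu> = distr (density ?L (\<lambda>z. ennreal (f z))) ?B (\<lambda>z. z)"
  proof (rule measure_eqI)
    fix A assume "A \<in> sets (measure_on S ?\<nu>)"
    then have A: "A \<in> borel_sets_on S" by simp
    have AL: "A \<in> sets ?L" using sub[OF A] Ss by (simp add: sets_restrict_space_iff)
    have "emeasure (distr (density ?L (\<lambda>z. ennreal (f z))) ?B (\<lambda>z. z)) A
        = emeasure (density ?L (\<lambda>z. ennreal (f z))) A"
      using A sub(2)[OF A] by (subst emeasure_distr[OF id']) (auto simp: space_restrict_space Int_absorb2)
    also have "\<dots> = (\<integral>\<^sup>+z. ennreal (f z) * indicator A z \<partial>?L)"
      using fm AL by (intro emeasure_density) auto
    also have "\<dots> = (\<integral>\<^sup>+z. ennreal (indicat_real A z * f z) \<partial>?L)"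
      by (intro nn_integral_cong) (simp split: split_indicator)
    also have "\<dots> = ennreal (\<integral>z. indicat_real A z * f z \<partial>?L)"
    proof (rule nn_integral_eq_integral)
      show "integrable ?L (\<lambda>z. indicat_real A z * f z)"
        using integrable_mult_indicator[OF AL fL] by simp
      show "AE z in ?L. 0 \<le> indicat_real A z * f z"
        using nnL by eventually_elim (auto split: split_indicator)
    qed
    also have "(\<integral>z. indicat_real A z * f z \<partial>?L) = ?\<nu> A"
      unfolding val[OF A] using Ss sub(2)[OF A]
      by (subst integral_restrict_space) (auto intro!: Bochner_Integration.integral_cong split: split_indicator)
    finally show "emeasure (measure_on S ?\<nu>) A = emeasure (distr (density ?L (\<lambda>z. ennreal (f z))) ?B (\<lambda>z. z)) A"
      using emeasure_measure_on[OF ca nnA A] by simp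
  qed simp
  then have "sintegral S ?\<nu> h = integral\<^sup>L (distr (density ?L (\<lambda>z. ennreal (f z))) ?B (\<lambda>z. z)) h"
    using sintegral_nonneg_measure[OF ca nnA] by simp
  also have "\<dots> = integral\<^sup>L (density ?L (\<lambda>z. ennreal (f z))) h"
    using h by (subst integral_distr[OF id']) (auto intro: borel_measurable_continuous_on_restrict)
  also have "\<dots> = (\<integral>z. f z *\<^sub>R h z \<partial>?L)"
    using fm nnL measurable_compose[OF id borel_measurable_continuous_on_restrict[OF h]]
    by (intro integral_density) auto
  also have "\<dots> = (LINT z:S|lebesgue. h z * f z)"
    using Ss by (subst integral_restrict_space) (auto simp: set_lebesgue_integral_def mult.commute)
  finally show "sintegral S ?\<nu> h = (LINT z:S|lebesgue. h z * f z)" .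
qed

section \<open>Mollified measures\<close>

abbreviation lborel_on :: "'a::euclidean_space set \<Rightarrow> 'a measure" where
  "lborel_on S \<equiv> restrict_space lborel S"

lemma finite_lborel_on: "compact S \<Longrightarrow> finite_measure (lborel_on S)"
  using emeasure_compact_finite[of S]
  by (intro finite_measureI) (auto simp: space_restrict_space emeasure_restrict_space borel_compact less_top[symmetric])

lemma integral_lborel_on:
  fixes f :: "'a::euclidean_space \<Rightarrow> real"
  assumes "compact S"
  shows "(\<integral>x. f x \<partial>lborel_on S) = (\<integral>x. indicat_real S x * f x \<partial>lborel)"
  using assms by (subst integral_restrict_space) (auto simp: borel_compact)

lemma set_integral_lebesgue_eq:
  fixes f :: "'a::euclidean_space \<Rightarrow> real"
  assumes S: "compact S" and f: "f \<in> borel_measurable (lborel_on S)"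
  shows "(LINT x:S|lebesgue. f x) = (\<integral>x. f x \<partial>lborel_on S)"
proof -
  have "(\<lambda>x. indicat_real S x *\<^sub>R f x) \<in> borel_measurable lborel"
    using f S by (subst (asm) borel_measurable_restrict_space_iff) (auto simp: borel_compact)
  then show ?thesis
    unfolding integral_lborel_on[OF S] set_lebesgue_integral_def by (simp add: integral_completion)
qed

lemma measure_lebesgue_lborel_on: "compact S \<Longrightarrow> measure lebesgue S = measure (lborel_on S) S"
  by (simp add: measure_restrict_space borel_compact)

lemma continuous_lborel_on: "continuous_on S f \<Longrightarrow> f \<in> borel_measurable (lborel_on S)"
  using continuous_on_measurable[of "lborel_on S" S f] by (simp add: sets_restrict_space)

lemma space_lborel_on [simp]: "space (lborel_on S) = S"
  by (simp add: space_restrict_space)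

lemma mollifier_meas: "(\<lambda>x. mollifier \<delta> (x - y)) \<in> borel_measurable (lborel_on S)"
  by (intro measurable_restrict_space1) simp

lemma mollifier_abs_le:
  "0 < \<delta> \<Longrightarrow> \<bar>mollifier \<delta> (z::'a::euclidean_space)\<bar> \<le> inverse (\<delta> ^ DIM('a) * bump_mass TYPE('a))"
  using mollifier_nonneg[of \<delta> z] mollifier_le[of \<delta> z] by simp

lemma integral_mollifier_on:
  assumes "compact S" "0 < \<delta>" "ball y \<delta> \<subseteq> S"
  shows "(\<integral>x. mollifier \<delta> (x - y) \<partial>lborel_on S) = 1"
proof -
  have "mollifier \<delta> (x - y) = 0" if "x \<notin> S" for x
  proof (rule mollifier_eq_0[OF assms(2)])
    have "x \<notin> ball y \<delta>" using assms(3) that by blast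
    then show "\<delta> \<le> norm (x - y)" by (simp add: dist_norm norm_minus_commute)
  qed
  then have "(\<lambda>x. indicat_real S x * mollifier \<delta> (x - y)) = (\<lambda>x. mollifier \<delta> (x - y))"
    by (auto simp: fun_eq_iff split: split_indicator)
  then show ?thesis
    unfolding integral_lborel_on[OF assms(1)] using integral_mollifier[OF assms(2)] by simp
qed

lemma integrable_mult_mollifier:
  fixes g :: "'a::euclidean_space \<Rightarrow> real"
  assumes S: "compact S" and "0 < \<delta>" and g: "g \<in> borel_measurable (lborel_on S)" "\<And>x. x \<in> S \<Longrightarrow> \<bar>g x\<bar> \<le> B"
  shows "integrable (lborel_on S) (\<lambda>x. g x * mollifier \<delta> (x - y))"
proof (rule finite_measure.integrable_const_bound[OF finite_lborel_on[OF S]])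
  show "(\<lambda>x. g x * mollifier \<delta> (x - y)) \<in> borel_measurable (lborel_on S)"
    by (intro borel_measurable_times g mollifier_meas)
  show "AE x in lborel_on S. norm (g x * mollifier \<delta> (x - y)) \<le> B * inverse (\<delta> ^ DIM('a) * bump_mass TYPE('a))"
  proof (rule AE_I2)
    fix x assume "x \<in> space (lborel_on S)"
    then have "\<bar>g x\<bar> \<le> B" using g(2) by simp
    then show "norm (g x * mollifier \<delta> (x - y)) \<le> B * inverse (\<delta> ^ DIM('a) * bump_mass TYPE('a))"
      unfolding real_norm_def abs_mult
      by (rule mult_mono[OF _ mollifier_abs_le[OF assms(2)]]) (use order_trans[OF abs_ge_zero \<open>\<bar>g x\<bar> \<le> B\<close>] in auto)
  qed
qed

lemma kernel_average:
  fixes g :: "'a::euclidean_space \<Rightarrow> real"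
  assumes S: "compact S" and \<delta>: "0 < \<delta>" "ball y \<delta> \<subseteq> S"
    and g: "g \<in> borel_measurable (lborel_on S)" "\<And>x. x \<in> S \<Longrightarrow> \<bar>g x\<bar> \<le> B"
    and near: "\<And>x. x \<in> ball y \<delta> \<Longrightarrow> \<bar>g x - a\<bar> \<le> \<eta>"
  shows "\<bar>(\<integral>x. g x * mollifier \<delta> (x - y) \<partial>lborel_on S) - a\<bar> \<le> \<eta>"
proof -
  let ?m = "\<lambda>x. mollifier \<delta> (x - y)"
  have m: "integrable (lborel_on S) (\<lambda>x. c * ?m x)" for c
    by (rule integrable_mult_mollifier[OF S \<delta>(1)]) auto
  have one: "(\<integral>x. c * ?m x \<partial>lborel_on S) = c" for c
    using integral_mollifier_on[OF S \<delta>] by simp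
  have gm: "integrable (lborel_on S) (\<lambda>x. g x * ?m x)" by (rule integrable_mult_mollifier[OF S \<delta>(1) g])
  have ptw: "\<bar>(g x - a) * ?m x\<bar> \<le> \<eta> * ?m x" for x
  proof (cases "x \<in> ball y \<delta>")
    case True
    then show ?thesis
      unfolding abs_mult using near[OF True] mollifier_nonneg[of \<delta> "x - y"] \<delta>(1) by (simp add: mult_right_mono)
  next
    case False
    then show ?thesis using mollifier_eq_0[OF \<delta>(1), of "x - y"] by (simp add: dist_norm norm_minus_commute)
  qed
  have "(\<integral>x. g x * ?m x \<partial>lborel_on S) - a = (\<integral>x. (g x - a) * ?m x \<partial>lborel_on S)"
    using gm m[of a] one[of a] by (simp add: left_diff_distrib)
  also have "\<bar>\<dots>\<bar> \<le> (\<integral>x. \<eta> * ?m x \<partial>lborel_on S)"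
    using gm m[of a] m[of \<eta>] ptw
    by (intro order_trans[OF integral_abs_bound] integral_mono integrable_abs) (auto simp: left_diff_distrib)
  also have "\<dots> = \<eta>" by (rule one)
  finally show ?thesis .
qed

text \<open>The mollified image under \<open>Y\<close> of the measure with density \<open>w\<close> with respect to \<open>Q\<close>.  Up to an
  additive constant, the smoothed marginals are the case \<open>w = 1\<close> with the identity for \<open>Y\<close>; the blocks of the recovery sequence take for \<open>Q\<close> a coupling, for \<open>w\<close> a
  function of the first and for \<open>Y\<close> the projection to the second variable.\<close>

definition moll :: "'q measure \<Rightarrow> ('q \<Rightarrow> real) \<Rightarrow> ('q \<Rightarrow> 'a) \<Rightarrow> real \<Rightarrow> 'a::euclidean_space \<Rightarrow> real" where
  "moll Q w Y \<delta> x = (\<integral>q. w q * mollifier \<delta> (x - Y q) \<partial>Q)"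

lemma
  fixes Y :: "'q \<Rightarrow> 'a::euclidean_space"
  assumes Q: "finite_measure Q" and w: "w \<in> borel_measurable Q" "\<And>q. q \<in> space Q \<Longrightarrow> 0 \<le> w q" "\<And>q. q \<in> space Q \<Longrightarrow> w q \<le> 1"
    and Y: "Y \<in> measurable Q borel" and \<delta>: "0 < \<delta>"
  shows moll_measurable: "moll Q w Y \<delta> \<in> borel_measurable borel"
    and moll_nonneg: "0 \<le> moll Q w Y \<delta> x"
    and moll_le: "moll Q w Y \<delta> x \<le> inverse (\<delta> ^ DIM('a) * bump_mass TYPE('a)) * (\<integral>q. w q \<partial>Q)"
    and moll_fubini: "compact S \<Longrightarrow> g \<in> borel_measurable (lborel_on S) \<Longrightarrow> (\<And>x. x \<in> S \<Longrightarrow> \<bar>g x\<bar> \<le> B) \<Longrightarrow>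
      (\<integral>x. g x * moll Q w Y \<delta> x \<partial>lborel_on S) = (\<integral>q. w q * (\<integral>x. g x * mollifier \<delta> (x - Y q) \<partial>lborel_on S) \<partial>Q)"
    and moll_fubini_integrable: "compact S \<Longrightarrow> g \<in> borel_measurable (lborel_on S) \<Longrightarrow> (\<And>x. x \<in> S \<Longrightarrow> \<bar>g x\<bar> \<le> B) \<Longrightarrow>
      integrable Q (\<lambda>q. w q * (\<integral>x. g x * mollifier \<delta> (x - Y q) \<partial>lborel_on S))"
proof -
  let ?K = "inverse (\<delta> ^ DIM('a) * bump_mass TYPE('a))"
  interpret Q: finite_measure Q by (rule Q)
  note [measurable] = w(1) Y
  have K: "0 \<le> ?K" using \<delta> bump_mass_pos[where 'a='a] by simp
  have kernel [measurable]: "(\<lambda>(x, q). w q * mollifier \<delta> (x - Y q)) \<in> borel_measurable (borel \<Otimes>\<^sub>M Q)"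
    by measurable
  show "moll Q w Y \<delta> \<in> borel_measurable borel"
    unfolding moll_def[abs_def] by (rule Q.borel_measurable_lebesgue_integral[OF kernel])
  show "0 \<le> moll Q w Y \<delta> x"
    unfolding moll_def by (intro integral_nonneg_AE AE_I2 mult_nonneg_nonneg w(2) mollifier_nonneg less_imp_le[OF \<delta>])
  have wi: "integrable Q w"
    by (rule Q.integrable_const_bound[of _ 1]) (use w in \<open>auto intro!: AE_I2\<close>)
  have bd: "\<bar>w q * mollifier \<delta> z\<bar> \<le> ?K * w q" if "q \<in> space Q" for q and z :: 'a
    unfolding abs_mult using w(2)[OF that] mult_left_mono[OF mollifier_abs_le[OF \<delta>, of z], of "w q"] by (simp add: mult.commute)
  have int: "integrable Q (\<lambda>q. w q * mollifier \<delta> (x - Y q))"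
    by (rule Bochner_Integration.integrable_bound[OF integrable_mult_right[OF wi, of ?K]])
      (use bd in \<open>auto intro!: AE_I2 order_trans[OF _ abs_ge_self]\<close>)
  show "moll Q w Y \<delta> x \<le> ?K * (\<integral>q. w q \<partial>Q)"
  proof -
    have "moll Q w Y \<delta> x \<le> (\<integral>q. ?K * w q \<partial>Q)"
      unfolding moll_def using bd by (intro integral_mono int integrable_mult_right wi) (auto simp: abs_le_iff)
    then show ?thesis by simp
  qed
  {
  assume S: "compact S" and g: "g \<in> borel_measurable (lborel_on S)" "\<And>x. x \<in> S \<Longrightarrow> \<bar>g x\<bar> \<le> B"
  interpret L: finite_measure "lborel_on S" by (rule finite_lborel_on[OF S])
  interpret P: pair_sigma_finite "lborel_on S" Q ..
  have PQ: "finite_measure (lborel_on S \<Otimes>\<^sub>M Q)" by (rule finite_measure_pair_measure) unfold_locales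
  note [measurable] = g(1)
  have m [measurable]: "(\<lambda>(x, q). mollifier \<delta> (x - Y q)) \<in> borel_measurable (lborel_on S \<Otimes>\<^sub>M Q)"
  proof -
    have "(\<lambda>x. x) \<in> measurable (lborel_on S) borel" by (intro measurable_restrict_space1) simp
    note [measurable] = this
    show ?thesis by measurable
  qed
  have pair: "integrable (lborel_on S \<Otimes>\<^sub>M Q) (\<lambda>(x, q). g x * (w q * mollifier \<delta> (x - Y q)))"
  proof (rule finite_measure.integrable_const_bound[OF PQ])
    show "AE z in lborel_on S \<Otimes>\<^sub>M Q. norm (case z of (x, q) \<Rightarrow> g x * (w q * mollifier \<delta> (x - Y q))) \<le> B * ?K"
    proof (rule AE_I2)
      fix z assume z: "z \<in> space (lborel_on S \<Otimes>\<^sub>M Q)"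
      obtain x q where xq: "z = (x, q)" "x \<in> S" "q \<in> space Q" using z by (cases z) (auto simp: space_pair_measure)
      have "?K * w q \<le> ?K * 1" using w(3)[OF xq(3)] K by (intro mult_left_mono)
      then have "\<bar>w q * mollifier \<delta> (x - Y q)\<bar> \<le> ?K" using bd[OF xq(3), of "x - Y q"] by simp
      then show "norm (case z of (x, q) \<Rightarrow> g x * (w q * mollifier \<delta> (x - Y q))) \<le> B * ?K"
        unfolding xq(1) using g(2)[OF xq(2)] by (simp only: prod.case real_norm_def abs_mult[of "g x"]) (rule mult_mono, auto)
    qed
    show "(\<lambda>(x, q). g x * (w q * mollifier \<delta> (x - Y q))) \<in> borel_measurable (lborel_on S \<Otimes>\<^sub>M Q)"
      by measurable
  qed
  from P.Fubini_integral[OF pair]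
  have "(\<integral>q. (\<integral>x. g x * (w q * mollifier \<delta> (x - Y q)) \<partial>lborel_on S) \<partial>Q)
      = (\<integral>x. (\<integral>q. g x * (w q * mollifier \<delta> (x - Y q)) \<partial>Q) \<partial>lborel_on S)" .
  also have "\<dots> = (\<integral>x. g x * moll Q w Y \<delta> x \<partial>lborel_on S)"
    unfolding moll_def by simp
  also have "(\<integral>q. (\<integral>x. g x * (w q * mollifier \<delta> (x - Y q)) \<partial>lborel_on S) \<partial>Q)
     = (\<integral>q. w q * (\<integral>x. g x * mollifier \<delta> (x - Y q) \<partial>lborel_on S) \<partial>Q)"
    by (simp add: mult.left_commute[of "g _"])
  finally show "(\<integral>x. g x * moll Q w Y \<delta> x \<partial>lborel_on S)
     = (\<integral>q. w q * (\<integral>x. g x * mollifier \<delta> (x - Y q) \<partial>lborel_on S) \<partial>Q)" by simp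
  show "integrable Q (\<lambda>q. w q * (\<integral>x. g x * mollifier \<delta> (x - Y q) \<partial>lborel_on S))"
    using P.integrable_snd[OF pair] by (simp add: mult.left_commute[of "g _"])
  }
qed

lemma continuous_on_compact_bound:
  fixes g :: "'a::topological_space \<Rightarrow> real"
  assumes "compact S" "continuous_on S g"
  obtains B where "0 \<le> B" "\<And>x. x \<in> S \<Longrightarrow> \<bar>g x\<bar> \<le> B"
proof -
  have "bounded (g ` S)" using assms by (intro compact_imp_bounded compact_continuous_image)
  then obtain B where "0 < B" "\<And>x. x \<in> S \<Longrightarrow> \<bar>g x\<bar> \<le> B" by (auto simp: bounded_pos)
  then show ?thesis by (intro that[of B]) auto
qed

lemma integral_prob_abs_le:
  assumes "finite_measure M" "measure M (space M) = 1" "integrable M f" "AE x in M. \<bar>f x\<bar> \<le> (c::real)"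
  shows "\<bar>integral\<^sup>L M f\<bar> \<le> c"
proof -
  have "\<bar>integral\<^sup>L M f\<bar> \<le> (\<integral>x. \<bar>f x\<bar> \<partial>M)" by (rule integral_abs_bound)
  also have "\<dots> \<le> (\<integral>x. c \<partial>M)"
    using assms by (intro integral_mono_AE integrable_abs finite_measure.integrable_const)
  finally show ?thesis using assms(2) by simp
qed

lemma smoothing_eq_moll:
  assumes "\<mu> \<in> prob_measures X"
  shows "smoothing X \<delta> \<mu> x = moll (measure_on X \<mu>) (\<lambda>_. 1) (\<lambda>y. y) \<delta> x + \<delta> / measure lebesgue X"
  using sintegral_nonneg_measure[OF prob_measuresD(1,2)[OF assms]] by (simp add: smoothing_def moll_def)

lemma id_measurable_on: "(\<lambda>y. y) \<in> measurable (measure_on X \<mu>) borel"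
  by (rule continuous_on_measurable[OF sets_measure_on continuous_on_id])

lemma prob_measure_on:
  assumes "\<mu> \<in> prob_measures X"
  shows "finite_measure (measure_on X \<mu>)" "measure (measure_on X \<mu>) X = 1"
  using finite_measure_on[OF prob_measuresD(1,2)[OF assms]]
    measure_measure_on[OF prob_measuresD(1,2)[OF assms] borel_sets_on_self] prob_measuresD(3)[OF assms] by simp_all

lemma
  fixes X :: "'a::euclidean_space set"
  assumes \<mu>: "\<mu> \<in> prob_measures X" and \<delta>: "0 < \<delta>"
  shows smoothing_measurable: "smoothing X \<delta> \<mu> \<in> borel_measurable borel"
    and smoothing_nonneg: "0 \<le> smoothing X \<delta> \<mu> x"
    and smoothing_le: "smoothing X \<delta> \<mu> x \<le> inverse (\<delta> ^ DIM('a) * bump_mass TYPE('a)) + \<delta> / measure lebesgue X"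
proof -
  let ?m = "moll (measure_on X \<mu>) (\<lambda>_. 1) (\<lambda>y. y) \<delta>"
  note fm = prob_measure_on[OF \<mu>]
  note m = fm(1) _ _ _ id_measurable_on \<delta>
  have [measurable]: "?m \<in> borel_measurable borel" by (rule moll_measurable[OF m]) auto
  show "smoothing X \<delta> \<mu> \<in> borel_measurable borel"
    unfolding smoothing_eq_moll[OF \<mu>, abs_def] by measurable
  have "0 \<le> ?m x" by (rule moll_nonneg[OF m]) auto
  then show "0 \<le> smoothing X \<delta> \<mu> x" using \<delta> by (simp add: smoothing_eq_moll[OF \<mu>])
  have "?m x \<le> inverse (\<delta> ^ DIM('a) * bump_mass TYPE('a)) * (\<integral>q. 1 \<partial>measure_on X \<mu>)"
    by (rule moll_le[OF m]) auto
  then show "smoothing X \<delta> \<mu> x \<le> inverse (\<delta> ^ DIM('a) * bump_mass TYPE('a)) + \<delta> / measure lebesgue X"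
    using fm(2) by (simp add: smoothing_eq_moll[OF \<mu>])
qed

text \<open>By Fubini the mollification acts on \<open>g\<close>, whose averages over balls of radius \<open>\<delta>\<close> differ from \<open>g\<close> by its
  oscillation; the added constant density has mass \<open>\<delta>\<close>.\<close>

lemma smoothing_close:
  fixes X :: "'a::euclidean_space set"
  assumes X: "compact X" "0 < measure lebesgue X" and \<mu>: "\<mu> \<in> prob_measures X" and \<delta>: "0 < \<delta>" "\<delta> \<le> \<rho>"
    and far: "\<rho> \<le> setdist (msupport X \<mu>) (frontier X)"
    and g: "continuous_on X g" "\<And>x. x \<in> X \<Longrightarrow> \<bar>g x\<bar> \<le> B"
    and near: "\<And>x y. x \<in> X \<Longrightarrow> y \<in> X \<Longrightarrow> dist x y < \<delta> \<Longrightarrow> \<bar>g x - g y\<bar> \<le> \<eta>"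
  shows "\<bar>(\<integral>x. g x * smoothing X \<delta> \<mu> x \<partial>lborel_on X) - sintegral X \<mu> g\<bar> \<le> \<eta> + \<delta> * B"
proof -
  let ?M = "measure_on X \<mu>" and ?L = "lborel_on X"
  let ?m = "moll ?M (\<lambda>_. 1) (\<lambda>y. y) \<delta>" and ?A = "\<lambda>y. \<integral>x. g x * mollifier \<delta> (x - y) \<partial>?L"
  note fm = prob_measure_on[OF \<mu>]
  note m = fm(1) _ _ _ id_measurable_on \<delta>(1)
  have gm: "g \<in> borel_measurable ?L" by (rule continuous_lborel_on[OF g(1)])
  have gi: "integrable ?L g"
    by (rule finite_measure.integrable_const_bound[OF finite_lborel_on[OF X(1)], of _ B]) (use g(2) gm in \<open>auto intro!: AE_I2\<close>)
  have fub: "(\<integral>x. g x * ?m x \<partial>?L) = (\<integral>q. 1 * ?A q \<partial>?M)"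
    by (rule moll_fubini[OF m X(1) gm g(2)]) auto
  have gM: "integrable ?M g"
    by (rule continuous_on_integrable[OF sets_measure_on g(1) X(1) fm(1)])
  have Am: "?A \<in> borel_measurable ?M"
  proof -
    interpret L: finite_measure ?L by (rule finite_lborel_on[OF X(1)])
    note [measurable] = gm id_measurable_on[of X \<mu>]
    have "(\<lambda>x. x) \<in> measurable ?L borel" by (intro measurable_restrict_space1) simp
    note [measurable] = this
    show ?thesis by measurable
  qed
  have diff: "AE y in ?M. \<bar>?A y - g y\<bar> \<le> \<eta>"
    using AE_ball_subset[OF \<mu> far] AE_space[of ?M]
  proof eventually_elim
    case (elim y)
    have "ball y \<delta> \<subseteq> X" using elim(1) \<delta>(2) by (meson order_trans subset_ball)
    moreover have "\<bar>g x - g y\<bar> \<le> \<eta>" if "x \<in> ball y \<delta>" for x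
      using that elim(2) \<open>ball y \<delta> \<subseteq> X\<close> by (intro near) (auto simp: dist_commute)
    ultimately show ?case by (intro kernel_average[OF X(1) \<delta>(1) _ gm g(2)])
  qed
  have dm: "(\<lambda>y. ?A y - g y) \<in> borel_measurable ?M" using Am gM by simp
  have di: "integrable ?M (\<lambda>y. ?A y - g y)"
    by (rule finite_measure.integrable_const_bound[OF fm(1) _ dm, of \<eta>]) (use diff in simp)
  have Ai: "integrable ?M ?A" using Bochner_Integration.integrable_add[OF di gM] by simp
  have "\<bar>\<integral>y. ?A y - g y \<partial>?M\<bar> \<le> \<eta>"
    using fm(2) by (intro integral_prob_abs_le[OF fm(1) _ di diff]) simp
  then have 1: "\<bar>(\<integral>x. g x * ?m x \<partial>?L) - sintegral X \<mu> g\<bar> \<le> \<eta>"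
    unfolding fub sintegral_nonneg_measure[OF prob_measuresD(1,2)[OF \<mu>]] using Ai gM by simp
  have mi: "integrable ?L (\<lambda>x. g x * ?m x)"
  proof (rule Bochner_Integration.integrable_bound)
    let ?K = "inverse (\<delta> ^ DIM('a) * bump_mass TYPE('a)) * (\<integral>q. 1 \<partial>?M)"
    show "integrable ?L (\<lambda>x. g x * ?K)" using gi by simp
    have "?m \<in> borel_measurable ?L" by (intro measurable_restrict_space1) (simp, rule moll_measurable[OF m], auto)
    then show "(\<lambda>x. g x * ?m x) \<in> borel_measurable ?L" using gm by simp
    show "AE x in ?L. norm (g x * ?m x) \<le> norm (g x * ?K)"
    proof (rule AE_I2)
      fix x
      have "0 \<le> ?m x" "?m x \<le> ?K" by (rule moll_nonneg[OF m] moll_le[OF m]; auto)+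
      then show "norm (g x * ?m x) \<le> norm (g x * ?K)"
        unfolding real_norm_def abs_mult[of "g x"] by (intro mult_left_mono) linarith+
    qed
  qed
  have "\<bar>\<integral>x. g x \<partial>?L\<bar> \<le> (\<integral>x. \<bar>g x\<bar> \<partial>?L)" by (rule integral_abs_bound)
  also have "\<dots> \<le> (\<integral>x. B \<partial>?L)"
    using g(2) gi by (intro integral_mono integrable_abs finite_measure.integrable_const finite_lborel_on X(1)) auto
  also have "\<dots> = B * measure lebesgue X"
    using measure_lebesgue_lborel_on[OF X(1)] by simp
  finally have "\<delta> / measure lebesgue X * \<bar>\<integral>x. g x \<partial>?L\<bar> \<le> \<delta> / measure lebesgue X * (B * measure lebesgue X)"
    using \<delta>(1) X(2) by (intro mult_left_mono) auto
  then have 2: "\<bar>\<delta> / measure lebesgue X * (\<integral>x. g x \<partial>?L)\<bar> \<le> \<delta> * B"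
    using \<delta>(1) X(2) by (simp add: abs_mult)
  have "(\<integral>x. g x * smoothing X \<delta> \<mu> x \<partial>?L) = (\<integral>x. g x * ?m x + \<delta> / measure lebesgue X * g x \<partial>?L)"
    unfolding smoothing_eq_moll[OF \<mu>] by (simp add: distrib_left mult.commute)
  also have "\<dots> = (\<integral>x. g x * ?m x \<partial>?L) + \<delta> / measure lebesgue X * (\<integral>x. g x \<partial>?L)"
    by (subst Bochner_Integration.integral_add[OF mi]) (use gi in auto)
  finally show ?thesis using 1 2 by linarith
qed

lemma smoothing_tendsto:
  fixes X :: "'a::euclidean_space set"
  assumes X: "compact X" "0 < measure lebesgue X" and \<mu>s: "\<And>n. \<mu>s n \<in> prob_measures X"
    and \<delta>: "\<And>n. 0 < \<delta> n" "\<And>n. \<delta> n \<le> \<rho>" "\<delta> \<longlonglongrightarrow> 0"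
    and far: "\<And>n. \<rho> \<le> setdist (msupport X (\<mu>s n)) (frontier X)" and g: "continuous_on X g"
    and lim: "(\<lambda>n. sintegral X (\<mu>s n) g) \<longlonglongrightarrow> l"
  shows "(\<lambda>n. \<integral>x. g x * smoothing X (\<delta> n) (\<mu>s n) x \<partial>lborel_on X) \<longlonglongrightarrow> l"
proof -
  obtain B where B: "0 \<le> B" "\<And>x. x \<in> X \<Longrightarrow> \<bar>g x\<bar> \<le> B"
    using continuous_on_compact_bound[OF X(1) g] by blast
  let ?D = "\<lambda>n. (\<integral>x. g x * smoothing X (\<delta> n) (\<mu>s n) x \<partial>lborel_on X) - sintegral X (\<mu>s n) g"
  have "?D \<longlonglongrightarrow> 0"
  proof (rule tendstoI)
    fix e :: real assume e: "0 < e"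
    have "uniformly_continuous_on X g" using g X(1) by (rule compact_uniformly_continuous)
    then obtain d where d: "0 < d" "\<And>x y. x \<in> X \<Longrightarrow> y \<in> X \<Longrightarrow> dist x y < d \<Longrightarrow> \<bar>g x - g y\<bar> < e / 2"
      using e unfolding uniformly_continuous_on_def dist_real_def by (metis dist_commute half_gt_zero)
    have "(\<lambda>n. \<delta> n * B) \<longlonglongrightarrow> 0 * B" by (intro tendsto_intros \<delta>(3))
    then have "eventually (\<lambda>n. \<delta> n * B < e / 2) sequentially" using e by (intro order_tendstoD(2)) auto
    moreover have "eventually (\<lambda>n. \<delta> n < d) sequentially" using \<delta>(3) d(1) by (rule order_tendstoD(2))
    ultimately show "eventually (\<lambda>n. dist (?D n) 0 < e) sequentially"
    proof eventually_elim
      case (elim n)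
      have "\<bar>?D n\<bar> \<le> e / 2 + \<delta> n * B"
        using elim(2) d(2) by (intro smoothing_close[OF X \<mu>s \<delta>(1,2) far g B(2)]) (force intro: less_imp_le)+
      with elim(1) show ?case by simp
    qed
  qed
  from tendsto_add[OF this lim] show ?thesis by simp
qed

section \<open>Couplings with densities\<close>

lemma AE_lebesgue_iff: "(AE x in lebesgue. P x) \<longleftrightarrow> (AE x in lborel. P x)"
  by (rule AE_completion_iff)

text \<open>A Lebesgue measurable function on the product need not have measurable sections everywhere; Fubini's theorem is
  applied to a Borel representative, which agrees with it almost everywhere on almost all sections.\<close>

lemma lebesgue_sections:
  fixes F :: "'a::euclidean_space \<times> 'b::euclidean_space \<Rightarrow> real"
  assumes "integrable lebesgue F"
  obtains f where "f \<in> borel_measurable borel" "integrable lborel f" "AE z in lebesgue. F z = f z"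
    "AE x in lborel. AE y in lborel. F (x, y) = f (x, y)" "AE y in lborel. AE x in lborel. F (x, y) = f (x, y)"
proof -
  have "F \<in> borel_measurable (completion lborel)" using assms by auto
  then obtain f where f: "f \<in> borel_measurable lborel" "AE z in lborel. F z = f z"
    using completion_ex_borel_measurable_real[of F lborel] by auto
  have ae: "AE z in lebesgue. F z = f z" using f(2) by (simp add: AE_lebesgue_iff)
  have "integrable lebesgue f"
    using assms f(1) ae by (subst integrable_cong_AE[of f lebesgue F]) (auto intro: measurable_completion)
  then have int: "integrable lborel f" using f(1) by (simp add: integrable_completion)
  have 1: "AE z in lborel \<Otimes>\<^sub>M lborel. F z = f z" unfolding lborel_prod by (rule f(2))
  have "AE z in distr (lborel \<Otimes>\<^sub>M lborel) (lborel \<Otimes>\<^sub>M lborel) (\<lambda>(y, x). (x, y)). F z = f z"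
    using 1 lborel_pair.distr_pair_swap[where 'a='a and 'b='b] by metis
  then have "AE z in (lborel \<Otimes>\<^sub>M lborel). F ((\<lambda>(y, x). (x, y)) z) = f ((\<lambda>(y, x). (x, y)) z)"
    by (rule AE_distrD[rotated]) measurable
  from lborel_pair.AE_pair[OF this]
  have 2: "AE y in lborel. AE x in lborel. F (x, y) = f (x, y)" by simp
  show thesis
    using that[of f] f(1) int ae lborel_pair.AE_pair[OF 1] 2 by simp
qed

lemma integral_lebesgue_AE_eq:
  fixes F f :: "'a::euclidean_space \<Rightarrow> real"
  assumes "AE x in lborel. F x = f x" "f \<in> borel_measurable borel"
  shows "integral\<^sup>L lebesgue F = integral\<^sup>L lborel f"
proof -
  have ae: "AE x in lebesgue. f x = F x" using assms(1) by (simp add: AE_lebesgue_iff eq_commute)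
  have fm: "f \<in> borel_measurable lebesgue" using assms(2) by (rule borel_in_lebesgue)
  have "integral\<^sup>L lebesgue F = integral\<^sup>L lebesgue f"
    using ae by (intro integral_cong_AE borel_measurable_AE[OF fm ae] fm) (auto simp: eq_commute)
  then show ?thesis using assms(2) by (simp add: integral_completion)
qed

lemma L2_coupling_integrable:
  assumes "compact \<Omega>1" "compact \<Omega>2" "L2_coupling \<Omega>1 \<Omega>2 m1 m2 f"
  shows "set_integrable lebesgue (\<Omega>1 \<times> \<Omega>2) f"
  using assms Lp_on_imp_integrable[of 2 "\<Omega>1 \<times> \<Omega>2" f] lmeasurable_compact[OF compact_Times[OF assms(1,2)]]
  by (simp add: L2_coupling_def)

lemma
  fixes \<Omega>1 :: "'a::euclidean_space set" and \<Omega>2 :: "'b::euclidean_space set"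
  assumes \<Omega>: "compact \<Omega>1" "compact \<Omega>2" and f: "L2_coupling \<Omega>1 \<Omega>2 m1 m2 f"
  shows L2_coupling_fst: "continuous_on \<Omega>1 g \<Longrightarrow> m1 \<in> borel_measurable borel \<Longrightarrow>
      (LINT z:\<Omega>1 \<times> \<Omega>2|lebesgue. g (fst z) * f z) = (\<integral>x. g x * m1 x \<partial>lborel_on \<Omega>1)"
    and L2_coupling_snd: "continuous_on \<Omega>2 h \<Longrightarrow> m2 \<in> borel_measurable borel \<Longrightarrow>
      (LINT z:\<Omega>1 \<times> \<Omega>2|lebesgue. h (snd z) * f z) = (\<integral>y. h y * m2 y \<partial>lborel_on \<Omega>2)"
proof -
  define F where "F z = indicat_real (\<Omega>1 \<times> \<Omega>2) z * f z" for z
  have "integrable lebesgue F"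
    using L2_coupling_integrable[OF \<Omega> f] by (simp add: set_integrable_def F_def[abs_def])
  then obtain f0 where f0 [measurable]: "f0 \<in> borel_measurable borel" and int: "integrable lborel f0"
    and ae: "AE z in lebesgue. F z = f0 z"
    and ae1: "AE x in lborel. AE y in lborel. F (x, y) = f0 (x, y)"
    and ae2: "AE y in lborel. AE x in lborel. F (x, y) = f0 (x, y)"
    by (rule lebesgue_sections) (rule that)
  have f0p [measurable]: "f0 \<in> borel_measurable (lborel \<Otimes>\<^sub>M lborel)" using f0 by (simp add: lborel_prod)
  {
    assume g: "continuous_on \<Omega>1 g" and m1 [measurable]: "m1 \<in> borel_measurable borel"
    obtain B where B: "\<And>x. x \<in> \<Omega>1 \<Longrightarrow> \<bar>g x\<bar> \<le> B" using continuous_on_compact_bound[OF \<Omega>(1) g] by blast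
    define g' where "g' x = indicat_real \<Omega>1 x *\<^sub>R g x" for x
    have g'm [measurable]: "g' \<in> borel_measurable borel"
      unfolding g'_def[abs_def] using borel_measurable_continuous_on_indicator[OF _ g] \<Omega>(1) by (simp add: borel_compact)
    have g'B: "\<bar>g' x\<bar> \<le> \<bar>B\<bar>" for x using B[of x] by (auto simp: g'_def split: split_indicator)
    have "integrable lborel (\<lambda>z. g' (fst z) * f0 z)"
    proof (rule Bochner_Integration.integrable_bound)
      show "integrable lborel (\<lambda>z. \<bar>B\<bar> * f0 z)" using int by simp
      have "(\<lambda>z::'a \<times> 'b. g' (fst z)) \<in> borel_measurable borel"
        by (rule measurable_compose[OF _ g'm]) (intro borel_measurable_continuous_onI continuous_intros)
      then show "(\<lambda>z. g' (fst z) * f0 z) \<in> borel_measurable lborel" using f0 by simp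
      show "AE z in lborel. norm (g' (fst z) * f0 z) \<le> norm (\<bar>B\<bar> * f0 z)"
        using g'B by (intro AE_I2) (auto simp: abs_mult intro: mult_right_mono)
    qed
    then have i: "integrable (lborel \<Otimes>\<^sub>M lborel) (\<lambda>z. g' (fst z) * f0 z)" by (simp add: lborel_prod)
    have "(LINT z:\<Omega>1 \<times> \<Omega>2|lebesgue. g (fst z) * f z) = (\<integral>z. g' (fst z) * F z \<partial>lebesgue)"
      unfolding set_lebesgue_integral_def
      by (intro Bochner_Integration.integral_cong) (auto simp: F_def g'_def split: split_indicator)
    also have "\<dots> = (\<integral>z. g' (fst z) * f0 z \<partial>lborel)"
    proof (rule integral_lebesgue_AE_eq)
      show "AE z in lborel. g' (fst z) * F z = g' (fst z) * f0 z"
        using ae unfolding AE_lebesgue_iff by eventually_elim simp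
      have "(\<lambda>z::'a \<times> 'b. g' (fst z)) \<in> borel_measurable borel"
        by (rule measurable_compose[OF _ g'm]) (intro borel_measurable_continuous_onI continuous_intros)
      then show "(\<lambda>z. g' (fst z) * f0 z) \<in> borel_measurable borel" using f0 by simp
    qed
    also have "\<dots> = (\<integral>x. (\<integral>y. g' (fst (x, y)) * f0 (x, y) \<partial>lborel) \<partial>lborel)"
      using lborel_pair.integral_fst'[OF i] by (simp add: lborel_prod)
    also have "\<dots> = (\<integral>x. g' x * (\<integral>y. f0 (x, y) \<partial>lborel) \<partial>lborel)" by simp
    also have "\<dots> = (\<integral>x. g' x * m1 x \<partial>lborel)"
    proof (rule integral_cong_AE)
      show "(\<lambda>x. g' x * (\<integral>y. f0 (x, y) \<partial>lborel)) \<in> borel_measurable lborel" by measurable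
      show "(\<lambda>x. g' x * m1 x) \<in> borel_measurable lborel" by measurable
      have "AE x in lborel. x \<in> \<Omega>1 \<longrightarrow> (LINT y:\<Omega>2|lebesgue. f (x, y)) = m1 x"
        using f unfolding L2_coupling_def AE_lebesgue_iff by blast
      with ae1 show "AE x in lborel. g' x * (\<integral>y. f0 (x, y) \<partial>lborel) = g' x * m1 x"
      proof eventually_elim
        case (elim x)
        show ?case
        proof (cases "x \<in> \<Omega>1")
          case True
          have "(\<lambda>y. f0 (x, y)) \<in> borel_measurable borel"
            by (rule measurable_compose[OF _ f0]) (intro borel_measurable_continuous_onI continuous_intros)
          then have "(\<integral>y. f0 (x, y) \<partial>lborel) = (\<integral>y. F (x, y) \<partial>lebesgue)"
            using integral_lebesgue_AE_eq[OF elim(1)] by simp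
          also have "\<dots> = (LINT y:\<Omega>2|lebesgue. f (x, y))"
            unfolding set_lebesgue_integral_def using True
            by (intro Bochner_Integration.integral_cong) (auto simp: F_def split: split_indicator)
          finally show ?thesis using elim(2) True by simp
        qed (simp add: g'_def)
      qed
    qed
    also have "\<dots> = (\<integral>x. g x * m1 x \<partial>lborel_on \<Omega>1)"
      unfolding integral_lborel_on[OF \<Omega>(1)] by (simp add: g'_def mult.assoc)
    finally show "(LINT z:\<Omega>1 \<times> \<Omega>2|lebesgue. g (fst z) * f z) = (\<integral>x. g x * m1 x \<partial>lborel_on \<Omega>1)" .
  }
  {
    assume g: "continuous_on \<Omega>2 h" and m2 [measurable]: "m2 \<in> borel_measurable borel"
    obtain B where B: "\<And>x. x \<in> \<Omega>2 \<Longrightarrow> \<bar>h x\<bar> \<le> B" using continuous_on_compact_bound[OF \<Omega>(2) g] by blast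
    define h' where "h' x = indicat_real \<Omega>2 x *\<^sub>R h x" for x
    have h'm [measurable]: "h' \<in> borel_measurable borel"
      unfolding h'_def[abs_def] using borel_measurable_continuous_on_indicator[OF _ g] \<Omega>(2) by (simp add: borel_compact)
    have h'B: "\<bar>h' x\<bar> \<le> \<bar>B\<bar>" for x using B[of x] by (auto simp: h'_def split: split_indicator)
    have h's: "(\<lambda>z::'a \<times> 'b. h' (snd z)) \<in> borel_measurable borel"
      by (rule measurable_compose[OF _ h'm]) (intro borel_measurable_continuous_onI continuous_intros)
    have "integrable lborel (\<lambda>z. h' (snd z) * f0 z)"
    proof (rule Bochner_Integration.integrable_bound)
      show "integrable lborel (\<lambda>z. \<bar>B\<bar> * f0 z)" using int by simp
      show "(\<lambda>z. h' (snd z) * f0 z) \<in> borel_measurable lborel" using f0 h's by simp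
      show "AE z in lborel. norm (h' (snd z) * f0 z) \<le> norm (\<bar>B\<bar> * f0 z)"
        using h'B by (intro AE_I2) (auto simp: abs_mult intro: mult_right_mono)
    qed
    then have i: "integrable (lborel \<Otimes>\<^sub>M lborel) (\<lambda>(x, y). h' y * f0 (x, y))"
      by (simp add: lborel_prod case_prod_beta')
    have "(LINT z:\<Omega>1 \<times> \<Omega>2|lebesgue. h (snd z) * f z) = (\<integral>z. h' (snd z) * F z \<partial>lebesgue)"
      unfolding set_lebesgue_integral_def
      by (intro Bochner_Integration.integral_cong) (auto simp: F_def h'_def split: split_indicator)
    also have "\<dots> = (\<integral>z. h' (snd z) * f0 z \<partial>lborel)"
    proof (rule integral_lebesgue_AE_eq)
      show "AE z in lborel. h' (snd z) * F z = h' (snd z) * f0 z"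
        using ae unfolding AE_lebesgue_iff by eventually_elim simp
      show "(\<lambda>z. h' (snd z) * f0 z) \<in> borel_measurable borel" using f0 h's by simp
    qed
    also have "\<dots> = (\<integral>y. (\<integral>x. h' y * f0 (x, y) \<partial>lborel) \<partial>lborel)"
      using lborel_pair.integral_snd[OF i] by (simp add: lborel_prod case_prod_beta')
    also have "\<dots> = (\<integral>y. h' y * (\<integral>x. f0 (x, y) \<partial>lborel) \<partial>lborel)" by simp
    also have "\<dots> = (\<integral>y. h' y * m2 y \<partial>lborel)"
    proof (rule integral_cong_AE)
      have "(\<lambda>(y, x). f0 (x, y)) \<in> borel_measurable (lborel \<Otimes>\<^sub>M lborel)"
        by measurable
      then have "(\<lambda>y. \<integral>x. f0 (x, y) \<partial>lborel) \<in> borel_measurable lborel"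
        by (rule lborel.borel_measurable_lebesgue_integral)
      then show "(\<lambda>y. h' y * (\<integral>x. f0 (x, y) \<partial>lborel)) \<in> borel_measurable lborel" by simp
      show "(\<lambda>y. h' y * m2 y) \<in> borel_measurable lborel" by measurable
      have "AE y in lborel. y \<in> \<Omega>2 \<longrightarrow> (LINT x:\<Omega>1|lebesgue. f (x, y)) = m2 y"
        using f unfolding L2_coupling_def AE_lebesgue_iff by blast
      with ae2 show "AE y in lborel. h' y * (\<integral>x. f0 (x, y) \<partial>lborel) = h' y * m2 y"
      proof eventually_elim
        case (elim y)
        show ?case
        proof (cases "y \<in> \<Omega>2")
          case True
          have "(\<lambda>x. f0 (x, y)) \<in> borel_measurable borel"
            by (rule measurable_compose[OF _ f0]) (intro borel_measurable_continuous_onI continuous_intros)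
          then have "(\<integral>x. f0 (x, y) \<partial>lborel) = (\<integral>x. F (x, y) \<partial>lebesgue)"
            using integral_lebesgue_AE_eq[OF elim(1)] by simp
          also have "\<dots> = (LINT x:\<Omega>1|lebesgue. f (x, y))"
            unfolding set_lebesgue_integral_def using True
            by (intro Bochner_Integration.integral_cong) (auto simp: F_def split: split_indicator)
          finally show ?thesis using elim(2) True by simp
        qed (simp add: h'_def)
      qed
    qed
    also have "\<dots> = (\<integral>y. h y * m2 y \<partial>lborel_on \<Omega>2)"
      unfolding integral_lborel_on[OF \<Omega>(2)] by (simp add: h'_def mult.assoc)
    finally show "(LINT z:\<Omega>1 \<times> \<Omega>2|lebesgue. h (snd z) * f z) = (\<integral>y. h y * m2 y \<partial>lborel_on \<Omega>2)" .
  }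
qed

lemma set_integral_Times:
  fixes \<Omega>1 :: "'a::euclidean_space set" and \<Omega>2 :: "'b::euclidean_space set"
    and h :: "'a \<times> 'b \<Rightarrow> real"
  assumes \<Omega>: "compact \<Omega>1" "compact \<Omega>2" and h: "h \<in> borel_measurable borel"
    and B: "\<And>x y. x \<in> \<Omega>1 \<Longrightarrow> y \<in> \<Omega>2 \<Longrightarrow> \<bar>h (x, y)\<bar> \<le> B"
  shows "(LINT z:\<Omega>1 \<times> \<Omega>2|lebesgue. h z) = (\<integral>x. (\<integral>y. h (x, y) \<partial>lborel_on \<Omega>2) \<partial>lborel_on \<Omega>1)"
proof -
  let ?O = "\<Omega>1 \<times> \<Omega>2"
  have O: "compact ?O" using \<Omega> by (rule compact_Times)
  have Ob: "?O \<in> sets borel" using O by (rule borel_compact)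
  have "integrable lborel (\<lambda>z. indicat_real ?O z * h z)"
  proof (rule Bochner_Integration.integrable_bound)
    show "integrable lborel (\<lambda>z. B * indicat_real ?O z)"
      using Ob emeasure_compact_finite[OF O] by (intro integrable_mult_right integrable_real_indicator) auto
    show "(\<lambda>z. indicat_real ?O z * h z) \<in> borel_measurable lborel" using h Ob by simp
    show "AE z in lborel. norm (indicat_real ?O z * h z) \<le> norm (B * indicat_real ?O z)"
    proof (rule AE_I2)
      fix z :: "'a \<times> 'b"
      show "norm (indicat_real ?O z * h z) \<le> norm (B * indicat_real ?O z)"
        using B[of "fst z" "snd z"] by (cases "z \<in> ?O") (auto simp: mem_Times_iff)
    qed
  qed
  then have i: "integrable (lborel \<Otimes>\<^sub>M lborel) (\<lambda>z. indicat_real ?O z * h z)" by (simp add: lborel_prod)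
  have "(LINT z:?O|lebesgue. h z) = (\<integral>z. indicat_real ?O z * h z \<partial>lborel)"
    unfolding set_lebesgue_integral_def using h Ob by (subst integral_completion) auto
  also have "\<dots> = (\<integral>x. (\<integral>y. indicat_real ?O (x, y) * h (x, y) \<partial>lborel) \<partial>lborel)"
    using lborel_pair.integral_fst'[OF i] by (simp add: lborel_prod)
  also have "\<dots> = (\<integral>x. indicat_real \<Omega>1 x * (\<integral>y. indicat_real \<Omega>2 y * h (x, y) \<partial>lborel) \<partial>lborel)"
    by (simp add: indicator_times mult.assoc)
  finally show ?thesis unfolding integral_lborel_on[OF \<Omega>(1)] integral_lborel_on[OF \<Omega>(2)] .
qed

lemma bounded_integrable_lborel_on:
  fixes f :: "'a::euclidean_space \<Rightarrow> real"
  assumes "compact S" "f \<in> borel_measurable borel" "\<And>x. x \<in> S \<Longrightarrow> \<bar>f x\<bar> \<le> K"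
  shows "integrable (lborel_on S) f"
proof (rule finite_measure.integrable_const_bound[OF finite_lborel_on[OF assms(1)]])
  show "f \<in> borel_measurable (lborel_on S)" using assms(2) by (intro measurable_restrict_space1) simp
  show "AE x in lborel_on S. norm (f x) \<le> K" using assms(3) by (intro AE_I2) simp
qed

lemma borel_fst: "f \<in> borel_measurable borel \<Longrightarrow> (\<lambda>z::'a::euclidean_space \<times> 'b::euclidean_space. f (fst z)) \<in> borel_measurable borel"
  by (rule measurable_compose[of fst borel borel]) (intro borel_measurable_continuous_onI continuous_intros)

lemma borel_snd: "f \<in> borel_measurable borel \<Longrightarrow> (\<lambda>z::'a::euclidean_space \<times> 'b::euclidean_space. f (snd z)) \<in> borel_measurable borel"
  by (rule measurable_compose[of snd borel borel]) (intro borel_measurable_continuous_onI continuous_intros)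

lemma borel_section1:
  fixes h :: "'a::euclidean_space \<times> 'b::euclidean_space \<Rightarrow> real"
  shows "h \<in> borel_measurable borel \<Longrightarrow> (\<lambda>y. h (x, y)) \<in> borel_measurable borel"
  by (rule measurable_compose[of "\<lambda>y. (x, y)" borel borel]) (intro borel_measurable_continuous_onI continuous_intros)

lemma borel_section2:
  fixes h :: "'a::euclidean_space \<times> 'b::euclidean_space \<Rightarrow> real"
  shows "h \<in> borel_measurable borel \<Longrightarrow> (\<lambda>x. h (x, y)) \<in> borel_measurable borel"
  by (rule measurable_compose[of "\<lambda>x. (x, y)" borel borel]) (intro borel_measurable_continuous_onI continuous_intros)

text \<open>Coupling of two densities that are cut into blocks with masses \<open>A j\<close> and \<open>B j\<close>: a fraction of
  the second block is spread over the first one as a product density.  What is left of the first density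
  has mass \<open>(1 - s) * M\<close> and is coupled to a multiple of the whole second density, of which just the
  fraction \<open>1 - s\<close> is missing.  The number \<open>D j\<close> bounds the cost of the \<open>j\<close>-th block seen from any point of the
  first one.\<close>

lemma block_coupling:
  fixes \<Omega>1 :: "'a::euclidean_space set" and \<Omega>2 :: "'b::euclidean_space set"
    and p :: "'j \<Rightarrow> 'a \<Rightarrow> real" and q :: "'j \<Rightarrow> 'b \<Rightarrow> real" and c :: "'a \<times> 'b \<Rightarrow> real"
  assumes \<Omega>: "compact \<Omega>1" "compact \<Omega>2" and J: "finite J"
    and p: "\<And>j. p j \<in> borel_measurable borel" "\<And>j x. 0 \<le> p j x"
    and q: "\<And>j. q j \<in> borel_measurable borel" "\<And>j y. 0 \<le> q j y"
    and m1: "\<And>x. x \<in> \<Omega>1 \<Longrightarrow> m1 x = (\<Sum>j\<in>J. p j x)" "\<And>x. x \<in> \<Omega>1 \<Longrightarrow> m1 x \<le> K"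
    and m2: "\<And>y. y \<in> \<Omega>2 \<Longrightarrow> m2 y = (\<Sum>j\<in>J. q j y)"
    and A: "\<And>j. A j = (\<integral>x. p j x \<partial>lborel_on \<Omega>1)" and B: "\<And>j. B j = (\<integral>y. q j y \<partial>lborel_on \<Omega>2)"
    and qB: "\<And>j y. j \<in> J \<Longrightarrow> y \<in> \<Omega>2 \<Longrightarrow> q j y \<le> \<kappa> * B j" and K: "0 \<le> K" "0 \<le> \<kappa>"
    and s: "0 < s" "s \<le> 1" "\<And>j. j \<in> J \<Longrightarrow> s * B j \<le> A j"
    and M: "(\<Sum>j\<in>J. A j) = M" "(\<Sum>j\<in>J. B j) = M" "0 < M"
    and c: "c \<in> borel_measurable borel" "\<And>z. \<bar>c z\<bar> \<le> C"
    and D: "\<And>j x. j \<in> J \<Longrightarrow> x \<in> \<Omega>1 \<Longrightarrow> p j x \<noteq> 0 \<Longrightarrow> (\<integral>y. c (x, y) * q j y \<partial>lborel_on \<Omega>2) \<le> D j"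
    and D0: "\<And>j. j \<in> J \<Longrightarrow> A j = 0 \<Longrightarrow> D j = 0"
  obtains \<theta> where "L2_coupling \<Omega>1 \<Omega>2 m1 m2 \<theta>" "\<theta> \<in> borel_measurable borel" "\<And>z. 0 \<le> \<theta> z"
    "\<And>x y. x \<in> \<Omega>1 \<Longrightarrow> y \<in> \<Omega>2 \<Longrightarrow> \<theta> (x, y) \<le> (real (card J) + 1) * (K * \<kappa>)"
    "(LINT z:\<Omega>1 \<times> \<Omega>2|lebesgue. c z * \<theta> z) \<le> s * (\<Sum>j\<in>J. D j) + C * ((1 - s) * M)"
proof -
  let ?L1 = "lborel_on \<Omega>1" and ?L2 = "lborel_on \<Omega>2"
  have A0: "0 \<le> A j" and B0: "0 \<le> B j" for j
    unfolding A B using p q by (auto intro!: integral_nonneg_AE AE_I2)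
  have AB: "B j = 0" if "j \<in> J" "A j = 0" for j
    using s(3)[OF that(1)] that(2) B0[of j] s(1) by (simp add: mult_le_0_iff)
  \<comment> \<open>The fraction of the first block that the second one leaves free; an empty first block forces an empty
    second one, so that the junk value of the division is harmless.\<close>
  define k where "k j = 1 - s * (B j / A j)" for j
  have k: "0 \<le> k j" "k j \<le> 1" if "j \<in> J" for j
    using s(1) s(3)[OF that] A0[of j] B0[of j] by (auto simp: k_def divide_le_eq)
  define r where "r x = (\<Sum>j\<in>J. k j * p j x)" for x
  define m where "m y = (\<Sum>j\<in>J. q j y)" for y
  define \<theta>' where "\<theta>' x y = s * (\<Sum>j\<in>J. p j x * q j y / A j) + r x * m y / M" for x y
  define \<theta> where "\<theta> z = \<theta>' (fst z) (snd z)" for z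
  have pK: "p j x \<le> K" if "j \<in> J" "x \<in> \<Omega>1" for j x
  proof -
    have "p j x \<le> (\<Sum>j\<in>J. p j x)" using that(1) J p(2) by (intro member_le_sum) auto
    then show ?thesis using m1[OF that(2)] by simp
  qed
  have r: "0 \<le> r x" for x unfolding r_def using k p(2) by (intro sum_nonneg) simp
  have rK: "r x \<le> K" if "x \<in> \<Omega>1" for x
  proof -
    have "r x \<le> (\<Sum>j\<in>J. 1 * p j x)" unfolding r_def using k p(2) by (intro sum_mono mult_right_mono)
    then show ?thesis using m1[OF that] by simp
  qed
  have m0: "0 \<le> m y" for y unfolding m_def using q(2) by (intro sum_nonneg)
  have mM: "m y \<le> \<kappa> * M" if "y \<in> \<Omega>2" for y
    unfolding m_def M(2)[symmetric] sum_distrib_left using that by (intro sum_mono qB)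
  have pi: "integrable ?L1 (p j)" if "j \<in> J" for j
    using pK[OF that] p by (intro bounded_integrable_lborel_on[OF \<Omega>(1), of _ K]) auto
  have qi: "integrable ?L2 (q j)" if "j \<in> J" for j
    using qB[OF that] q by (intro bounded_integrable_lborel_on[OF \<Omega>(2), of _ "\<kappa> * B j"]) auto
  have rm: "r \<in> borel_measurable borel" and mm: "m \<in> borel_measurable borel"
    unfolding r_def[abs_def] m_def[abs_def] using p q by auto
  have ri: "integrable ?L1 r" using rm rK r by (intro bounded_integrable_lborel_on[OF \<Omega>(1), of _ K]) auto
  have mi: "integrable ?L2 m" using mm mM m0 by (intro bounded_integrable_lborel_on[OF \<Omega>(2), of _ "\<kappa> * M"]) auto
  have mint: "(\<integral>y. m y \<partial>?L2) = M"
    unfolding m_def using qi M(2) B by (simp add: Bochner_Integration.integral_sum)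
  have kA: "k j * A j = A j - s * B j" if "j \<in> J" for j
    using AB[OF that] by (cases "A j = 0") (auto simp: k_def left_diff_distrib)
  have rint: "(\<integral>x. r x \<partial>?L1) = (1 - s) * M"
  proof -
    have "(\<integral>x. r x \<partial>?L1) = (\<Sum>j\<in>J. k j * A j)"
      unfolding r_def using pi A by (simp add: Bochner_Integration.integral_sum)
    also have "\<dots> = (\<Sum>j\<in>J. A j - s * B j)" by (intro sum.cong refl kA)
    also have "\<dots> = (1 - s) * M" using M by (simp add: sum_subtractf sum_distrib_left[symmetric] left_diff_distrib)
    finally show ?thesis .
  qed
  have \<theta>m: "\<theta> \<in> borel_measurable borel"
    unfolding \<theta>_def[abs_def] \<theta>'_def
    by (intro borel_measurable_add borel_measurable_times borel_measurable_const borel_measurable_sum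
        borel_measurable_divide borel_fst borel_snd p(1) q(1) rm mm)
  have \<theta>0: "0 \<le> \<theta> z" for z
    unfolding \<theta>_def \<theta>'_def using s p q A0 r m0 M(3)
    by (intro add_nonneg_nonneg mult_nonneg_nonneg sum_nonneg divide_nonneg_nonneg) auto
  have \<theta>K: "\<theta> (x, y) \<le> (real (card J) + 1) * (K * \<kappa>)" if x: "x \<in> \<Omega>1" and y: "y \<in> \<Omega>2" for x y
  proof -
    have "s * (p j x * q j y / A j) \<le> K * \<kappa>" if j: "j \<in> J" for j
    proof (cases "A j = 0")
      case False
      then have Aj: "0 < A j" using A0[of j] by simp
      have "p j x * (s * q j y) \<le> K * (s * (\<kappa> * B j))"
        using pK[OF j x] qB[OF j y] p q K s(1) by (intro mult_mono) auto
      also have "\<dots> = (K * \<kappa>) * (s * B j)" by simp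
      also have "\<dots> \<le> (K * \<kappa>) * A j" using s(3)[OF j] K by (intro mult_left_mono) auto
      finally show ?thesis using Aj by (simp add: divide_le_eq mult_ac)
    qed (use K in simp)
    then have "(\<Sum>j\<in>J. s * (p j x * q j y / A j)) \<le> (\<Sum>j\<in>J. K * \<kappa>)" by (rule sum_mono)
    moreover have "r x * m y / M \<le> K * \<kappa>"
    proof -
      have "r x * m y \<le> K * (\<kappa> * M)" using rK[OF x] mM[OF y] r m0 K by (intro mult_mono) auto
      then show ?thesis using M(3) by (simp add: divide_le_eq mult_ac)
    qed
    ultimately show ?thesis by (simp add: \<theta>_def \<theta>'_def sum_distrib_left distrib_right)
  qed
  let ?N = "(real (card J) + 1) * (K * \<kappa>)"
  have O: "compact (\<Omega>1 \<times> \<Omega>2)" using \<Omega> by (rule compact_Times)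
  have \<theta>z: "\<theta> z \<le> ?N" if "z \<in> \<Omega>1 \<times> \<Omega>2" for z using \<theta>K[of "fst z" "snd z"] that by (auto simp: mem_Times_iff)
  have "L2_coupling \<Omega>1 \<Omega>2 m1 m2 \<theta>"
    unfolding L2_coupling_def
  proof (intro conjI AE_I2 impI)
    have Ob: "\<Omega>1 \<times> \<Omega>2 \<in> sets lebesgue" using O by (intro fmeasurableD lmeasurable_compact)
    have bm: "set_borel_measurable lebesgue (\<Omega>1 \<times> \<Omega>2) h" if "h \<in> borel_measurable borel" for h :: "'a \<times> 'b \<Rightarrow> real"
      unfolding set_borel_measurable_def
      by (intro borel_measurable_scaleR borel_measurable_indicator Ob borel_in_lebesgue that)
    show "Lp_on 2 (\<Omega>1 \<times> \<Omega>2) \<theta>"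
      unfolding Lp_on_def
    proof
      show "set_borel_measurable lebesgue (\<Omega>1 \<times> \<Omega>2) \<theta>" by (rule bm[OF \<theta>m])
      show "set_integrable lebesgue (\<Omega>1 \<times> \<Omega>2) (\<lambda>z. \<bar>\<theta> z\<bar> powr 2)"
      proof (rule set_integrable_bound)
        show "set_integrable lebesgue (\<Omega>1 \<times> \<Omega>2) (\<lambda>_. ?N powr 2)"
          using lmeasurable_compact[OF O] unfolding set_integrable_def
          by (intro integrable_scaleR_left integrable_real_indicator) (auto simp: fmeasurable_def)
        show "set_borel_measurable lebesgue (\<Omega>1 \<times> \<Omega>2) (\<lambda>z. \<bar>\<theta> z\<bar> powr 2)"
          using \<theta>m by (intro bm) simp
        show "AE z in lebesgue. z \<in> \<Omega>1 \<times> \<Omega>2 \<longrightarrow> norm (\<bar>\<theta> z\<bar> powr 2) \<le> norm (?N powr 2)"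
        proof (intro AE_I2 impI)
          fix z assume "z \<in> \<Omega>1 \<times> \<Omega>2"
          then have "\<bar>\<theta> z\<bar> \<le> ?N" using \<theta>z[of z] \<theta>0[of z] by simp
          then show "norm (\<bar>\<theta> z\<bar> powr 2) \<le> norm (?N powr 2)"
            unfolding real_norm_def abs_of_nonneg[OF powr_ge_zero] by (intro powr_mono2) simp_all
        qed
      qed
    qed
    show "0 \<le> \<theta> z" for z by (rule \<theta>0)
    show "(LINT y:\<Omega>2|lebesgue. \<theta> (x, y)) = m1 x" if x: "x \<in> \<Omega>1" for x
    proof -
      have "(\<lambda>y. \<theta> (x, y)) \<in> borel_measurable ?L2"
        using borel_section1[OF \<theta>m] by (intro measurable_restrict_space1) simp
      then have "(LINT y:\<Omega>2|lebesgue. \<theta> (x, y)) = (\<integral>y. \<theta> (x, y) \<partial>?L2)"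
        by (rule set_integral_lebesgue_eq[OF \<Omega>(2)])
      also have "\<dots> = (\<integral>y. (\<Sum>j\<in>J. (s * p j x / A j) * q j y) + (r x / M) * m y \<partial>?L2)"
        by (simp add: \<theta>_def \<theta>'_def sum_distrib_left mult_ac)
      also have "\<dots> = (\<Sum>j\<in>J. (s * p j x / A j) * B j) + (r x / M) * M"
        using qi mi mint B by (simp add: Bochner_Integration.integral_sum)
      also have "\<dots> = (\<Sum>j\<in>J. (s * p j x / A j) * B j) + r x" using M(3) by simp
      also have "\<dots> = (\<Sum>j\<in>J. p j x)"
        unfolding r_def sum.distrib[symmetric] by (intro sum.cong refl) (simp add: k_def algebra_simps)
      finally show ?thesis using m1[OF x] by simp
    qed
    show "(LINT x:\<Omega>1|lebesgue. \<theta> (x, y)) = m2 y" if y: "y \<in> \<Omega>2" for y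
    proof -
      have "(\<lambda>x. \<theta> (x, y)) \<in> borel_measurable ?L1"
        using borel_section2[OF \<theta>m] by (intro measurable_restrict_space1) simp
      then have "(LINT x:\<Omega>1|lebesgue. \<theta> (x, y)) = (\<integral>x. \<theta> (x, y) \<partial>?L1)"
        by (rule set_integral_lebesgue_eq[OF \<Omega>(1)])
      also have "\<dots> = (\<integral>x. (\<Sum>j\<in>J. (s * q j y / A j) * p j x) + (m y / M) * r x \<partial>?L1)"
        by (simp add: \<theta>_def \<theta>'_def sum_distrib_left mult_ac)
      also have "\<dots> = (\<Sum>j\<in>J. (s * q j y / A j) * A j) + (m y / M) * ((1 - s) * M)"
        using pi ri rint A by (simp add: Bochner_Integration.integral_sum)
      also have "(\<Sum>j\<in>J. (s * q j y / A j) * A j) = (\<Sum>j\<in>J. s * q j y)"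
      proof (intro sum.cong refl)
        fix j assume j: "j \<in> J"
        have "q j y = 0" if "A j = 0" using qB[OF j y] AB[OF j that] q(2)[of j y] by simp
        then show "(s * q j y / A j) * A j = s * q j y" by (cases "A j = 0") auto
      qed
      also have "\<dots> = s * m y" by (simp add: m_def sum_distrib_left)
      also have "(m y / M) * ((1 - s) * M) = (1 - s) * m y" using M(3) by simp
      also have "s * m y + (1 - s) * m y = m y" by (simp add: algebra_simps)
      finally show ?thesis using m2[OF y] by (simp add: m_def)
    qed
  qed
  moreover have "(LINT z:\<Omega>1 \<times> \<Omega>2|lebesgue. c z * \<theta> z) \<le> s * (\<Sum>j\<in>J. D j) + C * ((1 - s) * M)"
  proof -
    have C0: "0 \<le> C" using c(2)[of undefined] by linarith
    have ctm: "(\<lambda>z. c z * \<theta> z) \<in> borel_measurable borel" using c(1) \<theta>m by simp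
    have ctb: "\<bar>c (x, y) * \<theta> (x, y)\<bar> \<le> C * ?N" if "x \<in> \<Omega>1" "y \<in> \<Omega>2" for x y
      unfolding abs_mult using c(2)[of "(x, y)"] \<theta>0[of "(x, y)"] \<theta>K[OF that] C0 by (intro mult_mono) auto
    let ?I = "\<lambda>x. \<integral>y. c (x, y) * \<theta> (x, y) \<partial>?L2"
    have eq: "(LINT z:\<Omega>1 \<times> \<Omega>2|lebesgue. c z * \<theta> z) = (\<integral>x. ?I x \<partial>?L1)"
      by (rule set_integral_Times[OF \<Omega> ctm ctb])
    have cb: "(\<lambda>y. c (x, y)) \<in> borel_measurable borel" for x by (rule borel_section1[OF c(1)])
    have cqi: "integrable ?L2 (\<lambda>y. c (x, y) * q j y)" if "j \<in> J" for x j
    proof (rule bounded_integrable_lborel_on[OF \<Omega>(2)])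
      show "(\<lambda>y. c (x, y) * q j y) \<in> borel_measurable borel" using cb q(1) by simp
      show "\<bar>c (x, y) * q j y\<bar> \<le> C * (\<kappa> * B j)" if "y \<in> \<Omega>2" for y
        unfolding abs_mult using c(2)[of "(x, y)"] q(2)[of j y] qB[OF \<open>j \<in> J\<close> that] C0 by (intro mult_mono) auto
    qed
    have cmi: "integrable ?L2 (\<lambda>y. c (x, y) * m y)" for x
    proof (rule bounded_integrable_lborel_on[OF \<Omega>(2)])
      show "(\<lambda>y. c (x, y) * m y) \<in> borel_measurable borel" using cb mm by simp
      show "\<bar>c (x, y) * m y\<bar> \<le> C * (\<kappa> * M)" if "y \<in> \<Omega>2" for y
        unfolding abs_mult using c(2)[of "(x, y)"] m0[of y] mM[OF that] C0 by (intro mult_mono) auto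
    qed
    have Ile: "?I x \<le> (\<Sum>j\<in>J. (s * D j / A j) * p j x) + C * r x" if x: "x \<in> \<Omega>1" for x
    proof -
      have "?I x = (\<integral>y. (\<Sum>j\<in>J. (s * p j x / A j) * (c (x, y) * q j y)) + (r x / M) * (c (x, y) * m y) \<partial>?L2)"
        by (simp add: \<theta>_def \<theta>'_def distrib_left sum_distrib_left mult_ac)
      also have "\<dots> = (\<Sum>j\<in>J. (s * p j x / A j) * (\<integral>y. c (x, y) * q j y \<partial>?L2)) + (r x / M) * (\<integral>y. c (x, y) * m y \<partial>?L2)"
        using cqi cmi by (simp add: Bochner_Integration.integral_sum)
      also have "\<dots> \<le> (\<Sum>j\<in>J. (s * D j / A j) * p j x) + C * r x"
      proof (intro add_mono sum_mono)
        fix j assume j: "j \<in> J"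
        show "(s * p j x / A j) * (\<integral>y. c (x, y) * q j y \<partial>?L2) \<le> (s * D j / A j) * p j x"
        proof (cases "p j x = 0")
          case False
          have "(s * p j x / A j) * (\<integral>y. c (x, y) * q j y \<partial>?L2) \<le> (s * p j x / A j) * D j"
            using D[OF j x False] s(1) p(2)[of j x] A0[of j] by (intro mult_left_mono) auto
          then show ?thesis by (simp add: mult_ac)
        qed simp
      next
        have "(\<integral>y. c (x, y) * m y \<partial>?L2) \<le> (\<integral>y. C * m y \<partial>?L2)"
          using cmi mi c(2) m0 by (intro integral_mono mult_right_mono integrable_mult_right) (auto simp: abs_le_iff)
        then have "(r x / M) * (\<integral>y. c (x, y) * m y \<partial>?L2) \<le> (r x / M) * (C * M)"
          using r[of x] M(3) mint by (intro mult_left_mono) auto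
        then show "(r x / M) * (\<integral>y. c (x, y) * m y \<partial>?L2) \<le> C * r x" using M(3) by (simp add: mult_ac)
      qed
      finally show ?thesis .
    qed
    have Ii: "integrable ?L1 ?I"
    proof (rule finite_measure.integrable_const_bound[OF finite_lborel_on[OF \<Omega>(1)]])
      interpret L2: finite_measure ?L2 by (rule finite_lborel_on[OF \<Omega>(2)])
      have "(\<lambda>(x, y). (x, y)) \<in> measurable (?L1 \<Otimes>\<^sub>M ?L2) (borel \<Otimes>\<^sub>M borel)"
      proof -
        have "(\<lambda>x. x) \<in> measurable ?L1 borel" "(\<lambda>y. y) \<in> measurable ?L2 borel" by (intro measurable_restrict_space1; simp)+
        note [measurable] = this
        show ?thesis by measurable
      qed
      then have "(\<lambda>(x, y). c (x, y) * \<theta> (x, y)) \<in> borel_measurable (?L1 \<Otimes>\<^sub>M ?L2)"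
        using measurable_compose[of "\<lambda>(x, y). (x, y)" _ borel "\<lambda>z. c z * \<theta> z" borel] ctm
        by (simp add: borel_prod case_prod_beta')
      then show "?I \<in> borel_measurable ?L1" by (rule L2.borel_measurable_lebesgue_integral)
      have "\<bar>?I x\<bar> \<le> C * ?N * measure ?L2 \<Omega>2" if "x \<in> \<Omega>1" for x
      proof -
        have i: "integrable ?L2 (\<lambda>y. c (x, y) * \<theta> (x, y))"
          using ctb[OF that] borel_section1[OF ctm] by (intro bounded_integrable_lborel_on[OF \<Omega>(2)])
        have "\<bar>?I x\<bar> \<le> (\<integral>y. \<bar>c (x, y) * \<theta> (x, y)\<bar> \<partial>?L2)" by (rule integral_abs_bound)
        also have "\<dots> \<le> (\<integral>y. C * ?N \<partial>?L2)"
          using ctb[OF that] i by (intro integral_mono integrable_abs L2.integrable_const) auto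
        finally show ?thesis by (simp add: mult_ac)
      qed
      then show "AE x in ?L1. norm (?I x) \<le> C * ?N * measure ?L2 \<Omega>2" by (intro AE_I2) simp
    qed
    have "(\<integral>x. ?I x \<partial>?L1) \<le> (\<integral>x. (\<Sum>j\<in>J. (s * D j / A j) * p j x) + C * r x \<partial>?L1)"
      using Ile Ii pi ri by (intro integral_mono) auto
    also have "\<dots> = (\<Sum>j\<in>J. (s * D j / A j) * A j) + C * ((1 - s) * M)"
      using pi ri rint A by (simp add: Bochner_Integration.integral_sum)
    also have "(\<Sum>j\<in>J. (s * D j / A j) * A j) = (\<Sum>j\<in>J. s * D j)"
      by (intro sum.cong refl) (use D0 in auto)
    finally show ?thesis unfolding eq by (simp add: sum_distrib_left)
  qed
  ultimately show thesis using that[of \<theta>] \<theta>m \<theta>0 \<theta>K by blast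
qed

section \<open>Recovery sequence\<close>

lemma distr_pushforward:
  fixes X :: "'a::metric_space set" and Y :: "'b::metric_space set"
  assumes \<phi>: "ctbl_add X \<phi>" "\<And>A. 0 \<le> \<phi> A" and \<mu>: "ctbl_add Y \<mu>" "\<And>A. 0 \<le> \<mu> A"
    and h: "continuous_on X h" "h ` X \<subseteq> Y" and eq: "pushforward X Y h \<phi> = \<mu>"
  shows "h \<in> measurable (measure_on X \<phi>) (restrict_space borel Y)"
    and "distr (measure_on X \<phi>) (restrict_space borel Y) h = measure_on Y \<mu>"
proof -
  let ?Q = "measure_on X \<phi>"
  show hm: "h \<in> measurable ?Q (restrict_space borel Y)"
    using h by (intro measurable_restrict_space2 continuous_on_measurable) auto
  show "distr ?Q (restrict_space borel Y) h = measure_on Y \<mu>"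
  proof (rule measure_eqI)
    fix B assume "B \<in> sets (distr ?Q (restrict_space borel Y) h)"
    then have B: "B \<in> borel_sets_on Y" by simp
    have "emeasure (distr ?Q (restrict_space borel Y) h) B = emeasure ?Q (h -` B \<inter> X)"
      using B by (subst emeasure_distr[OF hm]) auto
    also have "\<dots> = ennreal (\<phi> (h -` B \<inter> X))"
      using measurable_sets[OF hm B] by (intro emeasure_measure_on \<phi>) simp
    also have "\<phi> (h -` B \<inter> X) = \<mu> B" using fun_cong[OF eq, of B] B by (simp add: pushforward_def)
    also have "ennreal (\<mu> B) = emeasure (measure_on Y \<mu>) B"
      by (rule emeasure_measure_on[OF \<mu> B, symmetric])
    finally show "emeasure (distr ?Q (restrict_space borel Y) h) B = emeasure (measure_on Y \<mu>) B" .
  qed simp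
qed

lemma partition_of_unity:
  fixes S :: "'a::euclidean_space set"
  assumes "compact S" "0 < d"
  obtains F and \<psi> :: "'a \<Rightarrow> 'a \<Rightarrow> real" where "finite F"
    "\<And>j. \<psi> j \<in> borel_measurable borel" "\<And>j. continuous_on S (\<psi> j)" "\<And>j x. 0 \<le> \<psi> j x"
    "\<And>j x. j \<in> F \<Longrightarrow> \<psi> j x \<le> 1" "\<And>x. x \<in> S \<Longrightarrow> (\<Sum>j\<in>F. \<psi> j x) = 1" "\<And>j x. \<psi> j x \<noteq> 0 \<Longrightarrow> dist x j < d"
proof -
  have "S \<subseteq> (\<Union>x\<in>S. ball x d)" using assms(2) by auto
  then obtain F where F: "F \<subseteq> S" "finite F" "S \<subseteq> (\<Union>x\<in>F. ball x d)"
    using compactE_image[OF assms(1), of S "\<lambda>x. ball x d"] by auto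
  define \<zeta> where "\<zeta> j x = max 0 (d - dist x j)" for j x :: 'a
  define Z where "Z x = (\<Sum>j\<in>F. \<zeta> j x)" for x
  have \<zeta>0: "0 \<le> \<zeta> j x" for j x by (simp add: \<zeta>_def)
  have Z0: "0 \<le> Z x" for x unfolding Z_def by (intro sum_nonneg \<zeta>0)
  have Zpos: "0 < Z x" if "x \<in> S" for x
  proof -
    obtain j where j: "j \<in> F" "dist j x < d" using F(3) \<open>x \<in> S\<close> by auto
    then have "0 < \<zeta> j x" by (simp add: \<zeta>_def dist_commute)
    then show ?thesis unfolding Z_def using j(1) F(2) \<zeta>0 by (intro sum_pos2) auto
  qed
  have \<zeta>c: "continuous_on T (\<zeta> j)" for T j unfolding \<zeta>_def by (intro continuous_intros)
  have Zc: "continuous_on T Z" for T unfolding Z_def by (intro continuous_intros \<zeta>c)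
  define \<psi> where "\<psi> j x = \<zeta> j x / Z x" for j x
  show thesis
  proof (rule that[of F \<psi>])
    show "\<psi> j \<in> borel_measurable borel" for j
      unfolding \<psi>_def by (intro borel_measurable_divide borel_measurable_continuous_onI \<zeta>c Zc)
    show "continuous_on S (\<psi> j)" for j
      unfolding \<psi>_def using Zpos by (intro continuous_on_divide \<zeta>c Zc) force
    show "0 \<le> \<psi> j x" for j x using \<zeta>0 Z0 by (simp add: \<psi>_def)
    show "\<psi> j x \<le> 1" if "j \<in> F" for j x
    proof -
      have "\<zeta> j x \<le> Z x" unfolding Z_def using that F(2) \<zeta>0 by (intro member_le_sum) auto
      then show ?thesis using Z0[of x] by (cases "Z x = 0") (auto simp: \<psi>_def divide_le_eq_1)
    qed
    show "(\<Sum>j\<in>F. \<psi> j x) = 1" if "x \<in> S" for x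
      using Zpos[OF that] by (simp add: \<psi>_def sum_divide_distrib[symmetric] Z_def[symmetric])
    show "dist x j < d" if "\<psi> j x \<noteq> 0" for j x
      using that by (auto simp: \<psi>_def \<zeta>_def)
  qed (rule F(2))
qed

lemma integral_smoothing:
  fixes X :: "'a::euclidean_space set"
  assumes X: "compact X" "0 < measure lebesgue X" and \<mu>: "\<mu> \<in> prob_measures X" and \<delta>: "0 < \<delta>" "\<delta> \<le> \<rho>"
    and far: "\<rho> \<le> setdist (msupport X \<mu>) (frontier X)"
  shows "(\<integral>x. smoothing X \<delta> \<mu> x \<partial>lborel_on X) = 1 + \<delta>"
proof -
  let ?M = "measure_on X \<mu>" and ?L = "lborel_on X"
  let ?m = "moll ?M (\<lambda>_. 1) (\<lambda>y. y) \<delta>"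
  note fm = prob_measure_on[OF \<mu>]
  note m = fm(1) _ _ _ id_measurable_on \<delta>(1)
  have "(\<integral>x. 1 * ?m x \<partial>?L) = (\<integral>q. 1 * (\<integral>x. 1 * mollifier \<delta> (x - q) \<partial>?L) \<partial>?M)"
    by (rule moll_fubini[OF m X(1), where g = "\<lambda>_. 1" and B = 1]) auto
  also have "\<dots> = (\<integral>q. 1 \<partial>?M)"
  proof (rule integral_cong_AE)
    show "(\<lambda>q. 1 * (\<integral>x. 1 * mollifier \<delta> (x - q) \<partial>?L)) \<in> borel_measurable ?M"
      by (rule borel_measurable_integrable, rule moll_fubini_integrable[OF m X(1), where g = "\<lambda>_. 1" and B = 1]) auto
    show "AE q in ?M. 1 * (\<integral>x. 1 * mollifier \<delta> (x - q) \<partial>?L) = 1"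
      using AE_ball_subset[OF \<mu> far]
    proof eventually_elim
      case (elim q)
      then have "ball q \<delta> \<subseteq> X" using \<delta>(2) by (meson order_trans subset_ball)
      then show ?case using integral_mollifier_on[OF X(1) \<delta>(1)] by simp
    qed
  qed simp
  finally have 1: "(\<integral>x. ?m x \<partial>?L) = 1" using fm(2) by simp
  have "integrable ?L ?m"
  proof (rule bounded_integrable_lborel_on[OF X(1)])
    show "?m \<in> borel_measurable borel" by (rule moll_measurable[OF m]) auto
    show "\<bar>?m x\<bar> \<le> inverse (\<delta> ^ DIM('a) * bump_mass TYPE('a)) * (\<integral>q. 1 \<partial>?M)" for x
    proof -
      have "0 \<le> ?m x" "?m x \<le> inverse (\<delta> ^ DIM('a) * bump_mass TYPE('a)) * (\<integral>q. 1 \<partial>?M)"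
        by (rule moll_nonneg[OF m] moll_le[OF m]; auto)+
      then show ?thesis by simp
    qed
  qed
  then show ?thesis
    unfolding smoothing_eq_moll[OF \<mu>] using 1 X measure_lebesgue_lborel_on[OF X(1)] finite_lborel_on[OF X(1)]
    by (subst Bochner_Integration.integral_add) (auto intro: finite_measure.integrable_const)
qed

text \<open>The first marginal of \<open>\<theta>\<close> is the smoothing of \<open>\<mu>1s n\<close>, cut by a partition of unity; the second one is
  the smoothing of \<open>\<mu>2\<close>, cut into the mollified second marginals of the corresponding parts of \<open>\<phi>\<close>.  Weak
  convergence makes the masses of corresponding blocks nearly equal, so that any fraction \<open>s < 1\<close> can be
  transported for large \<open>n\<close>.  Both blocks are close to the part of \<open>\<phi>\<close> over the support of the cut-off
  function, so that uniform continuity of the cost controls the error.  All densities are bounded by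
  multiples of powers of \<open>1 / \<delta> n\<close>, and the squared norm by the supremum times the mass.\<close>

lemma recovery:
  fixes \<Omega>1 :: "'a::euclidean_space set" and \<Omega>2 :: "'b::euclidean_space set"
  assumes \<Omega>: "compact \<Omega>1" "compact \<Omega>2" and pos: "0 < measure lebesgue \<Omega>1" "0 < measure lebesgue \<Omega>2"
    and \<mu>1s: "\<And>n. \<mu>1s n \<in> prob_measures \<Omega>1" and \<mu>1: "\<mu>1 \<in> prob_measures \<Omega>1" and \<mu>2: "\<mu>2 \<in> prob_measures \<Omega>2"
    and lim: "weak_star_tendsto \<Omega>1 \<mu>1s \<mu>1"
    and far1: "\<And>n. \<rho> \<le> setdist (msupport \<Omega>1 (\<mu>1s n)) (frontier \<Omega>1)"
    and far2: "\<rho> \<le> setdist (msupport \<Omega>2 \<mu>2) (frontier \<Omega>2)"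
    and \<delta>: "\<And>n. 0 < \<delta> n" "\<And>n. \<delta> n \<le> \<rho>" "\<delta> \<longlonglongrightarrow> 0"
    and \<gamma>: "\<And>n. 0 < \<gamma> n" "(\<lambda>n. \<gamma> n / \<delta> n ^ (DIM('a) + DIM('b))) \<longlonglongrightarrow> 0"
    and \<phi>: "\<phi> \<in> couplings \<Omega>1 \<Omega>2 \<mu>1 \<mu>2" "nonneg_measure \<phi>" and c: "continuous_on (\<Omega>1 \<times> \<Omega>2) c" and e: "0 < e"
  shows "eventually (\<lambda>n. \<exists>\<theta>. L2_coupling \<Omega>1 \<Omega>2 (smoothing \<Omega>1 (\<delta> n) (\<mu>1s n)) (smoothing \<Omega>2 (\<delta> n) \<mu>2) \<theta>
      \<and> (LINT z:\<Omega>1 \<times> \<Omega>2|lebesgue. c z * \<theta> z) \<le> sintegral (\<Omega>1 \<times> \<Omega>2) \<phi> c + e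
      \<and> \<gamma> n / 2 * (LINT z:\<Omega>1 \<times> \<Omega>2|lebesgue. (\<theta> z)\<^sup>2) \<le> e) sequentially"
proof -
  let ?O = "\<Omega>1 \<times> \<Omega>2"
  let ?Q = "measure_on ?O \<phi>" and ?L1 = "lborel_on \<Omega>1" and ?L2 = "lborel_on \<Omega>2"
  have O: "compact ?O" using \<Omega> by (rule compact_Times)
  have \<phi>s: "\<phi> \<in> signed_measures ?O" and push: "pushforward ?O \<Omega>1 fst \<phi> = \<mu>1" "pushforward ?O \<Omega>2 snd \<phi> = \<mu>2"
    using \<phi>(1) by (auto simp: couplings_def)
  have \<phi>ca: "ctbl_add ?O \<phi>" by (rule signed_measures_ctbl_add[OF \<phi>s])
  have \<phi>nn: "0 \<le> \<phi> A" for A using \<phi>(2) by (simp add: nonneg_measure_def)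
  interpret Q: finite_measure ?Q by (rule finite_measure_on[OF \<phi>ca \<phi>nn])
  have fst_c: "continuous_on ?O fst" "fst ` ?O \<subseteq> \<Omega>1" and snd_c: "continuous_on ?O snd" "snd ` ?O \<subseteq> \<Omega>2"
    by (auto intro!: continuous_intros)
  note d1 = distr_pushforward[OF \<phi>ca \<phi>nn prob_measuresD(1,2)[OF \<mu>1] fst_c push(1)]
  note d2 = distr_pushforward[OF \<phi>ca \<phi>nn prob_measuresD(1,2)[OF \<mu>2] snd_c push(2)]
  have snd_m: "snd \<in> measurable ?Q borel" by (rule continuous_on_measurable[OF sets_measure_on snd_c(1)])
  have fst_m: "fst \<in> measurable ?Q borel" by (rule continuous_on_measurable[OF sets_measure_on fst_c(1)])
  have int1: "(\<integral>z. g (fst z) \<partial>?Q) = (\<integral>x. g x \<partial>measure_on \<Omega>1 \<mu>1)" if "continuous_on \<Omega>1 g" for g :: "'a \<Rightarrow> real"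
    using integral_distr[OF d1(1) borel_measurable_continuous_on_restrict[OF that]] unfolding d1(2) by simp
  have int2: "(\<integral>z. g (snd z) \<partial>?Q) = (\<integral>y. g y \<partial>measure_on \<Omega>2 \<mu>2)" if "continuous_on \<Omega>2 g" for g :: "'b \<Rightarrow> real"
    using integral_distr[OF d2(1) borel_measurable_continuous_on_restrict[OF that]] unfolding d2(2) by simp
  have Q1: "measure ?Q ?O = 1"
    using int1[of "\<lambda>_. 1"] prob_measure_on(2)[OF \<mu>1] by simp
  have ball2: "AE z in ?Q. ball (snd z) \<rho> \<subseteq> \<Omega>2"
    using AE_ball_subset[OF \<mu>2 far2] unfolding d2(2)[symmetric] by (rule AE_distrD[OF d2(1)])
  obtain C where C: "0 \<le> C" "\<And>z. z \<in> ?O \<Longrightarrow> \<bar>c z\<bar> \<le> C" using continuous_on_compact_bound[OF O c] by blast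
  define c' where "c' z = indicat_real ?O z *\<^sub>R c z" for z
  have c'm: "c' \<in> borel_measurable borel"
    unfolding c'_def[abs_def] using borel_measurable_continuous_on_indicator[OF _ c] O by (simp add: borel_compact)
  have c'C: "\<bar>c' z\<bar> \<le> C" for z using C by (auto simp: c'_def split: split_indicator)
  have cm: "c \<in> borel_measurable ?Q" by (rule continuous_on_measurable[OF sets_measure_on c])
  have ci: "integrable ?Q c" by (rule continuous_on_integrable[OF sets_measure_on c O Q.finite_measure_axioms])
  have \<phi>c: "sintegral ?O \<phi> c = (\<integral>z. c z \<partial>?Q)" by (rule sintegral_nonneg_measure[OF \<phi>ca \<phi>nn])
  have T: "\<bar>\<integral>z. c z \<partial>?Q\<bar> \<le> C"
    using Q1 C(2) by (intro integral_prob_abs_le Q.finite_measure_axioms ci AE_I2) auto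
  have "uniformly_continuous_on ?O c" using c O by (rule compact_uniformly_continuous)
  from this[unfolded uniformly_continuous_on_def, rule_format, of "e / 4"] e
  obtain d where d: "0 < d" "\<forall>z\<in>?O. \<forall>z'\<in>?O. dist z' z < d \<longrightarrow> dist (c z') (c z) < e / 4"
    by auto
  \<comment> \<open>Two points of a cell are within \<open>d / 2\<close>, which leaves \<open>d / 2\<close> for the mollification in the other variable.\<close>
  obtain F and \<psi> :: "'a \<Rightarrow> 'a \<Rightarrow> real" where F: "finite F"
    and \<psi>: "\<And>j. \<psi> j \<in> borel_measurable borel" "\<And>j. continuous_on \<Omega>1 (\<psi> j)" "\<And>j x. 0 \<le> \<psi> j x"
    "\<And>j x. j \<in> F \<Longrightarrow> \<psi> j x \<le> 1" "\<And>x. x \<in> \<Omega>1 \<Longrightarrow> (\<Sum>j\<in>F. \<psi> j x) = 1" "\<And>j x. \<psi> j x \<noteq> 0 \<Longrightarrow> dist x j < d / 4"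
    by (rule partition_of_unity[OF \<Omega>(1), of "d / 4"]) (use d(1) in simp, rule that)
  define w where "w j z = \<psi> j (fst z)" for j and z :: "'a \<times> 'b"
  have wm: "w j \<in> borel_measurable ?Q" for j
    unfolding w_def[abs_def] by (rule measurable_compose[OF fst_m \<psi>(1)])
  have w0: "0 \<le> w j z" for j z by (simp add: w_def \<psi>(3))
  have w1: "w j z \<le> 1" if "j \<in> F" for j z by (simp add: w_def \<psi>(4) that)
  have wi: "integrable ?Q (w j)" if "j \<in> F" for j
    by (rule Q.integrable_const_bound[of _ 1]) (use wm w0 w1[OF that] in auto)
  define m where "m j = (\<integral>z. w j z \<partial>?Q)" for j
  have m0: "0 \<le> m j" for j unfolding m_def using w0 by (intro integral_nonneg_AE AE_I2)
  have m_eq: "m j = sintegral \<Omega>1 \<mu>1 (\<psi> j)" for j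
    unfolding m_def w_def using int1[OF \<psi>(2)] sintegral_nonneg_measure[OF prob_measuresD(1,2)[OF \<mu>1]] by simp
  have sum_w: "(\<Sum>j\<in>F. w j z) = 1" if "z \<in> ?O" for z
    using \<psi>(5)[of "fst z"] that by (auto simp: w_def)
  have sum_m: "(\<Sum>j\<in>F. m j) = 1"
  proof -
    have "(\<Sum>j\<in>F. m j) = (\<integral>z. (\<Sum>j\<in>F. w j z) \<partial>?Q)"
      unfolding m_def by (rule Bochner_Integration.integral_sum[symmetric]) (rule wi)
    also have "\<dots> = (\<integral>z. 1 \<partial>?Q)" by (rule Bochner_Integration.integral_cong) (auto simp: sum_w)
    finally show ?thesis using Q1 by simp
  qed
  have wci: "integrable ?Q (\<lambda>z. w j z * c z)" if "j \<in> F" for j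
  proof (rule Q.integrable_const_bound[of _ C])
    show "AE z in ?Q. norm (w j z * c z) \<le> C"
    proof (rule AE_I2)
      fix z assume "z \<in> space ?Q"
      then have "\<bar>c z\<bar> \<le> C" using C(2) by simp
      then have "w j z * \<bar>c z\<bar> \<le> 1 * C" using w1[OF that] w0 by (intro mult_mono) auto
      then show "norm (w j z * c z) \<le> C" using w0 by (simp add: abs_mult)
    qed
  qed (use wm cm in simp)
  define I where "I j = (\<integral>z. w j z * c z \<partial>?Q)" for j
  have sum_I: "(\<Sum>j\<in>F. I j) = (\<integral>z. c z \<partial>?Q)"
  proof -
    have "(\<Sum>j\<in>F. I j) = (\<integral>z. (\<Sum>j\<in>F. w j z * c z) \<partial>?Q)"
      unfolding I_def by (rule Bochner_Integration.integral_sum[symmetric]) (rule wci)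
    also have "\<dots> = (\<integral>z. c z \<partial>?Q)"
      by (rule Bochner_Integration.integral_cong) (auto simp: sum_distrib_right[symmetric] sum_w)
    finally show ?thesis .
  qed
  have I_le: "\<bar>I j\<bar> \<le> C * m j" if "j \<in> F" for j
  proof -
    have "\<bar>I j\<bar> \<le> (\<integral>z. \<bar>w j z * c z\<bar> \<partial>?Q)" unfolding I_def by (rule integral_abs_bound)
    also have "\<dots> \<le> (\<integral>z. C * w j z \<partial>?Q)"
    proof (rule integral_mono)
      show "\<bar>w j z * c z\<bar> \<le> C * w j z" if "z \<in> space ?Q" for z
        using mult_left_mono[OF C(2)[of z] w0[of j z]] that w0[of j z] by (simp add: abs_mult mult.commute)
    qed (use wci[OF that] wi[OF that] in auto)
    finally show ?thesis by (simp add: m_def)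
  qed
  \<comment> \<open>The fraction of the mass that is not transported blockwise; it changes the cost by at most
    \<open>3 * C * \<tau>\<close> once \<open>\<delta> n < 1\<close>.\<close>
  define \<tau> where "\<tau> = min (1 / 2) (e / (4 * (3 * C + 1)))"
  have \<tau>: "0 < \<tau>" "\<tau> \<le> 1 / 2" "\<tau> \<le> e / (4 * (3 * C + 1))"
  proof -
    show "0 < \<tau>" using e C(1) by (simp add: \<tau>_def)
    show "\<tau> \<le> 1 / 2" unfolding \<tau>_def by (rule min.cobounded1)
    show "\<tau> \<le> e / (4 * (3 * C + 1))" unfolding \<tau>_def by (rule min.cobounded2)
  qed
  have "3 * C * \<tau> \<le> (3 * C + 1) * (e / (4 * (3 * C + 1)))"
    using C(1) \<tau>(1) by (intro mult_mono \<tau>(3)) auto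
  also have "\<dots> = e / 4" using C(1) by (simp add: field_simps add_pos_nonneg)
  finally have \<tau>C: "3 * C * \<tau> \<le> e / 4" .
  define s where "s = 1 - \<tau>"
  have s: "0 < s" "s \<le> 1" "s < 1" using \<tau> by (auto simp: s_def)
  define p where "p n j x = \<psi> j x * smoothing \<Omega>1 (\<delta> n) (\<mu>1s n) x" for n j x
  \<comment> \<open>Outside the index set the block is empty, so that the weight is bounded by \<open>1\<close> for every index.  The
    constant \<open>\<delta> / measure lebesgue \<Omega>2\<close> of the smoothing is shared out in proportion to the masses.\<close>
  define q where "q n j y = moll ?Q (\<lambda>z. if j \<in> F then w j z else 0) snd (\<delta> n) y + (if j \<in> F then m j else 0) * (\<delta> n / measure lebesgue \<Omega>2)" for n j y
  define A where "A n j = (\<integral>x. p n j x \<partial>?L1)" for n j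
  define K where "K n = inverse (\<delta> n ^ DIM('a) * bump_mass TYPE('a)) + \<delta> n / measure lebesgue \<Omega>1" for n
  define \<kappa> where "\<kappa> n = inverse (\<delta> n ^ DIM('b) * bump_mass TYPE('b)) + \<delta> n / measure lebesgue \<Omega>2" for n
  have K0: "0 \<le> K n" "0 \<le> \<kappa> n" for n
    using \<delta>(1)[of n] pos bump_mass_pos[where 'a='a] bump_mass_pos[where 'a='b] by (auto simp: K_def \<kappa>_def intro!: add_nonneg_nonneg)
  have A_lim: "(\<lambda>n. A n j) \<longlonglongrightarrow> m j" for j
    unfolding A_def p_def m_eq
    by (rule smoothing_tendsto[OF \<Omega>(1) pos(1) \<mu>1s \<delta> far1 \<psi>(2)]) (use lim \<psi>(2) in \<open>simp add: weak_star_tendsto_def\<close>)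
  have ev_A: "eventually (\<lambda>n. \<forall>j\<in>F. s * (m j * (1 + \<delta> n)) \<le> A n j) sequentially"
  proof (rule eventually_ball_finite[OF F], rule ballI)
    fix j assume "j \<in> F"
    have An: "0 \<le> A n j" for n
      unfolding A_def p_def using \<psi>(3) smoothing_nonneg[OF \<mu>1s \<delta>(1)] by (intro integral_nonneg_AE AE_I2) simp
    show "eventually (\<lambda>n. s * (m j * (1 + \<delta> n)) \<le> A n j) sequentially"
    proof (cases "m j = 0")
      case False
      have "(\<lambda>n. A n j - s * (m j * (1 + \<delta> n))) \<longlonglongrightarrow> m j - s * (m j * (1 + 0))"
        by (intro tendsto_intros A_lim \<delta>(3))
      moreover have "0 < m j - s * (m j * (1 + 0))" using False m0[of j] s(3) by simp
      ultimately have "eventually (\<lambda>n. 0 < A n j - s * (m j * (1 + \<delta> n))) sequentially" by (rule order_tendstoD(1))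
      then show ?thesis by eventually_elim simp
    qed (simp add: An)
  qed
  have ev_\<delta>: "eventually (\<lambda>n. \<delta> n < d / 2) sequentially" "eventually (\<lambda>n. \<delta> n < 1) sequentially"
    by (rule order_tendstoD(2)[OF \<delta>(3)], use d(1) in simp)+
  have "(\<lambda>n. \<delta> n * C) \<longlonglongrightarrow> 0 * C" by (intro tendsto_intros \<delta>(3))
  then have ev_C: "eventually (\<lambda>n. \<delta> n * C < e / 4) sequentially" using e by (intro order_tendstoD(2)) auto
  have ev_\<gamma>: "eventually (\<lambda>n. \<gamma> n * ((real (card F) + 1) * (K n * \<kappa> n)) < e) sequentially"
  proof -
    let ?r = "\<lambda>n. \<gamma> n / \<delta> n ^ (DIM('a) + DIM('b))"
    let ?a = "\<lambda>n. inverse (bump_mass TYPE('a)) + \<delta> n ^ DIM('a) * (\<delta> n / measure lebesgue \<Omega>1)"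
    let ?b = "\<lambda>n. inverse (bump_mass TYPE('b)) + \<delta> n ^ DIM('b) * (\<delta> n / measure lebesgue \<Omega>2)"
    have eq: "\<gamma> n * ((real (card F) + 1) * (K n * \<kappa> n)) = (real (card F) + 1) * (?r n * (?a n * ?b n))" for n
    proof -
      have "\<delta> n ^ DIM('a) * K n = ?a n" "\<delta> n ^ DIM('b) * \<kappa> n = ?b n"
        using \<delta>(1)[of n] by (simp_all add: K_def \<kappa>_def distrib_left)
      then have ab: "?a n * ?b n = \<delta> n ^ (DIM('a) + DIM('b)) * (K n * \<kappa> n)"
        by (metis (no_types, opaque_lifting) mult.assoc mult.left_commute power_add)
      show ?thesis unfolding ab using \<delta>(1)[of n] by simp
    qed
    have "(\<lambda>n. (real (card F) + 1) * (?r n * (?a n * ?b n))) \<longlonglongrightarrow> (real (card F) + 1) *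
       (0 * ((inverse (bump_mass TYPE('a)) + 0 ^ DIM('a) * (0 / measure lebesgue \<Omega>1)) * (inverse (bump_mass TYPE('b)) + 0 ^ DIM('b) * (0 / measure lebesgue \<Omega>2))))"
      using pos by (intro tendsto_intros \<gamma>(2) \<delta>(3)) auto
    then show ?thesis unfolding eq using e by (intro order_tendstoD(2)) auto
  qed
  show ?thesis
    using ev_A ev_\<delta> ev_C ev_\<gamma>
  proof eventually_elim
    case (elim n)
    let ?\<delta> = "\<delta> n" and ?S1 = "smoothing \<Omega>1 (\<delta> n) (\<mu>1s n)" and ?S2 = "smoothing \<Omega>2 (\<delta> n) \<mu>2"
    let ?v = "\<lambda>j z. if j \<in> F then w j z else 0"
    have v: "?v j \<in> borel_measurable ?Q" "\<And>z. 0 \<le> ?v j z" "\<And>z. ?v j z \<le> 1" for j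
      using wm[of j] w0 w1 by (cases "j \<in> F"; simp)+
    note mo = Q.finite_measure_axioms v snd_m \<delta>(1)[of n]
    have ball\<delta>: "AE z in ?Q. ball (snd z) ?\<delta> \<subseteq> \<Omega>2"
      using ball2 by eventually_elim (use \<delta>(2)[of n] subset_ball in blast)
    have qmoll: "q n j y = moll ?Q (?v j) snd ?\<delta> y + m j * (?\<delta> / measure lebesgue \<Omega>2)" if "j \<in> F" for j y
      using that by (simp add: q_def)
    have mol_m: "moll ?Q (?v j) snd ?\<delta> \<in> borel_measurable borel" for j by (rule moll_measurable[OF mo])
    have mol_le: "moll ?Q (?v j) snd ?\<delta> y \<le> inverse (?\<delta> ^ DIM('b) * bump_mass TYPE('b)) * m j"
      and mol_0: "0 \<le> moll ?Q (?v j) snd ?\<delta> y" if "j \<in> F" for j y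
      using moll_le[OF mo, of j y] moll_nonneg[OF mo, of j y] that by (simp_all add: m_def)
    have mol_i: "integrable ?L2 (moll ?Q (?v j) snd ?\<delta>)" if "j \<in> F" for j
      using mol_le[OF that] mol_0[OF that] by (intro bounded_integrable_lborel_on[OF \<Omega>(2) mol_m]) (simp add: abs_le_iff order_trans)
    have L2m: "(\<integral>y. 1 \<partial>?L2) = measure lebesgue \<Omega>2" using measure_lebesgue_lborel_on[OF \<Omega>(2)] by simp
    have B: "(\<integral>y. q n j y \<partial>?L2) = m j * (1 + ?\<delta>)" if j: "j \<in> F" for j
    proof -
      have "(\<integral>y. 1 * moll ?Q (?v j) snd ?\<delta> y \<partial>?L2) = (\<integral>z. ?v j z * (\<integral>y. 1 * mollifier ?\<delta> (y - snd z) \<partial>?L2) \<partial>?Q)"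
        by (rule moll_fubini[OF mo \<Omega>(2), where g = "\<lambda>_. 1" and B = 1]) auto
      also have "\<dots> = (\<integral>z. ?v j z \<partial>?Q)"
      proof (rule integral_cong_AE)
        show "(\<lambda>z. ?v j z * (\<integral>y. 1 * mollifier ?\<delta> (y - snd z) \<partial>?L2)) \<in> borel_measurable ?Q"
          by (rule borel_measurable_integrable, rule moll_fubini_integrable[OF mo \<Omega>(2), where g = "\<lambda>_. 1" and B = 1]) auto
        show "AE z in ?Q. ?v j z * (\<integral>y. 1 * mollifier ?\<delta> (y - snd z) \<partial>?L2) = ?v j z"
          using ball\<delta> by eventually_elim (simp add: integral_mollifier_on[OF \<Omega>(2) \<delta>(1)])
      qed (rule v)
      finally have 1: "(\<integral>y. moll ?Q (?v j) snd ?\<delta> y \<partial>?L2) = m j" using j by (simp add: m_def)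
      have "(\<integral>y. q n j y \<partial>?L2) = (\<integral>y. moll ?Q (?v j) snd ?\<delta> y + (m j * (?\<delta> / measure lebesgue \<Omega>2)) * 1 \<partial>?L2)"
        using qmoll[OF j] by simp
      also have "\<dots> = m j + (m j * (?\<delta> / measure lebesgue \<Omega>2)) * measure lebesgue \<Omega>2"
        using mol_i[OF j] 1 L2m finite_lborel_on[OF \<Omega>(2)]
        by (subst Bochner_Integration.integral_add) (auto intro: finite_measure.integrable_const)
      also have "\<dots> = m j * (1 + ?\<delta>)" using pos(2) by (simp add: distrib_left)
      finally show ?thesis .
    qed
    define D where "D j = I j + m j * (e / 4 + ?\<delta> * C)" for j
    obtain \<theta> where \<theta>: "L2_coupling \<Omega>1 \<Omega>2 ?S1 ?S2 \<theta>" "\<theta> \<in> borel_measurable borel" "\<And>z. 0 \<le> \<theta> z"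
      "\<And>x y. x \<in> \<Omega>1 \<Longrightarrow> y \<in> \<Omega>2 \<Longrightarrow> \<theta> (x, y) \<le> (real (card F) + 1) * (K n * \<kappa> n)"
      "(LINT z:?O|lebesgue. c' z * \<theta> z) \<le> s * (\<Sum>j\<in>F. D j) + C * ((1 - s) * (1 + ?\<delta>))"
    proof (rule block_coupling[where p = "p n" and q = "q n" and A = "A n" and B = "\<lambda>j. \<integral>y. q n j y \<partial>?L2"
          and J = F and s = s and M = "1 + ?\<delta>" and c = c' and C = C and D = D and K = "K n" and \<kappa> = "\<kappa> n"
          and ?m1.0 = ?S1 and ?m2.0 = ?S2, OF \<Omega> F])
      show "p n j \<in> borel_measurable borel" for j
        unfolding p_def[abs_def] by (intro borel_measurable_times \<psi> smoothing_measurable \<mu>1s \<delta>)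
      show "0 \<le> p n j x" for j x
        unfolding p_def by (intro mult_nonneg_nonneg \<psi> smoothing_nonneg \<mu>1s \<delta>)
      show "q n j \<in> borel_measurable borel" for j
        unfolding q_def[abs_def] using mol_m[of j] by simp
      show "0 \<le> q n j y" for j y
        unfolding q_def using moll_nonneg[OF mo, of j y] m0[of j] \<delta>(1)[of n] pos by (intro add_nonneg_nonneg) auto
      show "?S1 x = (\<Sum>j\<in>F. p n j x)" if "x \<in> \<Omega>1" for x
        unfolding p_def sum_distrib_right[symmetric] \<psi>(5)[OF that] by simp
      show "?S1 x \<le> K n" for x
        unfolding K_def by (rule smoothing_le[OF \<mu>1s \<delta>(1)])
      show "?S2 y = (\<Sum>j\<in>F. q n j y)" if "y \<in> \<Omega>2" for y
      proof -
        have mc: "continuous_on \<Omega>2 (\<lambda>y'. mollifier ?\<delta> (y - y'))"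
          by (rule continuous_on_compose2[OF continuous_mollifier]) (auto intro!: continuous_intros)
        have vi: "integrable ?Q (\<lambda>z. ?v j z * mollifier ?\<delta> (y - snd z))" for j
        proof (rule Q.integrable_const_bound)
          let ?k = "inverse (?\<delta> ^ DIM('b) * bump_mass TYPE('b))"
          show "AE z in ?Q. norm (?v j z * mollifier ?\<delta> (y - snd z)) \<le> 1 * ?k"
          proof (rule AE_I2)
            fix z
            have "\<bar>?v j z\<bar> \<le> 1" using v(2,3)[of j z] by simp
            then show "norm (?v j z * mollifier ?\<delta> (y - snd z)) \<le> 1 * ?k"
              unfolding real_norm_def abs_mult by (rule mult_mono[OF _ mollifier_abs_le[OF \<delta>(1)]]) auto
          qed
          have "(\<lambda>z. mollifier ?\<delta> (y - snd z)) \<in> borel_measurable ?Q" using snd_m by measurable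
          then show "(\<lambda>z. ?v j z * mollifier ?\<delta> (y - snd z)) \<in> borel_measurable ?Q" using v(1)[of j] by (rule borel_measurable_times[rotated])
        qed
        have "(\<Sum>j\<in>F. moll ?Q (?v j) snd ?\<delta> y) = (\<integral>z. (\<Sum>j\<in>F. ?v j z * mollifier ?\<delta> (y - snd z)) \<partial>?Q)"
          unfolding moll_def by (rule Bochner_Integration.integral_sum[symmetric]) (rule vi)
        also have "\<dots> = (\<integral>z. mollifier ?\<delta> (y - snd z) \<partial>?Q)"
          by (rule Bochner_Integration.integral_cong) (auto simp: sum_distrib_right[symmetric] sum_w)
        also have "\<dots> = (\<integral>y'. mollifier ?\<delta> (y - y') \<partial>measure_on \<Omega>2 \<mu>2)" by (rule int2[OF mc])
        finally have "(\<Sum>j\<in>F. moll ?Q (?v j) snd ?\<delta> y) = sintegral \<Omega>2 \<mu>2 (\<lambda>y'. mollifier ?\<delta> (y - y'))"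
          using sintegral_nonneg_measure[OF prob_measuresD(1,2)[OF \<mu>2]] by simp
        moreover have "(\<Sum>j\<in>F. q n j y) = (\<Sum>j\<in>F. moll ?Q (?v j) snd ?\<delta> y) + (\<Sum>j\<in>F. m j) * (?\<delta> / measure lebesgue \<Omega>2)"
          using qmoll by (simp add: sum.distrib sum_distrib_right sum_divide_distrib)
        ultimately show ?thesis using sum_m by (simp add: smoothing_def)
      qed
      show "A n j = (\<integral>x. p n j x \<partial>?L1)" for j by (simp add: A_def)
      show "q n j y \<le> \<kappa> n * (\<integral>y. q n j y \<partial>?L2)" if j: "j \<in> F" for j y
      proof -
        have "q n j y \<le> inverse (?\<delta> ^ DIM('b) * bump_mass TYPE('b)) * m j + m j * (?\<delta> / measure lebesgue \<Omega>2)"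
          unfolding qmoll[OF j] by (intro add_right_mono mol_le[OF j])
        also have "\<dots> = \<kappa> n * m j" unfolding \<kappa>_def distrib_right by (simp only: mult.commute)
        also have "\<dots> \<le> \<kappa> n * (m j * (1 + ?\<delta>))"
          using K0(2)[of n] m0[of j] \<delta>(1)[of n] by (intro mult_left_mono) (auto simp: mult_le_cancel_left1)
        finally show ?thesis by (simp add: B[OF j])
      qed
      show "0 \<le> K n" "0 \<le> \<kappa> n" by (rule K0)+
      show "0 < s" "s \<le> 1" by (rule s)+
      show "s * (\<integral>y. q n j y \<partial>?L2) \<le> A n j" if "j \<in> F" for j using elim(1) that by (simp add: B[OF that])
      show "(\<Sum>j\<in>F. A n j) = 1 + ?\<delta>"
      proof -
        have pi: "integrable ?L1 (p n j)" if "j \<in> F" for j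
        proof (rule bounded_integrable_lborel_on[OF \<Omega>(1)])
          show "p n j \<in> borel_measurable borel"
            unfolding p_def[abs_def] by (intro borel_measurable_times \<psi> smoothing_measurable \<mu>1s \<delta>)
          show "\<bar>p n j x\<bar> \<le> 1 * K n" for x
            unfolding p_def abs_mult using \<psi>(3,4)[of j x] \<psi>(3)[of j x] that smoothing_nonneg[OF \<mu>1s \<delta>(1), of n n x] smoothing_le[OF \<mu>1s \<delta>(1), of n n x]
            by (intro mult_mono) (auto simp: K_def)
        qed
        have "(\<Sum>j\<in>F. A n j) = (\<integral>x. (\<Sum>j\<in>F. p n j x) \<partial>?L1)"
          unfolding A_def by (rule Bochner_Integration.integral_sum[symmetric]) (rule pi)
        also have "\<dots> = (\<integral>x. ?S1 x \<partial>?L1)"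
          by (rule Bochner_Integration.integral_cong) (auto simp: p_def sum_distrib_right[symmetric] \<psi>(5))
        also have "\<dots> = 1 + ?\<delta>" by (rule integral_smoothing[OF \<Omega>(1) pos(1) \<mu>1s \<delta>(1,2) far1])
        finally show ?thesis .
      qed
      show "(\<Sum>j\<in>F. \<integral>y. q n j y \<partial>?L2) = 1 + ?\<delta>"
        using B sum_m by (simp add: sum_distrib_right[symmetric])
      show "0 < 1 + ?\<delta>" using \<delta>(1)[of n] by simp
      show "c' \<in> borel_measurable borel" by (rule c'm)
      show "\<bar>c' z\<bar> \<le> C" for z by (rule c'C)
      show "D j = 0" if j: "j \<in> F" "A n j = 0" for j
      proof -
        have "s * (m j * (1 + ?\<delta>)) \<le> 0" using elim(1) j by metis
        then have "m j = 0" using s(1) m0[of j] \<delta>(1)[of n] by (auto simp: mult_le_0_iff)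
        moreover from this have "I j = 0" using I_le[OF j(1)] by simp
        ultimately show ?thesis by (simp add: D_def)
      qed
      show "(\<integral>y. c' (x, y) * q n j y \<partial>?L2) \<le> D j" if j: "j \<in> F" and x: "x \<in> \<Omega>1" and px: "p n j x \<noteq> 0" for j x
      proof -
        let ?g = "\<lambda>y. c' (x, y)"
        have gm: "?g \<in> borel_measurable ?L2"
          using borel_section1[OF c'm] by (intro measurable_restrict_space1) simp
        have gb: "\<bar>?g y\<bar> \<le> C" for y by (rule c'C)
        have xj: "dist x j < d / 4" using px \<psi>(6)[of j x] by (auto simp: p_def)
        have "(\<integral>y. ?g y * moll ?Q (?v j) snd ?\<delta> y \<partial>?L2) = (\<integral>z. ?v j z * (\<integral>y. ?g y * mollifier ?\<delta> (y - snd z) \<partial>?L2) \<partial>?Q)"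
          by (rule moll_fubini[OF mo \<Omega>(2) gm gb])
        also have "\<dots> \<le> (\<integral>z. w j z * c z + e / 4 * w j z \<partial>?Q)"
        proof (rule integral_mono_AE)
          show "integrable ?Q (\<lambda>z. ?v j z * (\<integral>y. ?g y * mollifier ?\<delta> (y - snd z) \<partial>?L2))"
            by (rule moll_fubini_integrable[OF mo \<Omega>(2) gm gb])
          show "integrable ?Q (\<lambda>z. w j z * c z + e / 4 * w j z)" using wci[OF j] wi[OF j] by simp
          show "AE z in ?Q. ?v j z * (\<integral>y. ?g y * mollifier ?\<delta> (y - snd z) \<partial>?L2) \<le> w j z * c z + e / 4 * w j z"
            using ball\<delta> AE_space[of ?Q]
          proof eventually_elim
            case (elim z)
            show ?case
            proof (cases "w j z = 0")
              case False
              then have zj: "dist (fst z) j < d / 4" using \<psi>(6) by (auto simp: w_def)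
              have z: "z \<in> ?O" using elim(2) by simp
              have "\<bar>?g y - c z\<bar> \<le> e / 4" if "y \<in> ball (snd z) ?\<delta>" for y
              proof -
                have xy: "(x, y) \<in> ?O" using x that elim(1) by auto
                have "dist (x, y) z \<le> dist x (fst z) + dist y (snd z)"
                  unfolding dist_prod_def using sqrt_sum_squares_le_sum[of "dist x (fst z)" "dist y (snd z)"] by simp
                also have "dist x (fst z) < d / 2" using dist_triangle2[of x "fst z" j] xj zj by linarith
                also have "dist y (snd z) < d / 2" using that \<open>?\<delta> < d / 2\<close> by (simp add: dist_commute)
                finally have "dist (x, y) z < d" by simp
                then have "dist (c (x, y)) (c z) < e / 4" using d(2) xy z by blast
                then show ?thesis using xy by (simp add: c'_def dist_real_def)
              qed
              from kernel_average[OF \<Omega>(2) \<delta>(1) elim(1) gm gb this]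
              have "(\<integral>y. ?g y * mollifier ?\<delta> (y - snd z) \<partial>?L2) \<le> c z + e / 4" by linarith
              from mult_left_mono[OF this w0[of j z]] show ?thesis using j by (simp add: distrib_left mult.commute)
            qed simp
          qed
        qed
        also have "\<dots> = I j + e / 4 * m j" using wci[OF j] wi[OF j] by (simp add: I_def m_def)
        finally have 1: "(\<integral>y. ?g y * moll ?Q (?v j) snd ?\<delta> y \<partial>?L2) \<le> I j + e / 4 * m j" .
        have gi: "integrable ?L2 ?g"
          using borel_section1[OF c'm] gb by (intro bounded_integrable_lborel_on[OF \<Omega>(2)])
        have gmi: "integrable ?L2 (\<lambda>y. ?g y * moll ?Q (?v j) snd ?\<delta> y)"
        proof (rule bounded_integrable_lborel_on[OF \<Omega>(2)])
          show "(\<lambda>y. ?g y * moll ?Q (?v j) snd ?\<delta> y) \<in> borel_measurable borel"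
            by (intro borel_measurable_times borel_section1[OF c'm] mol_m)
          show "\<bar>?g y * moll ?Q (?v j) snd ?\<delta> y\<bar> \<le> C * (inverse (?\<delta> ^ DIM('b) * bump_mass TYPE('b)) * m j)" for y
            unfolding abs_mult[of "?g y"] using gb[of y] mol_le[OF j, of y] mol_0[OF j, of y] C(1) by (intro mult_mono) linarith+
        qed
        have "(\<integral>y. ?g y \<partial>?L2) \<le> (\<integral>y. C \<partial>?L2)"
          using gb gi finite_lborel_on[OF \<Omega>(2)] by (intro integral_mono) (auto simp: abs_le_iff intro: finite_measure.integrable_const)
        also have "\<dots> = C * measure lebesgue \<Omega>2" using measure_lebesgue_lborel_on[OF \<Omega>(2)] by simp
        finally have "(m j * (?\<delta> / measure lebesgue \<Omega>2)) * (\<integral>y. ?g y \<partial>?L2) \<le> (m j * (?\<delta> / measure lebesgue \<Omega>2)) * (C * measure lebesgue \<Omega>2)"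
          using m0[of j] \<delta>(1)[of n] pos by (intro mult_left_mono) auto
        then have 2: "(m j * (?\<delta> / measure lebesgue \<Omega>2)) * (\<integral>y. ?g y \<partial>?L2) \<le> m j * (?\<delta> * C)" using pos by simp
        have "(\<integral>y. ?g y * q n j y \<partial>?L2) = (\<integral>y. ?g y * moll ?Q (?v j) snd ?\<delta> y + (m j * (?\<delta> / measure lebesgue \<Omega>2)) * ?g y \<partial>?L2)"
          unfolding qmoll[OF j] by (simp only: distrib_left mult.commute)
        also have "\<dots> = (\<integral>y. ?g y * moll ?Q (?v j) snd ?\<delta> y \<partial>?L2) + (m j * (?\<delta> / measure lebesgue \<Omega>2)) * (\<integral>y. ?g y \<partial>?L2)"
          by (subst Bochner_Integration.integral_add[OF gmi]) (use gi in auto)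
        also have "\<dots> \<le> D j" using 1 2 by (simp add: D_def distrib_left mult.commute)
        finally show ?thesis .
      qed
    qed (rule refl, rule that)
    have cc: "(LINT z:?O|lebesgue. c z * \<theta> z) = (LINT z:?O|lebesgue. c' z * \<theta> z)"
      unfolding set_lebesgue_integral_def
      by (intro Bochner_Integration.integral_cong) (auto simp: c'_def split: split_indicator)
    have "(\<Sum>j\<in>F. D j) = (\<integral>z. c z \<partial>?Q) + (e / 4 + ?\<delta> * C)"
      unfolding D_def sum.distrib sum_I sum_distrib_right[symmetric] sum_m by simp
    then have "s * (\<Sum>j\<in>F. D j) = (\<integral>z. c z \<partial>?Q) + (e / 4 + ?\<delta> * C) - \<tau> * ((\<integral>z. c z \<partial>?Q) + (e / 4 + ?\<delta> * C))"
      by (simp add: s_def left_diff_distrib)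
    also have "\<dots> \<le> (\<integral>z. c z \<partial>?Q) + (e / 4 + e / 4) + \<tau> * C"
    proof -
      have "- (\<tau> * ((\<integral>z. c z \<partial>?Q) + (e / 4 + ?\<delta> * C))) \<le> \<tau> * C"
      proof -
        have "0 \<le> ?\<delta> * C" using \<delta>(1)[of n] C(1) by simp
        then have "- C \<le> (\<integral>z. c z \<partial>?Q) + (e / 4 + ?\<delta> * C)" using T e by linarith
        from mult_left_mono[OF this, of \<tau>] \<tau>(1) show ?thesis by simp
      qed
      then show ?thesis using elim(4) by linarith
    qed
    finally have sD: "s * (\<Sum>j\<in>F. D j) \<le> (\<integral>z. c z \<partial>?Q) + e / 2 + \<tau> * C" by simp
    have "C * ((1 - s) * (1 + ?\<delta>)) \<le> C * (\<tau> * 2)"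
      using C(1) \<tau>(1) elim(3) by (intro mult_left_mono) (auto simp: s_def)
    then have main: "(LINT z:?O|lebesgue. c z * \<theta> z) \<le> sintegral ?O \<phi> c + e"
      unfolding cc \<phi>c using \<theta>(5) sD \<tau>C e by (simp add: mult.commute)
    have \<theta>i: "set_integrable lebesgue ?O \<theta>" by (rule L2_coupling_integrable[OF \<Omega> \<theta>(1)])
    have \<theta>1: "(LINT z:?O|lebesgue. \<theta> z) = 1 + ?\<delta>"
      using L2_coupling_fst[OF \<Omega> \<theta>(1), of "\<lambda>_. 1"] smoothing_measurable[OF \<mu>1s \<delta>(1)]
        integral_smoothing[OF \<Omega>(1) pos(1) \<mu>1s \<delta>(1,2) far1, of n n] by simp
    let ?N = "(real (card F) + 1) * (K n * \<kappa> n)"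
    have "(LINT z:?O|lebesgue. (\<theta> z)\<^sup>2) \<le> (LINT z:?O|lebesgue. ?N * \<theta> z)"
    proof (rule set_integral_mono)
      show "set_integrable lebesgue ?O (\<lambda>z. (\<theta> z)\<^sup>2)"
        using \<theta>(1) by (simp add: L2_coupling_def Lp_on_def)
      show "set_integrable lebesgue ?O (\<lambda>z. ?N * \<theta> z)" using \<theta>i by (rule set_integrable_mult_right)
      show "(\<theta> z)\<^sup>2 \<le> ?N * \<theta> z" if "z \<in> ?O" for z
      proof -
        have "\<theta> z \<le> ?N" using \<theta>(4)[of "fst z" "snd z"] that by (auto simp: mem_Times_iff)
        from mult_right_mono[OF this \<theta>(3)[of z]] show ?thesis by (simp add: power2_eq_square)
      qed
    qed
    also have "\<dots> = ?N * (1 + ?\<delta>)" using \<theta>1 by simp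
    also have "\<dots> \<le> ?N * 2" using elim(3) K0[of n] by (intro mult_left_mono) auto
    finally have "\<gamma> n / 2 * (LINT z:?O|lebesgue. (\<theta> z)\<^sup>2) \<le> \<gamma> n / 2 * (?N * 2)"
      using \<gamma>(1)[of n] by (intro mult_left_mono) auto
    also have "\<dots> \<le> e" using elim(5) by simp
    finally show ?case using \<theta>(1) main by blast
  qed
qed

section \<open>Optimality of the limit\<close>

lemma interior_imp_measure_pos:
  fixes S :: "'a::euclidean_space set"
  assumes "compact S" "interior S \<noteq> {}"
  shows "0 < measure lebesgue S"
proof -
  have "\<not> negligible S"
    using open_not_negligible[OF open_interior assms(2)] negligible_subset[OF _ interior_subset] by blast
  then show ?thesis
    using lmeasurable_compact[OF assms(1)] by (simp add: negligible_iff_measure less_le)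
qed

lemma perturbed_cost:
  fixes S :: "'a::euclidean_space set" and f c c' :: "'a \<Rightarrow> real"
  assumes S: "compact S" and f: "set_integrable lebesgue S f" "AE z in lebesgue. z \<in> S \<longrightarrow> 0 \<le> f z"
    and c: "continuous_on S c" and c': "set_borel_measurable lebesgue S c'"
    and close: "AE z in lebesgue. z \<in> S \<longrightarrow> \<bar>c' z - c z\<bar> \<le> \<eta>"
  shows "\<bar>(LINT z:S|lebesgue. c' z * f z) - (LINT z:S|lebesgue. c z * f z)\<bar> \<le> \<eta> * (LINT z:S|lebesgue. f z)"
proof -
  have Sb: "S \<in> sets borel" using S by (rule borel_compact)
  obtain C where C: "0 \<le> C" "\<And>z. z \<in> S \<Longrightarrow> \<bar>c z\<bar> \<le> C" using continuous_on_compact_bound[OF S c] by blast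
  have cm: "set_borel_measurable lebesgue S c"
    unfolding set_borel_measurable_def by (rule borel_in_lebesgue[OF borel_measurable_continuous_on_indicator[OF Sb c]])
  have prod: "set_integrable lebesgue S (\<lambda>z. g z * f z)"
    if g: "set_borel_measurable lebesgue S g" and "AE z in lebesgue. z \<in> S \<longrightarrow> \<bar>g z\<bar> \<le> B" for g B
  proof (rule set_integrable_bound)
    show "set_integrable lebesgue S (\<lambda>z. B * f z)" using f(1) by (rule set_integrable_mult_right)
    have "(\<lambda>z. (indicat_real S z *\<^sub>R g z) * (indicat_real S z *\<^sub>R f z)) \<in> borel_measurable lebesgue"
      using g f(1) unfolding set_borel_measurable_def set_integrable_def
      by (intro borel_measurable_times) (auto dest: borel_measurable_integrable)
    moreover have "(\<lambda>z. (indicat_real S z *\<^sub>R g z) * (indicat_real S z *\<^sub>R f z)) = (\<lambda>z. indicat_real S z *\<^sub>R (g z * f z))"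
      by (auto simp: fun_eq_iff split: split_indicator)
    ultimately show "set_borel_measurable lebesgue S (\<lambda>z. g z * f z)" by (simp add: set_borel_measurable_def)
    show "AE z in lebesgue. z \<in> S \<longrightarrow> norm (g z * f z) \<le> norm (B * f z)"
      using that(2) by eventually_elim (auto simp: abs_mult intro!: mult_right_mono)
  qed
  have i: "set_integrable lebesgue S (\<lambda>z. c z * f z)"
    by (rule prod[OF cm, of C]) (use C(2) in auto)
  have "AE z in lebesgue. z \<in> S \<longrightarrow> \<bar>c' z\<bar> \<le> C + \<eta>"
    using close
  proof eventually_elim
    case (elim z)
    show ?case
    proof
      assume "z \<in> S"
      then have "\<bar>c' z - c z\<bar> \<le> \<eta>" "\<bar>c z\<bar> \<le> C" using elim C(2) by auto
      then show "\<bar>c' z\<bar> \<le> C + \<eta>" by linarith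
    qed
  qed
  from prod[OF c' this] have i': "set_integrable lebesgue S (\<lambda>z. c' z * f z)" .
  have "(LINT z:S|lebesgue. c' z * f z) - (LINT z:S|lebesgue. c z * f z) = (LINT z:S|lebesgue. c' z * f z - c z * f z)"
    by (rule set_integral_diff(2)[OF i' i, symmetric])
  also have "\<bar>\<dots>\<bar> \<le> (LINT z:S|lebesgue. \<bar>c' z * f z - c z * f z\<bar>)"
    using set_integral_norm_bound[OF set_integral_diff(1)[OF i' i]] by simp
  also have "\<dots> \<le> (LINT z:S|lebesgue. \<eta> * f z)"
  proof (rule set_integral_mono_AE)
    show "set_integrable lebesgue S (\<lambda>z. \<bar>c' z * f z - c z * f z\<bar>)" by (intro set_integrable_abs set_integral_diff i i')
    show "set_integrable lebesgue S (\<lambda>z. \<eta> * f z)" using f(1) by (rule set_integrable_mult_right)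
    show "AE z\<in>S in lebesgue. \<bar>c' z * f z - c z * f z\<bar> \<le> \<eta> * f z"
      using close f(2)
    proof eventually_elim
      case (elim z)
      show ?case
      proof
        assume z: "z \<in> S"
        then have "\<bar>c' z - c z\<bar> * f z \<le> \<eta> * f z" using elim by (intro mult_right_mono) auto
        then show "\<bar>c' z * f z - c z * f z\<bar> \<le> \<eta> * f z"
          using elim(2) z by (simp add: left_diff_distrib[symmetric] abs_mult)
      qed
    qed
  qed
  finally show ?thesis by simp
qed

text \<open>A Sobolev function on the interior may take arbitrary values on the boundary; these do not matter on a
  null set.\<close>

lemma W1p_borel_measurable:
  fixes S :: "'a::euclidean_space set"
  assumes "closed S" "negligible (frontier S)" "u \<in> W1p p (interior S)"
  shows "set_borel_measurable lebesgue S u"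
proof -
  have m: "(\<lambda>z. indicat_real (interior S) z *\<^sub>R u z) \<in> borel_measurable lebesgue"
    using assms(3) by (simp add: W1p_def Lp_on_def set_borel_measurable_def)
  have "AE z in lebesgue. z \<notin> frontier S"
    using assms(2) by (simp add: AE_not_in negligible_iff_null_sets)
  then have "AE z in lebesgue. indicat_real (interior S) z *\<^sub>R u z = indicat_real S z *\<^sub>R u z"
  proof eventually_elim
    case (elim z)
    then have "z \<in> interior S \<longleftrightarrow> z \<in> S" using assms(1) interior_subset[of S] by (auto simp: frontier_def)
    then show ?case by (simp add: indicator_def)
  qed
  from borel_measurable_AE[OF m this] show ?thesis by (simp add: set_borel_measurable_def)
qed

text \<open>The case of a sequence that converges as a whole; it applies to the subsequence that defines an
  accumulation point.\<close>

lemma limit_feasible: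
  fixes \<Omega>1 :: "'a::euclidean_space set" and \<Omega>2 :: "'b::euclidean_space set"
    and cd :: "'a \<times> 'b \<Rightarrow> real" and cs :: "nat \<Rightarrow> 'a \<times> 'b \<Rightarrow> real"
  assumes \<Omega>: "compact \<Omega>1" "interior \<Omega>1 \<noteq> {}" "compact \<Omega>2" "interior \<Omega>2 \<noteq> {}"
    and lip: "lipschitz_boundary (\<Omega>1 \<times> \<Omega>2)" and \<rho>: "0 < \<rho>"
    and \<mu>2: "\<mu>2d \<in> prob_measures \<Omega>2" "\<rho> \<le> setdist (msupport \<Omega>2 \<mu>2d) (frontier \<Omega>2)"
    and p: "real (DIM('a) + DIM('b)) < p"
    and cd: "cd \<in> W1p p (interior (\<Omega>1 \<times> \<Omega>2))" "continuous_on (\<Omega>1 \<times> \<Omega>2) cd"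
    and \<gamma>: "\<And>n. 0 < \<gamma> n" and \<delta>: "\<And>n. 0 < \<delta> n" "\<And>n. \<delta> n \<le> \<rho>" "\<delta> \<longlonglongrightarrow> 0"
    and \<gamma>\<delta>: "(\<lambda>n. \<gamma> n / \<delta> n ^ (DIM('a) + DIM('b))) \<longlonglongrightarrow> 0"
    and \<pi>s: "\<And>n. \<pi>s n \<in> signed_measures (\<Omega>1 \<times> \<Omega>2)"
    and feas: "\<And>n. (\<pi>s n, \<mu>1s n, cs n) \<in> BK_reg_feasible \<Omega>1 \<Omega>2 p \<rho> \<mu>2d (\<gamma> n) (\<delta> n)"
    and \<pi>: "\<pi> \<in> signed_measures (\<Omega>1 \<times> \<Omega>2)" and \<mu>1: "\<mu>1 \<in> signed_measures \<Omega>1"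
    and lim: "weak_star_tendsto (\<Omega>1 \<times> \<Omega>2) \<pi>s \<pi>" "weak_star_tendsto \<Omega>1 \<mu>1s \<mu>1"
      "W1p_weakly_tendsto p (interior (\<Omega>1 \<times> \<Omega>2)) cs cd"
  shows "(\<pi>, \<mu>1) \<in> BK_feasible \<Omega>1 \<Omega>2 \<rho> \<mu>2d cd"
proof -
  let ?O = "\<Omega>1 \<times> \<Omega>2"
  let ?S1 = "\<lambda>n. smoothing \<Omega>1 (\<delta> n) (\<mu>1s n)" and ?S2 = "\<lambda>n. smoothing \<Omega>2 (\<delta> n) \<mu>2d"
  have O: "compact ?O" using \<Omega>(1,3) by (rule compact_Times)
  have pos: "0 < measure lebesgue \<Omega>1" "0 < measure lebesgue \<Omega>2"
    using \<Omega> by (auto intro: interior_imp_measure_pos)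
  have \<mu>1s: "\<mu>1s n \<in> prob_measures \<Omega>1" and far: "\<rho> \<le> setdist (msupport \<Omega>1 (\<mu>1s n)) (frontier \<Omega>1)"
    and cs: "cs n \<in> W1p p (interior ?O)" for n
    using feas[of n] by (auto simp: BK_reg_feasible_def)
  have "\<forall>n. \<exists>f. is_S \<Omega>1 \<Omega>2 (\<gamma> n) (cs n) (?S1 n) (?S2 n) f \<and> \<pi>s n = density_measure ?O f"
    using feas by (simp add: BK_reg_feasible_def)
  from choice[OF this] obtain f where f: "\<And>n. is_S \<Omega>1 \<Omega>2 (\<gamma> n) (cs n) (?S1 n) (?S2 n) (f n)"
    and \<pi>f: "\<And>n. \<pi>s n = density_measure ?O (f n)" by blast
  have fc: "L2_coupling \<Omega>1 \<Omega>2 (?S1 n) (?S2 n) (f n)" for n using f[of n] by (simp add: is_S_def)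
  have fi: "set_integrable lebesgue ?O (f n)" for n by (rule L2_coupling_integrable[OF \<Omega>(1,3) fc])
  have f0: "AE z in lebesgue. z \<in> ?O \<longrightarrow> 0 \<le> f n z" for n using fc[of n] by (simp add: L2_coupling_def)
  have \<pi>int: "sintegral ?O (\<pi>s n) h = (LINT z:?O|lebesgue. h z * f n z)" if "continuous_on ?O h" for n h
    unfolding \<pi>f using \<pi>s[of n] \<pi>f[of n] that by (intro sintegral_density_measure[OF O fi f0]) simp_all
  have \<pi>lim: "(\<lambda>n. LINT z:?O|lebesgue. h z * f n z) \<longlonglongrightarrow> sintegral ?O \<pi> h" if "continuous_on ?O h" for h
    using lim(1)[unfolded weak_star_tendsto_def, rule_format, OF that] \<pi>int[OF that] by simp
  have \<mu>1p: "\<mu>1 \<in> prob_measures \<Omega>1" by (rule weak_star_limit_prob[OF \<mu>1s \<mu>1 lim(2)])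
  have \<mu>1far: "\<rho> \<le> setdist (msupport \<Omega>1 \<mu>1) (frontier \<Omega>1)"
    by (rule weak_star_limit_support[OF \<Omega>(1) \<mu>1s \<mu>1p lim(2) \<rho> far])
  have \<pi>nn: "nonneg_measure \<pi>"
  proof (rule weak_star_limit_nonneg[OF _ _ \<pi> lim(1)])
    show "ctbl_add ?O (\<pi>s n)" for n by (rule signed_measures_ctbl_add[OF \<pi>s])
    show "0 \<le> \<pi>s n A" for n A unfolding \<pi>f by (rule density_measure_nonneg[OF O fi f0])
  qed
  have closed: "closed \<Omega>1" "closed \<Omega>2" using \<Omega>(1,3) by (auto intro: compact_imp_closed)
  have fst_c: "continuous_on ?O fst" "fst ` ?O \<subseteq> \<Omega>1" and snd_c: "continuous_on ?O snd" "snd ` ?O \<subseteq> \<Omega>2"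
    by (auto intro!: continuous_intros)
  have "pushforward ?O \<Omega>1 fst \<pi> = \<mu>1"
  proof (rule pushforward_eqI[OF \<pi> \<pi>nn \<mu>1 _ closed(1) fst_c])
    show "nonneg_measure \<mu>1" using \<mu>1p by (simp add: prob_measures_def)
    fix g :: "'a \<Rightarrow> real" assume g: "continuous_on \<Omega>1 g"
    have "continuous_on ?O (\<lambda>z. g (fst z))" by (rule continuous_on_compose2[OF g fst_c])
    from \<pi>lim[OF this] have "(\<lambda>n. \<integral>x. g x * ?S1 n x \<partial>lborel_on \<Omega>1) \<longlonglongrightarrow> sintegral ?O \<pi> (\<lambda>z. g (fst z))"
      using L2_coupling_fst[OF \<Omega>(1,3) fc g smoothing_measurable[OF \<mu>1s \<delta>(1)]] by simp
    moreover have "(\<lambda>n. \<integral>x. g x * ?S1 n x \<partial>lborel_on \<Omega>1) \<longlonglongrightarrow> sintegral \<Omega>1 \<mu>1 g"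
      by (rule smoothing_tendsto[OF \<Omega>(1) pos(1) \<mu>1s \<delta> far g]) (use lim(2) g in \<open>simp add: weak_star_tendsto_def\<close>)
    ultimately show "sintegral ?O \<pi> (\<lambda>z. g (fst z)) = sintegral \<Omega>1 \<mu>1 g" by (rule LIMSEQ_unique)
  qed
  moreover have "pushforward ?O \<Omega>2 snd \<pi> = \<mu>2d"
  proof (rule pushforward_eqI[OF \<pi> \<pi>nn _ _ closed(2) snd_c])
    show "\<mu>2d \<in> signed_measures \<Omega>2" "nonneg_measure \<mu>2d" using \<mu>2(1) by (simp_all add: prob_measures_def)
    fix g :: "'b \<Rightarrow> real" assume g: "continuous_on \<Omega>2 g"
    have "continuous_on ?O (\<lambda>z. g (snd z))" by (rule continuous_on_compose2[OF g snd_c])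
    from \<pi>lim[OF this] have "(\<lambda>n. \<integral>y. g y * ?S2 n y \<partial>lborel_on \<Omega>2) \<longlonglongrightarrow> sintegral ?O \<pi> (\<lambda>z. g (snd z))"
      using L2_coupling_snd[OF \<Omega>(1,3) fc g smoothing_measurable[OF \<mu>2(1) \<delta>(1)]] by simp
    moreover have "(\<lambda>n. \<integral>y. g y * ?S2 n y \<partial>lborel_on \<Omega>2) \<longlonglongrightarrow> sintegral \<Omega>2 \<mu>2d g"
      by (rule smoothing_tendsto[OF \<Omega>(3) pos(2) \<mu>2(1) \<delta> \<mu>2(2) g tendsto_const])
    ultimately show "sintegral ?O \<pi> (\<lambda>z. g (snd z)) = sintegral \<Omega>2 \<mu>2d g" by (rule LIMSEQ_unique)
  qed
  ultimately have coupl: "\<pi> \<in> couplings \<Omega>1 \<Omega>2 \<mu>1 \<mu>2d" using \<pi> by (simp add: couplings_def)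
  have meas: "set_borel_measurable lebesgue ?O (cs n)" for n
    by (rule W1p_borel_measurable[OF compact_imp_closed[OF O] lipschitz_boundary_negligible[OF lip] cs])
  have mass: "(LINT z:?O|lebesgue. h z) = 1 + \<delta> n" if "L2_coupling \<Omega>1 \<Omega>2 (?S1 n) (?S2 n) h" for n h
    using L2_coupling_fst[OF \<Omega>(1,3) that, of "\<lambda>_. 1"] smoothing_measurable[OF \<mu>1s \<delta>(1)]
      integral_smoothing[OF \<Omega>(1) pos(1) \<mu>1s \<delta>(1,2) far, of n n] by simp
  have "sintegral ?O \<pi> cd \<le> sintegral ?O \<phi> cd" if \<phi>: "\<phi> \<in> couplings \<Omega>1 \<Omega>2 \<mu>1 \<mu>2d" "nonneg_measure \<phi>" for \<phi>
  proof (rule field_le_epsilon)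
    fix e :: real assume e: "0 < e"
    \<comment> \<open>Replacing \<open>cs n\<close> by \<open>cd\<close> costs at most \<open>\<eta>\<close> times the mass \<open>1 + \<delta> n\<close>; this happens twice, for the minimizer and
      for its competitor.\<close>
    define \<eta> where "\<eta> = e / (4 * (1 + \<rho>))"
    have \<eta>: "0 < \<eta>" using e \<rho> by (simp add: \<eta>_def)
    have "eventually (\<lambda>n. AE z in lebesgue. z \<in> ?O \<longrightarrow> \<bar>cs n z - cd z\<bar> \<le> \<eta>) sequentially"
      by (rule weak_imp_uniform[OF O lip _ cs cd(1) lim(3) \<eta>]) (use p in simp)
    moreover have "eventually (\<lambda>n. \<exists>\<theta>. L2_coupling \<Omega>1 \<Omega>2 (?S1 n) (?S2 n) \<theta>
      \<and> (LINT z:?O|lebesgue. cd z * \<theta> z) \<le> sintegral ?O \<phi> cd + e / 4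
      \<and> \<gamma> n / 2 * (LINT z:?O|lebesgue. (\<theta> z)\<^sup>2) \<le> e / 4) sequentially"
      by (rule recovery[OF \<Omega>(1,3) pos \<mu>1s \<mu>1p \<mu>2(1) lim(2) far \<mu>2(2) \<delta> \<gamma> \<gamma>\<delta> \<phi> cd(2)]) (use e in simp)
    ultimately have "eventually (\<lambda>n. (LINT z:?O|lebesgue. cd z * f n z) \<le> sintegral ?O \<phi> cd + e) sequentially"
    proof eventually_elim
      case (elim n)
      then obtain \<theta> where \<theta>: "L2_coupling \<Omega>1 \<Omega>2 (?S1 n) (?S2 n) \<theta>"
        "(LINT z:?O|lebesgue. cd z * \<theta> z) \<le> sintegral ?O \<phi> cd + e / 4"
        "\<gamma> n / 2 * (LINT z:?O|lebesgue. (\<theta> z)\<^sup>2) \<le> e / 4" by blast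
      have \<theta>i: "set_integrable lebesgue ?O \<theta>" by (rule L2_coupling_integrable[OF \<Omega>(1,3) \<theta>(1)])
      have \<theta>0: "AE z in lebesgue. z \<in> ?O \<longrightarrow> 0 \<le> \<theta> z" using \<theta>(1) by (simp add: L2_coupling_def)
      have "\<eta> * (1 + \<delta> n) \<le> \<eta> * (1 + \<rho>)" using \<eta> \<delta>(2)[of n] by (intro mult_left_mono) auto
      also have "\<dots> = e / 4" using \<rho> by (simp add: \<eta>_def field_simps)
      finally have small: "\<eta> * (1 + \<delta> n) \<le> e / 4" .
      have 1: "(LINT z:?O|lebesgue. cd z * f n z) \<le> (LINT z:?O|lebesgue. cs n z * f n z) + e / 4"
        using perturbed_cost[OF O fi[of n] f0[of n] cd(2) meas elim(1)] small unfolding mass[OF fc] by linarith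
      have 2: "(LINT z:?O|lebesgue. cs n z * \<theta> z) \<le> (LINT z:?O|lebesgue. cd z * \<theta> z) + e / 4"
        using perturbed_cost[OF O \<theta>i \<theta>0 cd(2) meas elim(1)] small unfolding mass[OF \<theta>(1)] by linarith
      have "reg_objective ?O (\<gamma> n) (cs n) (f n) \<le> reg_objective ?O (\<gamma> n) (cs n) \<theta>"
        using f[of n] \<theta>(1) by (simp add: is_S_def)
      moreover have "0 \<le> \<gamma> n / 2 * (LINT z:?O|lebesgue. (f n z)\<^sup>2)"
        using \<gamma>[of n] unfolding set_lebesgue_integral_def
        by (intro mult_nonneg_nonneg integral_nonneg_AE AE_I2) auto
      ultimately show ?case using 1 2 \<theta>(2,3) unfolding reg_objective_def by linarith
    qed
    then have "sintegral ?O \<pi> cd \<le> sintegral ?O \<phi> cd + e"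
      by (intro tendsto_upperbound[OF \<pi>lim[OF cd(2)]]) auto
    then show "sintegral ?O \<pi> cd \<le> sintegral ?O \<phi> cd + e" .
  qed
  then have "kantorovich_optimal \<Omega>1 \<Omega>2 cd \<mu>1 \<mu>2d \<pi>"
    using coupl \<pi>nn by (simp add: kantorovich_optimal_def)
  then show ?thesis using \<mu>1p \<mu>1far by (simp add: BK_feasible_def)
qed

theorem proposition3p3:
  fixes \<Omega>1 :: "'a::euclidean_space set" and \<Omega>2 :: "'b::euclidean_space set"
    and p \<rho> :: real
    and \<mu>2d :: "'b set \<Rightarrow> real" and cd :: "'a \<times> 'b \<Rightarrow> real"
    and \<gamma> \<delta> :: "nat \<Rightarrow> real"
    and \<pi>s :: "nat \<Rightarrow> ('a \<times> 'b) set \<Rightarrow> real" and \<mu>1s :: "nat \<Rightarrow> 'a set \<Rightarrow> real"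
    and cs :: "nat \<Rightarrow> 'a \<times> 'b \<Rightarrow> real"
    and \<pi> :: "('a \<times> 'b) set \<Rightarrow> real" and \<mu>1 :: "'a set \<Rightarrow> real"
  assumes "compact \<Omega>1" and "interior \<Omega>1 \<noteq> {}"
    and "compact \<Omega>2" and "interior \<Omega>2 \<noteq> {}"
    and "\<Omega>1 \<times> \<Omega>2 = closure (interior (\<Omega>1 \<times> \<Omega>2))"
    and "lipschitz_boundary (\<Omega>1 \<times> \<Omega>2)"
    and "0 < \<rho>"
    and "\<mu>2d \<in> prob_measures \<Omega>2" and "\<rho> \<le> setdist (msupport \<Omega>2 \<mu>2d) (frontier \<Omega>2)"
    and "real (DIM('a) + DIM('b)) < p"
    and "cd \<in> W1p p (interior (\<Omega>1 \<times> \<Omega>2))" and "continuous_on (\<Omega>1 \<times> \<Omega>2) cd"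
    and "BK_feasible \<Omega>1 \<Omega>2 \<rho> \<mu>2d cd \<noteq> {}"
    and "\<And>n. 0 < \<gamma> n" and "decseq \<gamma>" and "\<gamma> \<longlonglongrightarrow> 0"
    and "\<And>n. 0 < \<delta> n" and "decseq \<delta>" and "\<delta> \<longlonglongrightarrow> 0"
    and "\<And>n. \<delta> n \<le> \<rho>"
    and "(\<lambda>n. \<gamma> n / \<delta> n ^ (DIM('a) + DIM('b))) \<longlonglongrightarrow> 0"
    and "\<And>n. \<pi>s n \<in> signed_measures (\<Omega>1 \<times> \<Omega>2)"
    and "\<And>n. (\<pi>s n, \<mu>1s n, cs n) \<in> BK_reg_feasible \<Omega>1 \<Omega>2 p \<rho> \<mu>2d (\<gamma> n) (\<delta> n)"
    and "\<pi> \<in> signed_measures (\<Omega>1 \<times> \<Omega>2)" and "\<mu>1 \<in> signed_measures \<Omega>1"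
    and "\<exists>r. strict_mono r \<and>
           weak_star_tendsto (\<Omega>1 \<times> \<Omega>2) (\<pi>s \<circ> r) \<pi> \<and>
           weak_star_tendsto \<Omega>1 (\<mu>1s \<circ> r) \<mu>1 \<and>
           W1p_weakly_tendsto p (interior (\<Omega>1 \<times> \<Omega>2)) (cs \<circ> r) cd"
  shows "(\<pi>, \<mu>1) \<in> BK_feasible \<Omega>1 \<Omega>2 \<rho> \<mu>2d cd"
proof -
  obtain r where r: "strict_mono r"
    and lim: "weak_star_tendsto (\<Omega>1 \<times> \<Omega>2) (\<pi>s \<circ> r) \<pi>" "weak_star_tendsto \<Omega>1 (\<mu>1s \<circ> r) \<mu>1"
      "W1p_weakly_tendsto p (interior (\<Omega>1 \<times> \<Omega>2)) (cs \<circ> r) cd"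
    using assms(26) by blast
  have \<delta>: "(\<delta> \<circ> r) \<longlonglongrightarrow> 0" by (rule LIMSEQ_subseq_LIMSEQ[OF assms(19) r])
  have \<gamma>\<delta>: "(\<lambda>n. (\<gamma> \<circ> r) n / (\<delta> \<circ> r) n ^ (DIM('a) + DIM('b))) \<longlonglongrightarrow> 0"
    using LIMSEQ_subseq_LIMSEQ[OF assms(21) r] by (simp add: o_def)
  have seq: "0 < (\<gamma> \<circ> r) n" "0 < (\<delta> \<circ> r) n" "(\<delta> \<circ> r) n \<le> \<rho>" "(\<pi>s \<circ> r) n \<in> signed_measures (\<Omega>1 \<times> \<Omega>2)"
    "((\<pi>s \<circ> r) n, (\<mu>1s \<circ> r) n, (cs \<circ> r) n) \<in> BK_reg_feasible \<Omega>1 \<Omega>2 p \<rho> \<mu>2d ((\<gamma> \<circ> r) n) ((\<delta> \<circ> r) n)" for n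
    using assms(14,17,20,22,23) by simp_all
  show ?thesis
    by (rule limit_feasible[where \<gamma> = "\<gamma> \<circ> r" and \<delta> = "\<delta> \<circ> r" and \<pi>s = "\<pi>s \<circ> r" and \<mu>1s = "\<mu>1s \<circ> r" and cs = "cs \<circ> r"])
      (fact assms lim \<delta> \<gamma>\<delta> seq)+
qed

end
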